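(* Let $L_0\subseteq L$, $\mathbf{G}=\{\mathcal{G}_n:n\in\mathbb{N}\}$, $\mathbf{K}_n=\mathbf{K}(\mathcal{G}_n)$, $\mathbf{K}=\bigcup_n\mathbf{K}_n$ and the dimension conditional measures $\delta_n$ be as in the context. Let $k>0$. Suppose that $(\mathcal{G}_n:n\in\mathbb{N})$ is uniformly bounded and polynomially $k$-saturated and that $\mathbf{K}$ accepts $k$-substitutions over $L_0$. Then: (i) For every $(k-1)$-extension axiom $\varphi$ of $\mathbf{K}$, $\lim_{n\to\infty}\delta_n(\varphi)=1$, where $\delta_n(\varphi)=\delta_n(\{\mathcal{M}\in\mathbf{K}_n:\mathcal{M}\models\varphi\})$. (ii) $\mathbf{K}$ is polynomially $k$-saturated.
   Context: Setting. $L_0\subseteq L$ are first-order languages with vocabularies $V_0\subseteq V$ such that $V\setminus V_0$ is finite and consists of relation symbols. $\mathbf{G}=\{\mathcal{G}_n:n\in\mathbb{N}\}$ is a set of finite $L_0$-structures; each $\mathcal{G}_n$ carries a closure operator $\mathrm{cl}_{\mathcal{G}_n}$ on its universe making it a pregeometry (matroid), closed sets are closed under the interpretations of function and constant symbols, and there are $L_0$-formulas $\theta_m(x_1,\ldots,x_{m+1})$, $m\in\mathbb{N}$, such that for all $n,m$ and all $a_1,\ldots,a_{m+1}\in G_n$: $a_{m+1}\in\mathrm{cl}_{\mathcal{G}_n}(a_1,\ldots,a_m)$ iff $\mathcal{G}_n\models\theta_m(a_1,\ldots,a_{m+1})$. For each $n$, $\mathbf{K}_n=\mathbf{K}(\mathcal{G}_n)$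 is a set of expansions of $\mathcal{G}_n$ to $L$; $\mathbf{K}=\bigcup_n\mathbf{K}_n$. For $\mathcal{M}\in\mathbf{K}_n$, $\mathrm{cl}_{\mathcal{M}}=\mathrm{cl}_{\mathcal{G}_n}$. A structure is represented (with respect to $\mathbf{K}$) if it is isomorphic to a member of $\mathbf{K}$; its closure operator is the one defined by the formulas $\theta_m$. $\dim_{\mathcal{M}}$ is pregeometry dimension. $\mathcal{A}\subseteq_{cl}\mathcal{M}$ means $\mathcal{A}$ is a substructure of $\mathcal{M}$ with closed universe. Standing assumption: if $\mathcal{M}$ is represented and $\mathcal{A}\subseteq_{cl}\mathcal{M}$, then $\mathcal{A}$ is represented. Structures with empty universe are allowed if there are no constant symbols. Uniformly bounded: there is $u:\mathbb{N}\to\mathbb{N}$ with $|\mathrm{cl}_{\mathcal{G}_n}(X)|\le u(\dim_{\mathcal{G}_n}(X))$ for all $n$ and all $X\subseteq G_n$. Multiplicity and extension axioms: let $\mathcal{A}\subset\mathcal{B}$ be closed substructures of some represented structure. The $\mathcal{B}/\mathcal{A}$-multiplicity of $\mathcal{M}$ is at least $m$ if whenever $\mathcal{A}'\subseteq_{cl}\mathcal{M}$ and $\sigma:\mathcal{A}'\to\mathcal{A}$ is an isomorphism, there are $\mathcal{B}'_i\subseteq_{cl}\mathcal{M}$ and isomorphisms $\sigma_i:\mathcal{B}'_i\to\mathcal{B}$, $i=1,\ldots,m$, with $\mathcal{A}'\subseteq\mathcal{B}'_i$, $\sigma_i\upharpoonright A'=\sigma$ and $B'_i\cap B'_j=A'$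 for $i\neq j$. The $\mathcal{B}/\mathcal{A}$-extension axiom is the (first-order expressible) statement that the $\mathcal{B}/\mathcal{A}$-multiplicity is at least $1$; it is a $k$-extension axiom of $\mathbf{K}$ if $\mathcal{B}$ has dimension at most $k+1$. Polynomial $k$-saturation: let $\mathbf{C}$ be a class of structures that are pregeometries uniformly defined by formulas (here $\mathbf{C}=\mathbf{G}$ or $\mathbf{C}=\mathbf{K}$), with "represented" meaning isomorphic to a member of $\mathbf{C}$. A sequence $(\mathcal{M}_n:n\in\mathbb{N})$ from $\mathbf{C}$ is polynomially $k$-saturated if there are numbers $\lambda_n$ with $\lim_{n\to\infty}\lambda_n=\infty$ and a polynomial $P$ such that for every $n$: (1) $\lambda_n\le|M_n|\le P(\lambda_n)$, and (2) whenever $\mathcal{N}$ is represented, $\mathcal{A}\subset\mathcal{B}\subseteq\mathcal{N}$ are closed in $\mathcal{N}$ and $\dim_{\mathcal{N}}(A)+1=\dim_{\mathcal{N}}(B)\le k$, the $\mathcal{B}/\mathcal{A}$-multiplicity of $\mathcal{M}_n$ is at least $\lambda_n$. $\mathbf{C}$ is polynomially $k$-saturated if there is a polynomially $k$-saturated sequence $(\mathcal{M}_n:n\in\mathbb{N})$ with all $\mathcal{M}_n\in\mathbf{C}$. Acceptance of substitutions: represented $\mathcal{A},\mathcal{A}'$ agree on $L_0$ and on closed proper substructures if $\mathcal{A}\upharpoonright L_0=\mathcal{A}'\upharpoonright L_0$ and $\mathcal{A}\upharpoonright U=\mathcal{A}'\upharpoonright U$ for every closed $U\subseteq A$ with $\dim_{\mathcal{A}}(U)<\dim_{\mathcal{A}}(A)$.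 $\mathbf{K}$ accepts the substitution $[\mathcal{A}\triangleright\mathcal{A}']$ over $L_0$ if whenever $\mathcal{M}$ is represented and $\mathcal{A}\subseteq_{cl}\mathcal{M}$, there is a represented $\mathcal{N}$ such that $\mathcal{N}\upharpoonright L_0=\mathcal{M}\upharpoonright L_0$, $\mathcal{N}\upharpoonright A=\mathcal{A}'$, and if $\mathcal{U}\subseteq_{cl}\mathcal{N}$, $\dim_{\mathcal{N}}(U)\le\dim_{\mathcal{N}}(A')$ and $\mathcal{U}\ne\mathcal{A}'$, then $\mathcal{N}\upharpoonright U=\mathcal{M}\upharpoonright U$. $\mathbf{K}$ accepts $k$-substitutions over $L_0$ if it accepts $[\mathcal{A}\triangleright\mathcal{A}']$ over $L_0$ for all represented $\mathcal{A},\mathcal{A}'$ of dimension at most $k$ which agree on $L_0$ and on closed proper substructures. Dimension conditional measure: for $\mathcal{M}\in\mathbf{K}$ and $d\in\mathbb{N}$, $\mathcal{M}\upharpoonright d$ has the same universe and the same interpretations of symbols in $V_0$, and for $R\in V\setminus V_0$, $\bar a\in R^{\mathcal{M}\upharpoonright d}$ iff $\bar a\in R^{\mathcal{M}}$ and $\dim_{\mathcal{M}}(\bar a)\le d$. $\mathbf{K}_n\upharpoonright d=\{\mathcal{M}\upharpoonright d:\mathcal{M}\in\mathbf{K}_n\}$. $\mathbb{P}_{n,0}$ is the uniform probability measure on $\mathbf{K}_n\upharpoonright 0$, and for $\mathcal{B}\in\mathbf{K}_n\upharpoonright(r+1)$, $\mathbb{P}_{n,r+1}(\mathcal{B})=\mathbb{P}_{n,r}(\mathcal{B}\upharpoonright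 r)\big/\big|\{\mathcal{B}'\in\mathbf{K}_n\upharpoonright(r+1):\mathcal{B}'\upharpoonright r=\mathcal{B}\upharpoonright r\}\big|$. With $\rho$ the largest arity of a relation symbol of $L$ (so $\mathbf{K}_n\upharpoonright\rho=\mathbf{K}_n$), $\delta_n=\mathbb{P}_{n,\rho}$.
   Formalization: Two tacit conventions are added, without which the claim fails: K_n contains every represented expansion of G_n, and for A closed in a represented M the closure operator that the θ_m define in A is the restriction of the one in M. Each K_n is also assumed nonempty. *)

theory Defs
  imports Complex_Main "HOL-Computational_Algebra.Polynomial"
begin

section \<open>Vocabularies, structures, first-order formulas\<close>

text \<open>Constant symbols are the function symbols of arity 0.\<close>

record ('f, 'r) vocab =
  funs :: "'f set"
  fun_arity :: "'f \<Rightarrow> nat"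
  rels :: "'r set"
  rel_arity :: "'r \<Rightarrow> nat"

definition subvocab :: "('f, 'r) vocab \<Rightarrow> ('f, 'r) vocab \<Rightarrow> bool" where
  "subvocab L0 L \<longleftrightarrow>
     funs L0 \<subseteq> funs L \<and> rels L0 \<subseteq> rels L \<and>
     (\<forall>f\<in>funs L0. fun_arity L0 f = fun_arity L f) \<and>
     (\<forall>R\<in>rels L0. rel_arity L0 R = rel_arity L R)"

record ('a, 'f, 'r) struc =
  universe :: "'a set"
  fun_int :: "'f \<Rightarrow> 'a list \<Rightarrow> 'a"
  rel_int :: "'r \<Rightarrow> 'a list set"

text \<open>Interpretations are normalised (to \<^term>\<open>undefined\<close>, respectively the empty set) outside the
  vocabulary and outside the universe, so that HOL equality is equality of structures and a finite
  structure has only finitely many expansions by finitely many relation symbols. The universe may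
  be empty; the condition on function symbols excludes this when there is a constant symbol.\<close>

definition tuples :: "'a set \<Rightarrow> nat \<Rightarrow> 'a list set" where
  "tuples U n = {as. set as \<subseteq> U \<and> length as = n}"

definition is_struc :: "('f, 'r) vocab \<Rightarrow> ('a, 'f, 'r) struc \<Rightarrow> bool" where
  "is_struc L M \<longleftrightarrow>
     (\<forall>f\<in>funs L. \<forall>as\<in>tuples (universe M) (fun_arity L f). fun_int M f as \<in> universe M) \<and>
     (\<forall>f as. \<not> (f \<in> funs L \<and> as \<in> tuples (universe M) (fun_arity L f)) \<longrightarrow>
        fun_int M f as = undefined) \<and>
     (\<forall>R\<in>rels L. rel_int M R \<subseteq> tuples (universe M) (rel_arity L R)) \<and>
     (\<forall>R. R \<notin> rels L \<longrightarrow> rel_int M R = {})"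

definition reduct :: "('f, 'r) vocab \<Rightarrow> ('a, 'f, 'r) struc \<Rightarrow> ('a, 'f, 'r) struc" where
  "reduct L0 M =
     \<lparr> universe = universe M,
       fun_int = (\<lambda>f. if f \<in> funs L0 then fun_int M f else (\<lambda>_. undefined)),
       rel_int = (\<lambda>R. if R \<in> rels L0 then rel_int M R else {}) \<rparr>"

definition restr :: "('a, 'f, 'r) struc \<Rightarrow> 'a set \<Rightarrow> ('a, 'f, 'r) struc" where
  "restr M U =
     \<lparr> universe = U,
       fun_int = (\<lambda>f as. if set as \<subseteq> U then fun_int M f as else undefined),
       rel_int = (\<lambda>R. {as \<in> rel_int M R. set as \<subseteq> U}) \<rparr>"

text \<open>The condition \<^term>\<open>is_struc L A\<close> makes the universe of \<open>A\<close> closed under the functions.\<close>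

definition substruc ::
    "('f, 'r) vocab \<Rightarrow> ('a, 'f, 'r) struc \<Rightarrow> ('a, 'f, 'r) struc \<Rightarrow> bool" where
  "substruc L A M \<longleftrightarrow>
     is_struc L A \<and> is_struc L M \<and> universe A \<subseteq> universe M \<and> A = restr M (universe A)"

definition iso ::
    "('f, 'r) vocab \<Rightarrow> ('a \<Rightarrow> 'a) \<Rightarrow> ('a, 'f, 'r) struc \<Rightarrow> ('a, 'f, 'r) struc \<Rightarrow> bool" where
  "iso L \<sigma> A B \<longleftrightarrow>
     is_struc L A \<and> is_struc L B \<and> bij_betw \<sigma> (universe A) (universe B) \<and>
     (\<forall>f\<in>funs L. \<forall>as\<in>tuples (universe A) (fun_arity L f).
        \<sigma> (fun_int A f as) = fun_int B f (map \<sigma> as)) \<and>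
     (\<forall>R\<in>rels L. \<forall>as\<in>tuples (universe A) (rel_arity L R).
        as \<in> rel_int A R \<longleftrightarrow> map \<sigma> as \<in> rel_int B R)"

datatype 'f tm = Var nat | App 'f "'f tm list"

datatype ('f, 'r) fm =
    Eq "'f tm" "'f tm"
  | Rel 'r "'f tm list"
  | Neg "('f, 'r) fm"
  | Conj "('f, 'r) fm" "('f, 'r) fm"
  | Exi nat "('f, 'r) fm"

fun tm_in :: "('f, 'r) vocab \<Rightarrow> 'f tm \<Rightarrow> bool" where
  "tm_in L (Var i) \<longleftrightarrow> True"
| "tm_in L (App f ts) \<longleftrightarrow>
     f \<in> funs L \<and> length ts = fun_arity L f \<and> (\<forall>t\<in>set ts. tm_in L t)"

primrec fm_in :: "('f, 'r) vocab \<Rightarrow> ('f, 'r) fm \<Rightarrow> bool" where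
  "fm_in L (Eq s t) \<longleftrightarrow> tm_in L s \<and> tm_in L t"
| "fm_in L (Rel R ts) \<longleftrightarrow>
     R \<in> rels L \<and> length ts = rel_arity L R \<and> (\<forall>t\<in>set ts. tm_in L t)"
| "fm_in L (Neg p) \<longleftrightarrow> fm_in L p"
| "fm_in L (Conj p q) \<longleftrightarrow> fm_in L p \<and> fm_in L q"
| "fm_in L (Exi x p) \<longleftrightarrow> fm_in L p"

primrec tm_vars :: "'f tm \<Rightarrow> nat set" where
  "tm_vars (Var i) = {i}"
| "tm_vars (App f ts) = \<Union> (set (map tm_vars ts))"

primrec fm_free :: "('f, 'r) fm \<Rightarrow> nat set" where
  "fm_free (Eq s t) = tm_vars s \<union> tm_vars t"
| "fm_free (Rel R ts) = \<Union> (set (map tm_vars ts))"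
| "fm_free (Neg p) = fm_free p"
| "fm_free (Conj p q) = fm_free p \<union> fm_free q"
| "fm_free (Exi x p) = fm_free p - {x}"

primrec tm_val :: "('a, 'f, 'r) struc \<Rightarrow> (nat \<Rightarrow> 'a) \<Rightarrow> 'f tm \<Rightarrow> 'a" where
  "tm_val M s (Var i) = s i"
| "tm_val M s (App f ts) = fun_int M f (map (tm_val M s) ts)"

primrec sat :: "('a, 'f, 'r) struc \<Rightarrow> (nat \<Rightarrow> 'a) \<Rightarrow> ('f, 'r) fm \<Rightarrow> bool" where
  "sat M s (Eq t u) \<longleftrightarrow> tm_val M s t = tm_val M s u"
| "sat M s (Rel R ts) \<longleftrightarrow> map (tm_val M s) ts \<in> rel_int M R"
| "sat M s (Neg p) \<longleftrightarrow> \<not> sat M s p"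
| "sat M s (Conj p q) \<longleftrightarrow> sat M s p \<and> sat M s q"
| "sat M s (Exi x p) \<longleftrightarrow> (\<exists>a\<in>universe M. sat M (s(x := a)) p)"

text \<open>The formal variables \<open>x\<^sub>1, \<dots>, x\<^sub>m\<close> are \<^term>\<open>Var 0\<close>, \dots, \<^term>\<open>Var (m - 1)\<close>. For a formula whose
  free variables are below the length of \<open>as\<close>, this is satisfaction by the tuple \<open>as\<close>; the
  unspecified values of \<^term>\<open>(!) as\<close> beyond the length are irrelevant then.\<close>

definition sat_tuple :: "('a, 'f, 'r) struc \<Rightarrow> ('f, 'r) fm \<Rightarrow> 'a list \<Rightarrow> bool" where
  "sat_tuple M p as \<longleftrightarrow> sat M (\<lambda>i. as ! i) p"


section \<open>Pregeometries\<close>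

definition pregeometry :: "'a set \<Rightarrow> ('a set \<Rightarrow> 'a set) \<Rightarrow> bool" where
  "pregeometry S cl \<longleftrightarrow>
     (\<forall>X\<subseteq>S. X \<subseteq> cl X \<and> cl X \<subseteq> S \<and> cl (cl X) = cl X) \<and>
     (\<forall>X Y. X \<subseteq> Y \<and> Y \<subseteq> S \<longrightarrow> cl X \<subseteq> cl Y) \<and>
     (\<forall>X\<subseteq>S. \<forall>a\<in>S. \<forall>b\<in>S. a \<in> cl (insert b X) \<and> a \<notin> cl X \<longrightarrow> b \<in> cl (insert a X)) \<and>
     (\<forall>X\<subseteq>S. \<forall>a\<in>cl X. \<exists>Y\<subseteq>X. finite Y \<and> a \<in> cl Y)"

definition independent :: "('a set \<Rightarrow> 'a set) \<Rightarrow> 'a set \<Rightarrow> bool" where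
  "independent cl B \<longleftrightarrow> (\<forall>b\<in>B. b \<notin> cl (B - {b}))"

definition is_basis :: "('a set \<Rightarrow> 'a set) \<Rightarrow> 'a set \<Rightarrow> 'a set \<Rightarrow> bool" where
  "is_basis cl X B \<longleftrightarrow> B \<subseteq> X \<and> independent cl B \<and> X \<subseteq> cl B"

text \<open>In a pregeometry all bases of \<open>X\<close> have the same cardinality; only finite sets are used here.\<close>

definition pdim :: "('a set \<Rightarrow> 'a set) \<Rightarrow> 'a set \<Rightarrow> nat" where
  "pdim cl X = (LEAST d. \<exists>B. is_basis cl X B \<and> finite B \<and> card B = d)"

definition uniformly_bounded ::
    "(nat \<Rightarrow> ('a, 'f, 'r) struc) \<Rightarrow> (nat \<Rightarrow> 'a set \<Rightarrow> 'a set) \<Rightarrow> bool" where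
  "uniformly_bounded G clG \<longleftrightarrow>
     (\<exists>u :: nat \<Rightarrow> nat. \<forall>n. \<forall>X\<subseteq>universe (G n). card (clG n X) \<le> u (pdim (clG n) X))"


section \<open>Represented structures and the closure defined by formulas\<close>

text \<open>In what follows \<open>\<theta> m\<close> is a formula in the variables \<open>x\<^sub>1, \<dots>, x\<^sub>m\<^sub>+\<^sub>1\<close> expressing that
  \<open>x\<^sub>m\<^sub>+\<^sub>1\<close> belongs to the closure of \<open>{x\<^sub>1, \<dots>, x\<^sub>m}\<close>.\<close>

definition closure_by ::
    "(nat \<Rightarrow> ('f, 'r) fm) \<Rightarrow> ('a, 'f, 'r) struc \<Rightarrow> 'a set \<Rightarrow> 'a set" where
  "closure_by \<theta> M X =
     {b \<in> universe M. \<exists>as. set as \<subseteq> X \<and> sat_tuple M (\<theta> (length as)) (as @ [b])}"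

abbreviation dim_in ::
    "(nat \<Rightarrow> ('f, 'r) fm) \<Rightarrow> ('a, 'f, 'r) struc \<Rightarrow> 'a set \<Rightarrow> nat" where
  "dim_in \<theta> M X \<equiv> pdim (closure_by \<theta> M) X"

definition closed_in :: "(nat \<Rightarrow> ('f, 'r) fm) \<Rightarrow> ('a, 'f, 'r) struc \<Rightarrow> 'a set \<Rightarrow> bool" where
  "closed_in \<theta> M U \<longleftrightarrow> U \<subseteq> universe M \<and> closure_by \<theta> M U = U"

definition closed_sub ::
    "('f, 'r) vocab \<Rightarrow> (nat \<Rightarrow> ('f, 'r) fm) \<Rightarrow>
     ('a, 'f, 'r) struc \<Rightarrow> ('a, 'f, 'r) struc \<Rightarrow> bool" where
  "closed_sub L \<theta> A M \<longleftrightarrow> substruc L A M \<and> closed_in \<theta> M (universe A)"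

definition represented ::
    "('f, 'r) vocab \<Rightarrow> ('a, 'f, 'r) struc set \<Rightarrow> ('a, 'f, 'r) struc \<Rightarrow> bool" where
  "represented L C M \<longleftrightarrow> (\<exists>N\<in>C. \<exists>\<sigma>. iso L \<sigma> M N)"

text \<open>A given family of closure operators defined by \<open>\<theta>\<close> on finite structures is recovered by
  \<^const>\<open>closure_by\<close>.\<close>

lemma closure_by_eq:
  assumes "finite (universe M)" "pregeometry (universe M) cl" "X \<subseteq> universe M"
    and def: "\<And>as b. set as \<subseteq> universe M \<Longrightarrow> b \<in> universe M \<Longrightarrow>
      b \<in> cl (set as) \<longleftrightarrow> sat_tuple M (\<theta> (length as)) (as @ [b])"
  shows "closure_by \<theta> M X = cl X"
proof (intro equalityI subsetI)
  have mono: "cl Y \<subseteq> cl X" if "Y \<subseteq> X" for Y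
    using assms(2,3) that unfolding pregeometry_def by metis
  have sub: "cl X \<subseteq> universe M"
    using assms(2,3) unfolding pregeometry_def by metis
  {
  fix b assume "b \<in> closure_by \<theta> M X"
  then obtain as where as: "b \<in> universe M" "set as \<subseteq> X"
      "sat_tuple M (\<theta> (length as)) (as @ [b])"
    by (auto simp: closure_by_def)
  then have "b \<in> cl (set as)" using def assms(3) by blast
  then show "b \<in> cl X" using mono[OF as(2)] by blast
  }
  fix b assume b: "b \<in> cl X"
  then have bM: "b \<in> universe M" using sub by blast
  obtain as where "set as = X"
    using finite_list finite_subset[OF assms(3,1)] by blast
  then show "b \<in> closure_by \<theta> M X"
    using b bM def[of as b] assms(3) by (auto simp: closure_by_def)
qed


section \<open>Multiplicity, extension axioms, saturation\<close>

definition mult_at_least ::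
    "('f, 'r) vocab \<Rightarrow> (nat \<Rightarrow> ('f, 'r) fm) \<Rightarrow> ('a, 'f, 'r) struc \<Rightarrow> ('a, 'f, 'r) struc \<Rightarrow>
     ('a, 'f, 'r) struc \<Rightarrow> nat \<Rightarrow> bool" where
  "mult_at_least L \<theta> A B M m \<longleftrightarrow>
     (\<forall>A' \<sigma>. closed_sub L \<theta> A' M \<and> iso L \<sigma> A' A \<longrightarrow>
        (\<exists>B' \<tau>.
           (\<forall>i\<in>{1..m}. closed_sub L \<theta> (B' i) M \<and> iso L (\<tau> i) (B' i) B \<and>
              substruc L A' (B' i) \<and> (\<forall>x\<in>universe A'. \<tau> i x = \<sigma> x)) \<and>
           (\<forall>i\<in>{1..m}. \<forall>j\<in>{1..m}. i \<noteq> j \<longrightarrow>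
              universe (B' i) \<inter> universe (B' j) = universe A')))"

text \<open>\<open>M\<close> satisfies the \<open>B/A\<close>-extension axiom. The axiom is identified with the property of
  structures it expresses.\<close>

definition sat_ext_axiom ::
    "('f, 'r) vocab \<Rightarrow> (nat \<Rightarrow> ('f, 'r) fm) \<Rightarrow> ('a, 'f, 'r) struc \<Rightarrow> ('a, 'f, 'r) struc \<Rightarrow>
     ('a, 'f, 'r) struc \<Rightarrow> bool" where
  "sat_ext_axiom L \<theta> A B M \<longleftrightarrow> mult_at_least L \<theta> A B M 1"

text \<open>The \<open>B/A\<close>-extension axiom is a \<open>k\<close>-extension axiom of \<open>C\<close>.\<close>

definition ext_axiom_pair ::
    "('f, 'r) vocab \<Rightarrow> (nat \<Rightarrow> ('f, 'r) fm) \<Rightarrow> ('a, 'f, 'r) struc set \<Rightarrow> nat \<Rightarrow>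
     ('a, 'f, 'r) struc \<Rightarrow> ('a, 'f, 'r) struc \<Rightarrow> bool" where
  "ext_axiom_pair L \<theta> C k A B \<longleftrightarrow>
     (\<exists>N. represented L C N \<and> closed_sub L \<theta> A N \<and> closed_sub L \<theta> B N) \<and>
     universe A \<subset> universe B \<and> dim_in \<theta> B (universe B) \<le> k + 1"

definition poly_saturated_seq ::
    "('f, 'r) vocab \<Rightarrow> (nat \<Rightarrow> ('f, 'r) fm) \<Rightarrow> ('a, 'f, 'r) struc set \<Rightarrow> nat \<Rightarrow>
     (nat \<Rightarrow> ('a, 'f, 'r) struc) \<Rightarrow> bool" where
  "poly_saturated_seq L \<theta> C k M \<longleftrightarrow>
     (\<forall>n. M n \<in> C) \<and>
     (\<exists>(l :: nat \<Rightarrow> nat) (P :: real poly).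
        filterlim l at_top sequentially \<and>
        (\<forall>n. l n \<le> card (universe (M n)) \<and>
             real (card (universe (M n))) \<le> poly P (real (l n)) \<and>
             (\<forall>N A B.
                represented L C N \<and> closed_sub L \<theta> A N \<and> closed_sub L \<theta> B N \<and>
                universe A \<subset> universe B \<and>
                dim_in \<theta> N (universe A) + 1 = dim_in \<theta> N (universe B) \<and>
                dim_in \<theta> N (universe B) \<le> k \<longrightarrow>
                mult_at_least L \<theta> A B (M n) (l n))))"

definition poly_saturated ::
    "('f, 'r) vocab \<Rightarrow> (nat \<Rightarrow> ('f, 'r) fm) \<Rightarrow> ('a, 'f, 'r) struc set \<Rightarrow> nat \<Rightarrow> bool" where
  "poly_saturated L \<theta> C k \<longleftrightarrow> (\<exists>M. poly_saturated_seq L \<theta> C k M)"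


section \<open>Substitutions\<close>

definition agree_proper ::
    "('f, 'r) vocab \<Rightarrow> (nat \<Rightarrow> ('f, 'r) fm) \<Rightarrow>
     ('a, 'f, 'r) struc \<Rightarrow> ('a, 'f, 'r) struc \<Rightarrow> bool" where
  "agree_proper L0 \<theta> A A' \<longleftrightarrow>
     reduct L0 A = reduct L0 A' \<and>
     (\<forall>U. closed_in \<theta> A U \<and> dim_in \<theta> A U < dim_in \<theta> A (universe A) \<longrightarrow>
        restr A U = restr A' U)"

definition accepts_subst ::
    "('f, 'r) vocab \<Rightarrow> ('f, 'r) vocab \<Rightarrow> (nat \<Rightarrow> ('f, 'r) fm) \<Rightarrow> ('a, 'f, 'r) struc set \<Rightarrow>
     ('a, 'f, 'r) struc \<Rightarrow> ('a, 'f, 'r) struc \<Rightarrow> bool" where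
  "accepts_subst L0 L \<theta> C A A' \<longleftrightarrow>
     (\<forall>M. represented L C M \<and> closed_sub L \<theta> A M \<longrightarrow>
        (\<exists>N. represented L C N \<and> reduct L0 N = reduct L0 M \<and> restr N (universe A) = A' \<and>
           (\<forall>U. closed_sub L \<theta> U N \<and> dim_in \<theta> N (universe U) \<le> dim_in \<theta> N (universe A') \<and>
              U \<noteq> A' \<longrightarrow> restr N (universe U) = restr M (universe U))))"

definition accepts_k_substs ::
    "('f, 'r) vocab \<Rightarrow> ('f, 'r) vocab \<Rightarrow> (nat \<Rightarrow> ('f, 'r) fm) \<Rightarrow> ('a, 'f, 'r) struc set \<Rightarrow>
     nat \<Rightarrow> bool" where
  "accepts_k_substs L0 L \<theta> C k \<longleftrightarrow>
     (\<forall>A A'. represented L C A \<and> represented L C A' \<and>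
        dim_in \<theta> A (universe A) \<le> k \<and> dim_in \<theta> A' (universe A') \<le> k \<and>
        agree_proper L0 \<theta> A A' \<longrightarrow> accepts_subst L0 L \<theta> C A A')"


section \<open>The dimension conditional measure\<close>

definition trunc ::
    "('f, 'r) vocab \<Rightarrow> (nat \<Rightarrow> ('f, 'r) fm) \<Rightarrow> nat \<Rightarrow>
     ('a, 'f, 'r) struc \<Rightarrow> ('a, 'f, 'r) struc" where
  "trunc L0 \<theta> d M =
     M\<lparr>rel_int := (\<lambda>R. if R \<in> rels L0 then rel_int M R
                        else {as \<in> rel_int M R. dim_in \<theta> M (set as) \<le> d})\<rparr>"

text \<open>For \<open>Kn\<close> a finite nonempty set of expansions of one structure and \<open>B \<in> trunc L0 \<theta> r ` Kn\<close>,
  \<open>dc_mass L0 \<theta> Kn r B\<close> is the probability of the point \<open>B\<close>; other arguments are not used.\<close>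

primrec dc_mass ::
    "('f, 'r) vocab \<Rightarrow> (nat \<Rightarrow> ('f, 'r) fm) \<Rightarrow> ('a, 'f, 'r) struc set \<Rightarrow> nat \<Rightarrow>
     ('a, 'f, 'r) struc \<Rightarrow> real" where
  "dc_mass L0 \<theta> Kn 0 B = 1 / real (card (trunc L0 \<theta> 0 ` Kn))"
| "dc_mass L0 \<theta> Kn (Suc r) B =
     dc_mass L0 \<theta> Kn r (trunc L0 \<theta> r B) /
     real (card {B' \<in> trunc L0 \<theta> (Suc r) ` Kn. trunc L0 \<theta> r B' = trunc L0 \<theta> r B})"

text \<open>When \<open>\<rho>\<close> bounds the arities of the relation symbols outside \<open>L0\<close>, every \<open>M \<in> Kn\<close> is equal to
  \<open>trunc L0 \<theta> \<rho> M\<close>, and this is the probability of \<open>{M \<in> Kn. \<phi> M}\<close>.\<close>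

definition dc_prob ::
    "('f, 'r) vocab \<Rightarrow> (nat \<Rightarrow> ('f, 'r) fm) \<Rightarrow> ('a, 'f, 'r) struc set \<Rightarrow> nat \<Rightarrow>
     (('a, 'f, 'r) struc \<Rightarrow> bool) \<Rightarrow> real" where
  "dc_prob L0 \<theta> Kn \<rho> \<phi> = (\<Sum>M\<in>{M \<in> Kn. \<phi> M}. dc_mass L0 \<theta> Kn \<rho> M)"

end

theory Submission
  imports Defs
begin

text \<open>
  The truncations to dimension \<open>0, 1, \<dots>, \<rho>\<close> turn the random structure into a process in which each
  step is uniform on the fibre over the previous one. Fix a closed set \<open>A\<close> and copies \<open>B\<^sub>i\<close>
  (\<open>i \<in> I\<close>) of a one-step extension, provided by the saturation of the underlying structures and
  pairwise meeting in \<open>A\<close>. Within a fibre, consider the class of the structures that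
  differ from a given one only on tuples inside \<open>B\<^sub>i\<close> and not inside \<open>A\<close>. Its size is bounded by a
  constant \<open>C\<close>, because closures are uniformly bounded, and by acceptance of substitutions it
  contains a structure in which \<open>B\<^sub>i\<close> is correct up to the next dimension. Changing \<open>B\<^sub>i\<close> does not
  affect the other copies, so
  \<open>1[A correct up to r] * (\<Prod>i\<in>I. 1 - C\<^bsup>r-\<rho>\<^esup> * 1[B\<^sub>i correct up to r])\<close> is a supermartingale,
  and the probability that \<open>A\<close> is correct but all \<open>B\<^sub>i\<close> fail is at most \<open>(1 - C\<^bsup>-\<rho>\<^esup>) ^ card I\<close>.

  If there are \<open>\<lambda>\<close> copies, they are split into about \<open>\<surd>\<lambda>\<close> groups of about \<open>\<surd>\<lambda>\<close> copies. Up to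
  isomorphism over \<open>A\<close>, the one-step extension problems in the \<open>n\<close>-th structure are structures on closed
  sets of bounded size, hence polynomially many in \<open>\<lambda>\<close> (even if the vocabulary is infinite), and the
  union bound shows that with probability tending to 1 every one of them has multiplicity at least
  about \<open>\<surd>\<lambda>\<close>.
\<close>

section \<open>Finite pregeometries\<close>

locale finite_pregeometry =
  fixes S :: "'a set" and cl :: "'a set \<Rightarrow> 'a set"
  assumes pregeometry: "pregeometry S cl" and finite_carrier: "finite S"
begin

lemma cl_extensive: "X \<subseteq> S \<Longrightarrow> X \<subseteq> cl X"
  and cl_sub: "X \<subseteq> S \<Longrightarrow> cl X \<subseteq> S"
  and cl_idem: "X \<subseteq> S \<Longrightarrow> cl (cl X) = cl X"
  and cl_mono: "X \<subseteq> Y \<Longrightarrow> Y \<subseteq> S \<Longrightarrow> cl X \<subseteq> cl Y"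
  and cl_exchange: "X \<subseteq> S \<Longrightarrow> a \<in> S \<Longrightarrow> b \<in> S \<Longrightarrow> a \<in> cl (insert b X) \<Longrightarrow> a \<notin> cl X \<Longrightarrow>
    b \<in> cl (insert a X)"
  using pregeometry unfolding pregeometry_def by metis+

lemma cl_least: "X \<subseteq> cl Y \<Longrightarrow> Y \<subseteq> S \<Longrightarrow> cl X \<subseteq> cl Y"
  using cl_mono[of X "cl Y"] cl_sub cl_idem by metis

lemma independent_insert:
  assumes "independent cl I" "I \<subseteq> S" "a \<in> S" "a \<notin> cl I"
  shows "independent cl (insert a I)"
  unfolding independent_def
proof
  fix b assume b: "b \<in> insert a I"
  have aI: "a \<notin> I" using assms cl_extensive by blast
  show "b \<notin> cl (insert a I - {b})"
  proof (cases "b = a")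
    case True
    then show ?thesis using aI assms by auto
  next
    case False
    then have bI: "b \<in> I" using b by simp
    have eq: "insert a I - {b} = insert a (I - {b})" using False by auto
    have "b \<notin> cl (I - {b})" using assms(1) bI unfolding independent_def by blast
    then show ?thesis
      using cl_exchange[of "I - {b}" b a] assms bI eq by (auto simp: insert_absorb)
  qed
qed

lemma independent_mono:
  assumes "independent cl I" "J \<subseteq> I" "I \<subseteq> S"
  shows "independent cl J"
  unfolding independent_def
proof
  fix b assume b: "b \<in> J"
  then have "b \<notin> cl (I - {b})" using assms unfolding independent_def by blast
  moreover have "cl (J - {b}) \<subseteq> cl (I - {b})" using assms by (intro cl_mono) auto
  ultimately show "b \<notin> cl (J - {b})" by blast
qed

text \<open>Exchange one element at a time: some \<open>b\<close> in \<open>I - A\<close> is traded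
  for an \<open>a\<close> in \<open>A\<close> outside \<open>cl (I - {b})\<close>. Such an
  \<open>a\<close> exists, since otherwise \<open>cl A\<close>, and with it \<open>b\<close>, would
  lie in \<open>cl (I - {b})\<close>. The trade keeps independence and cardinality and shrinks
  \<open>I - A\<close>.\<close>

lemma steinitz:
  assumes "independent cl I" "I \<subseteq> cl A" "I \<subseteq> S" "A \<subseteq> S"
  shows "card I \<le> card A"
  using assms
proof (induction "card (I - A)" arbitrary: I rule: less_induct)
  case less
  have fin: "finite I" "finite A" using less.prems finite_carrier finite_subset by blast+
  show ?case
  proof (cases "I \<subseteq> A")
    case True
    then show ?thesis using fin card_mono by blast
  next
    case False
    then obtain b where b: "b \<in> I" "b \<notin> A" by blast
    let ?J = "I - {b}"
    have "b \<notin> cl ?J" using less.prems b unfolding independent_def by blast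
    then have "\<not> A \<subseteq> cl ?J"
      using cl_least[of A ?J] less.prems b by blast
    then obtain a where a: "a \<in> A" "a \<notin> cl ?J" by blast
    have aJ: "a \<notin> ?J" using a cl_extensive[of ?J] less.prems by blast
    have "independent cl ?J" "?J \<subseteq> S" "a \<in> S"
      using independent_mono[OF less.prems(1) _ less.prems(3), of ?J] less.prems(3,4) a by auto
    then have ind: "independent cl (insert a ?J)" using independent_insert a(2) by metis
    have "insert a ?J - A \<subset> I - A" using a(1) b by auto
    then have "card (insert a ?J - A) < card (I - A)"
      using fin by (intro psubset_card_mono) auto
    moreover have "insert a ?J \<subseteq> cl A" "insert a ?J \<subseteq> S"
      using less.prems(2-4) a cl_extensive[OF less.prems(4)] by auto
    ultimately have "card (insert a ?J) \<le> card A"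
      using less.hyps[of "insert a ?J"] ind less.prems(4) by metis
    moreover have "card (insert a ?J) = card I"
      using aJ b fin by (metis card.insert card.remove finite_Diff)
    ultimately show ?thesis by simp
  qed
qed

lemma basis_exists:
  assumes "X \<subseteq> S"
  shows "\<exists>B. is_basis cl X B"
proof -
  have "finite X" using assms finite_carrier finite_subset by blast
  then show ?thesis using assms
  proof (induction X)
    case empty
    then show ?case by (auto simp: is_basis_def independent_def)
  next
    case (insert a X)
    then obtain B where B: "is_basis cl X B" by auto
    show ?case
    proof (cases "a \<in> cl B")
      case True
      then show ?thesis using B unfolding is_basis_def by blast
    next
      case False
      have BS: "B \<subseteq> S" using B insert.prems unfolding is_basis_def by blast
      have "cl B \<subseteq> cl (insert a B)" "insert a B \<subseteq> cl (insert a B)"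
        using BS insert.prems cl_mono[of B "insert a B"] cl_extensive[of "insert a B"] by auto
      then have "is_basis cl (insert a X) (insert a B)"
        using B independent_insert[of B a] False BS insert.prems unfolding is_basis_def by blast
      then show ?thesis by blast
    qed
  qed
qed

lemma pdim_eq_card:
  assumes "is_basis cl X B" "X \<subseteq> S"
  shows "pdim cl X = card B"
proof -
  have eq: "card B' = card B" if "is_basis cl X B'" for B'
  proof -
    have "independent cl B" "independent cl B'" "B \<subseteq> X" "B' \<subseteq> X" "X \<subseteq> cl B" "X \<subseteq> cl B'"
      using that assms(1) unfolding is_basis_def by auto
    then show ?thesis
      using assms(2) steinitz[of B B'] steinitz[of B' B] by (meson antisym subset_trans)
  qed
  have "finite B" using assms finite_carrier unfolding is_basis_def by (meson finite_subset)
  then show ?thesis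
    unfolding pdim_def
  proof (intro Least_equality)
    show "\<exists>B'. is_basis cl X B' \<and> finite B' \<and> card B' = card B"
      using assms(1) \<open>finite B\<close> by blast
    fix d assume "\<exists>B'. is_basis cl X B' \<and> finite B' \<and> card B' = d"
    then obtain B' where "is_basis cl X B'" "card B' = d" by blast
    then show "card B \<le> d" using eq[of B'] by simp
  qed
qed

lemma pdim_basis:
  assumes "X \<subseteq> S"
  obtains B where "is_basis cl X B" "B \<subseteq> X" "B \<subseteq> S" "X \<subseteq> cl B" "card B = pdim cl X"
proof -
  obtain B where B: "is_basis cl X B" using basis_exists[OF assms] by blast
  then have "B \<subseteq> X" "X \<subseteq> cl B" unfolding is_basis_def by auto
  then show thesis using that[OF B] pdim_eq_card[OF B assms] assms by (metis subset_trans)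
qed

text \<open>A basis of \<open>X\<close> is independent and lies in the closure of a basis of
  \<open>Y\<close>, so the exchange lemma compares their sizes. The form
  \<open>X \<subseteq> cl Y\<close> lets the lemma serve for closures as well as for
  subsets.\<close>

lemma pdim_mono:
  assumes "X \<subseteq> cl Y" "Y \<subseteq> S"
  shows "pdim cl X \<le> pdim cl Y"
proof -
  have XS: "X \<subseteq> S" using assms cl_sub by blast
  obtain B where B: "is_basis cl X B" "B \<subseteq> X" "card B = pdim cl X" "B \<subseteq> S"
    using pdim_basis[OF XS] by metis
  obtain C where C: "Y \<subseteq> cl C" "card C = pdim cl Y" "C \<subseteq> S"
    using pdim_basis[OF assms(2)] by metis
  have "B \<subseteq> cl C" using B(2) assms(1) cl_least[OF C(1,3)] by blast
  then show ?thesis using steinitz[of B C] B C unfolding is_basis_def by metis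
qed

lemma pdim_cl: "X \<subseteq> S \<Longrightarrow> pdim cl (cl X) = pdim cl X"
  by (intro antisym pdim_mono) (auto dest: cl_extensive cl_sub simp: cl_idem)

lemma pdim_le_card:
  assumes "X \<subseteq> S" shows "pdim cl X \<le> card X"
proof -
  have "finite X" using assms finite_carrier finite_subset by blast
  then show ?thesis using pdim_basis[OF assms] card_mono by metis
qed

lemma pdim_0:
  assumes "pdim cl X = 0" "X \<subseteq> S" shows "X \<subseteq> cl {}"
proof -
  obtain B where "X \<subseteq> cl B" "card B = 0" "B \<subseteq> S" using pdim_basis[OF assms(2)] assms(1) by metis
  moreover from this have "B = {}" using finite_subset[OF _ finite_carrier] by (metis card_eq_0_iff)
  ultimately show ?thesis by simp
qed

text \<open>A basis of \<open>A\<close> together with \<open>b\<close> is a basis of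
  \<open>insert b A\<close>. This supplies the one-dimensional steps into which an extension is
  decomposed in \<open>extension_axiom\<close>.\<close>

lemma pdim_insert:
  assumes "A \<subseteq> S" "cl A = A" "b \<in> S" "b \<notin> A"
  shows "pdim cl (cl (insert b A)) = pdim cl A + 1"
proof -
  obtain B where B: "is_basis cl A B" "B \<subseteq> A" "B \<subseteq> S" "A \<subseteq> cl B" "card B = pdim cl A"
    using pdim_basis[OF assms(1)] by metis
  have bB: "b \<notin> cl B" using cl_mono[OF B(2) assms(1)] assms by blast
  have "is_basis cl (insert b A) (insert b B)"
  proof -
    have "cl B \<subseteq> cl (insert b B)" "insert b B \<subseteq> cl (insert b B)"
      using B assms cl_mono[of B "insert b B"] cl_extensive[of "insert b B"] by auto
    moreover have "independent cl (insert b B)"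
      using B(1) independent_insert[OF _ B(3) assms(3) bB] unfolding is_basis_def by blast
    ultimately show ?thesis using B unfolding is_basis_def by blast
  qed
  then have "pdim cl (insert b A) = card (insert b B)"
    using assms(1,3) by (intro pdim_eq_card) auto
  also have "\<dots> = card B + 1"
  proof -
    have "b \<notin> B" using bB cl_extensive[OF B(3)] by blast
    then show ?thesis using finite_subset[OF B(3) finite_carrier] by simp
  qed
  finally show ?thesis using pdim_cl[of "insert b A"] assms(1,3) unfolding B(5) by simp
qed

text \<open>A closed set of dimension at most \<open>d\<close> is the closure of the entries of a
  list of length at most \<open>d\<close>, so such lists are counted instead. The bound is
  polynomial in \<open>card S\<close>, which is what the union bound requires.\<close>

lemma card_closed_sets:
  "card {U. U \<subseteq> S \<and> cl U = U \<and> pdim cl U \<le> d} \<le> (d + 1) * (card S + 1) ^ d"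
proof -
  let ?L = "{xs. set xs \<subseteq> S \<and> length xs \<le> d}"
  have "{U. U \<subseteq> S \<and> cl U = U \<and> pdim cl U \<le> d} \<subseteq> (\<lambda>xs. cl (set xs)) ` ?L"
  proof
    fix U assume "U \<in> {U. U \<subseteq> S \<and> cl U = U \<and> pdim cl U \<le> d}"
    then have U: "U \<subseteq> S" "cl U = U" "pdim cl U \<le> d" by auto
    obtain B where B: "B \<subseteq> U" "B \<subseteq> S" "U \<subseteq> cl B" "card B = pdim cl U"
      using pdim_basis[OF U(1)] by metis
    have "U = cl B" using B U cl_mono[OF B(1) U(1)] by blast
    moreover obtain xs where "set xs = B" "distinct xs"
      using finite_distinct_list B(2) finite_carrier finite_subset by metis
    moreover from this have "length xs \<le> d" using distinct_card[of xs] B(4) U(3) by simp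
    ultimately show "U \<in> (\<lambda>xs. cl (set xs)) ` ?L" using B(2) by blast
  qed
  moreover have fin: "finite ?L" using finite_lists_length_le[OF finite_carrier] .
  ultimately have "card {U. U \<subseteq> S \<and> cl U = U \<and> pdim cl U \<le> d} \<le> card ?L"
    by (meson card_image_le card_mono finite_imageI le_trans)
  also have "card ?L = (\<Sum>i\<le>d. card S ^ i)"
    using card_lists_length_le[OF finite_carrier] .
  \<comment> \<open>The base is raised to \<open>card S + 1\<close> so that its powers increase with
    the exponent even if \<open>S\<close> is empty.\<close>
  also have "\<dots> \<le> (\<Sum>i\<le>d. (card S + 1) ^ d)"
  proof (intro sum_mono)
    fix i assume "i \<in> {..d}"
    have "card S ^ i \<le> (card S + 1) ^ i" by (intro power_mono) auto
    also have "\<dots> \<le> (card S + 1) ^ d" using \<open>i \<in> {..d}\<close> by (intro power_increasing) auto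
    finally show "card S ^ i \<le> (card S + 1) ^ d" .
  qed
  finally show ?thesis by simp
qed

end

section \<open>Transfer of closure operators and dimensions along injections\<close>

lemma inj_on_image_subset_iff:
  "inj_on f S \<Longrightarrow> X \<subseteq> S \<Longrightarrow> Y \<subseteq> S \<Longrightarrow> f ` X \<subseteq> f ` Y \<longleftrightarrow> X \<subseteq> Y"
  using inj_on_image_mem_iff by (smt (verit, best) image_mono imageI subset_iff)

text \<open>Each axiom for \<open>cl\<close> is the same axiom for \<open>cl'\<close> on images,
  read back through \<open>f\<close>. Represented structures are only isomorphic to members of the
  class, and this is how they become pregeometries.\<close>

lemma pregeometry_transfer:
  assumes pg: "pregeometry S' cl'" and f: "bij_betw f S S'"
    and cl: "\<And>X. X \<subseteq> S \<Longrightarrow> cl' (f ` X) = f ` cl X" and sub: "\<And>X. cl X \<subseteq> S"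
  shows "pregeometry S cl"
proof -
  have inj: "inj_on f S" and im: "\<And>X. X \<subseteq> S \<Longrightarrow> f ` X \<subseteq> S'"
    using f by (auto simp: bij_betw_def)
  have P1: "\<And>X. X \<subseteq> S' \<Longrightarrow> X \<subseteq> cl' X \<and> cl' X \<subseteq> S' \<and> cl' (cl' X) = cl' X"
    and P2: "\<And>X Y. X \<subseteq> Y \<Longrightarrow> Y \<subseteq> S' \<Longrightarrow> cl' X \<subseteq> cl' Y"
    and P3: "\<And>X a b. X \<subseteq> S' \<Longrightarrow> a \<in> S' \<Longrightarrow> b \<in> S' \<Longrightarrow> a \<in> cl' (insert b X) \<Longrightarrow> a \<notin> cl' X \<Longrightarrow>
      b \<in> cl' (insert a X)"
    and P4: "\<And>X a. X \<subseteq> S' \<Longrightarrow> a \<in> cl' X \<Longrightarrow> \<exists>Y\<subseteq>X. finite Y \<and> a \<in> cl' Y"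
    using pg unfolding pregeometry_def by metis+
  have mem: "a \<in> cl X \<longleftrightarrow> f a \<in> cl' (f ` X)" if "X \<subseteq> S" "a \<in> S" for a X
    using cl[OF that(1)] inj_on_image_mem_iff[OF inj that(2) sub] by simp
  show ?thesis
    unfolding pregeometry_def
  proof (intro conjI allI impI ballI)
    fix X assume X: "X \<subseteq> S"
    show "X \<subseteq> cl X" using mem[OF X] P1[OF im[OF X]] X by auto
    show "cl X \<subseteq> S" by (rule sub)
    have "f ` cl (cl X) = f ` cl X"
      using cl[of "cl X"] cl[OF X] sub P1[OF im[OF X]] by simp
    then show "cl (cl X) = cl X" using inj_on_image_eq_iff[OF inj] sub by blast
  next
    fix X Y assume "X \<subseteq> Y \<and> Y \<subseteq> S"
    then have XY: "X \<subseteq> S" "Y \<subseteq> S" "X \<subseteq> Y" by auto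
    have "f ` cl X \<subseteq> f ` cl Y"
      using P2[OF image_mono[OF XY(3)] im[OF XY(2)]] unfolding cl[OF XY(1)] cl[OF XY(2)] .
    then show "cl X \<subseteq> cl Y" using inj_on_image_subset_iff[OF inj] sub by blast
  next
    fix X a b assume *: "X \<subseteq> S" "a \<in> S" "b \<in> S" "a \<in> cl (insert b X) \<and> a \<notin> cl X"
    then show "b \<in> cl (insert a X)"
      using mem[of "insert b X" a] mem[of X a] mem[of "insert a X" b] P3[OF im[OF *(1)], of "f a" "f b"] im
      by auto
  next
    fix X a assume *: "X \<subseteq> S" "a \<in> cl X"
    then have a: "a \<in> S" using sub by blast
    obtain Y where Y: "Y \<subseteq> f ` X" "finite Y" "f a \<in> cl' Y"
      using P4[OF im[OF *(1)], of "f a"] mem[OF *(1) a] * by blast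
    then obtain Z where "Z \<subseteq> X" "finite Z" "Y = f ` Z" using finite_subset_image by metis
    then show "\<exists>Y\<subseteq>X. finite Y \<and> a \<in> cl Y"
      using mem[of Z a] * a Y by blast
  qed
qed

text \<open>Inside \<open>S\<close>, the map \<open>f\<close> matches the bases of \<open>X\<close>
  with the bases of its image and preserves their cardinalities.\<close>

lemma pdim_transfer:
  assumes f: "inj_on f S" and cl: "\<And>X. X \<subseteq> S \<Longrightarrow> cl' (f ` X) = f ` cl X"
    and sub: "\<And>X. cl X \<subseteq> S" and X: "X \<subseteq> S"
  shows "pdim cl' (f ` X) = pdim cl X"
proof -
  have iff: "is_basis cl' (f ` X) (f ` B) \<longleftrightarrow> is_basis cl X B" if B: "B \<subseteq> S" for B
  proof -
    have "f b \<in> cl' (f ` B - {f b}) \<longleftrightarrow> b \<in> cl (B - {b})" if "b \<in> B" for b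
    proof -
      have "f ` B - {f b} = f ` (B - {b})"
        using f B that by (subst inj_on_image_set_diff[OF f]) auto
      then have "cl' (f ` B - {f b}) = f ` cl (B - {b})" using cl[of "B - {b}"] B by force
      moreover have "b \<in> S" using B that by blast
      ultimately show ?thesis using inj_on_image_mem_iff[OF f _ sub] by blast
    qed
    moreover have "f ` X \<subseteq> cl' (f ` B) \<longleftrightarrow> X \<subseteq> cl B"
      using cl[OF B] inj_on_image_subset_iff[OF f X sub] by simp
    ultimately show ?thesis
      unfolding is_basis_def independent_def using inj_on_image_subset_iff[OF f B X] by auto
  qed
  have "(\<exists>B. is_basis cl' (f ` X) B \<and> finite B \<and> card B = d) \<longleftrightarrow>
      (\<exists>B. is_basis cl X B \<and> finite B \<and> card B = d)" for d
  proof
    assume "\<exists>B. is_basis cl' (f ` X) B \<and> finite B \<and> card B = d"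
    then obtain B where B: "is_basis cl' (f ` X) B" "finite B" "card B = d" by blast
    then have "B \<subseteq> f ` X" by (simp add: is_basis_def)
    then obtain C where C: "C \<subseteq> X" "B = f ` C" using subset_imageE by metis
    moreover have "inj_on f C" using f X C inj_on_subset by blast
    ultimately show "\<exists>B. is_basis cl X B \<and> finite B \<and> card B = d"
      using B iff[of C] X by (intro exI[of _ C]) (auto simp: card_image finite_image_iff)
  next
    assume "\<exists>B. is_basis cl X B \<and> finite B \<and> card B = d"
    then obtain B where B: "is_basis cl X B" "finite B" "card B = d" by blast
    then have BS: "B \<subseteq> S" using X by (auto simp: is_basis_def)
    moreover have "inj_on f B" using f BS inj_on_subset by blast
    ultimately show "\<exists>B. is_basis cl' (f ` X) B \<and> finite B \<and> card B = d"
      using B iff[of B] by (intro exI[of _ "f ` B"]) (auto simp: card_image)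
  qed
  then show ?thesis unfolding pdim_def by simp
qed

text \<open>Being a basis of \<open>X\<close> only involves closures of subsets of \<open>X\<close>.
  This compares dimensions computed in a structure and in a closed substructure, whose closures
  coincide only on the smaller universe.\<close>

lemma pdim_cong:
  assumes "\<And>Y. Y \<subseteq> X \<Longrightarrow> cl Y = cl' Y"
  shows "pdim cl X = pdim cl' X"
proof -
  have "is_basis cl X B \<longleftrightarrow> is_basis cl' X B" for B
    using assms unfolding is_basis_def independent_def by (metis Diff_subset subset_trans)
  then show ?thesis unfolding pdim_def by simp
qed

section \<open>Isomorphisms, restrictions and reducts\<close>

lemma tuples_mono: "U \<subseteq> V \<Longrightarrow> tuples U n \<subseteq> tuples V n"
  by (auto simp: tuples_def)

lemma map_tuples: "as \<in> tuples U n \<Longrightarrow> map f as \<in> tuples (f ` U) n"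
  by (auto simp: tuples_def)

lemma universe_reduct [simp]: "universe (reduct L0 M) = universe M"
  and universe_restr [simp]: "universe (restr M U) = U"
  by (simp_all add: reduct_def restr_def)

section \<open>Formulas and definable closure under reducts and isomorphisms\<close>

lemma tm_val_reduct: "tm_in L0 t \<Longrightarrow> tm_val (reduct L0 M) s t = tm_val M s t"
  by (induction t) (auto simp: reduct_def cong: map_cong)

lemma sat_reduct: "fm_in L0 p \<Longrightarrow> sat (reduct L0 M) s p \<longleftrightarrow> sat M s p"
proof (induction p arbitrary: s)
  case (Rel R ts)
  then have "map (tm_val (reduct L0 M) s) ts = map (tm_val M s) ts"
    by (auto simp: tm_val_reduct)
  moreover have "rel_int (reduct L0 M) R = rel_int M R" using Rel by (simp add: reduct_def)
  ultimately show ?case by (metis sat.simps(2))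
qed (auto simp: tm_val_reduct)

lemma closure_by_reduct:
  assumes "\<And>m. fm_in L0 (\<theta> m)"
  shows "closure_by \<theta> (reduct L0 M) = closure_by \<theta> M"
proof
  fix X
  show "closure_by \<theta> (reduct L0 M) X = closure_by \<theta> M X"
    using assms by (simp add: closure_by_def sat_tuple_def sat_reduct)
qed

lemma tm_val_iso:
  assumes "iso L \<sigma> M N" "tm_in L t" "\<And>i. i \<in> tm_vars t \<Longrightarrow> s i \<in> universe M \<and> s' i = \<sigma> (s i)"
  shows "tm_val M s t \<in> universe M \<and> tm_val N s' t = \<sigma> (tm_val M s t)"
  using assms(2,3)
proof (induction t)
  case (App f ts)
  then have IH: "\<And>t. t \<in> set ts \<Longrightarrow> tm_val M s t \<in> universe M \<and> tm_val N s' t = \<sigma> (tm_val M s t)"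
    by auto
  then have "map (tm_val N s') ts = map \<sigma> (map (tm_val M s) ts)" by simp
  moreover have "map (tm_val M s) ts \<in> tuples (universe M) (fun_arity L f)" "f \<in> funs L"
    using IH App.prems by (auto simp: tuples_def)
  ultimately show ?case using assms(1) unfolding iso_def is_struc_def by (metis tm_val.simps(2))
qed auto

text \<open>The assignments are related at the free variables only, because an assignment read off
  from a tuple has unspecified values beyond the length of the tuple.\<close>

lemma sat_iso:
  assumes "iso L \<sigma> M N"
  shows "fm_in L p \<Longrightarrow> (\<And>i. i \<in> fm_free p \<Longrightarrow> s i \<in> universe M \<and> s' i = \<sigma> (s i)) \<Longrightarrow>
    sat M s p \<longleftrightarrow> sat N s' p"
proof (induction p arbitrary: s s')
  case (Eq t u)
  then have *: "tm_val M s t \<in> universe M \<and> tm_val N s' t = \<sigma> (tm_val M s t)"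
      "tm_val M s u \<in> universe M \<and> tm_val N s' u = \<sigma> (tm_val M s u)"
    using tm_val_iso[OF assms, of _ s s'] by auto
  have "inj_on \<sigma> (universe M)" using assms by (simp add: iso_def bij_betw_def)
  then show ?case using * by (auto dest: inj_onD)
next
  case (Rel R ts)
  have *: "tm_val M s t \<in> universe M \<and> tm_val N s' t = \<sigma> (tm_val M s t)" if "t \<in> set ts" for t
    using Rel.prems that by (intro tm_val_iso[OF assms]) auto
  then have "map (tm_val N s') ts = map \<sigma> (map (tm_val M s) ts)" by simp
  moreover have "map (tm_val M s) ts \<in> tuples (universe M) (rel_arity L R)" "R \<in> rels L"
    using * Rel.prems by (auto simp: tuples_def)
  ultimately show ?case using assms unfolding iso_def by (metis sat.simps(2))
next
  case (Conj p q)
  have "sat M s p \<longleftrightarrow> sat N s' p" "sat M s q \<longleftrightarrow> sat N s' q"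
    using Conj.prems by (intro Conj.IH; simp)+
  then show ?case by simp
next
  case (Exi x p)
  have "sat M (s(x := a)) p \<longleftrightarrow> sat N (s'(x := \<sigma> a)) p" if "a \<in> universe M" for a
    using Exi.prems that by (intro Exi.IH) auto
  moreover have "universe N = \<sigma> ` universe M"
    using assms by (auto simp: iso_def bij_betw_def)
  ultimately show ?case by auto
next
  case (Neg p)
  have "sat M s p \<longleftrightarrow> sat N s' p" using Neg.prems by (intro Neg.IH) simp_all
  then show ?case by simp
qed

text \<open>Isomorphisms preserve satisfaction of the defining formulas. The bound on the free
  variables of \<open>\<theta> m\<close> ensures that only the \<open>m + 1\<close> entries of the
  tuple matter.\<close>

lemma closure_by_iso:
  assumes iso: "iso L \<sigma> M N" and \<theta>: "\<And>m. fm_in L (\<theta> m)" "\<And>m. fm_free (\<theta> m) \<subseteq> {..m}"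
    and X: "X \<subseteq> universe M"
  shows "closure_by \<theta> N (\<sigma> ` X) = \<sigma> ` closure_by \<theta> M X"
proof -
  have sat: "sat_tuple M (\<theta> (length as)) (as @ [b]) \<longleftrightarrow>
      sat_tuple N (\<theta> (length as)) (map \<sigma> as @ [\<sigma> b])"
    if "set as \<subseteq> universe M" "b \<in> universe M" for as b
    unfolding sat_tuple_def
  proof (rule sat_iso[OF iso \<theta>(1)])
    fix i assume "i \<in> fm_free (\<theta> (length as))"
    then have "i < length (as @ [b])" using \<theta>(2)[of "length as"] by auto
    moreover have "(as @ [b]) ! i \<in> set (as @ [b])" using nth_mem[OF calculation] .
    ultimately show "(as @ [b]) ! i \<in> universe M \<and> (map \<sigma> as @ [\<sigma> b]) ! i = \<sigma> ((as @ [b]) ! i)"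
      using that nth_map[of i "as @ [b]" \<sigma>] by auto
  qed
  have uN: "universe N = \<sigma> ` universe M"
    using iso by (auto simp: iso_def bij_betw_def)
  show ?thesis
  proof (intro equalityI subsetI)
    fix c assume "c \<in> closure_by \<theta> N (\<sigma> ` X)"
    then obtain bs where bs: "c \<in> universe N" "set bs \<subseteq> \<sigma> ` X"
        "sat_tuple N (\<theta> (length bs)) (bs @ [c])"
      by (auto simp: closure_by_def)
    obtain b where b: "b \<in> universe M" "c = \<sigma> b" using bs uN by auto
    have "bs \<in> lists (\<sigma> ` X)" using bs(2) by auto
    then have "bs \<in> map \<sigma> ` lists X" by (simp add: lists_image)
    then obtain as where as: "set as \<subseteq> X" "bs = map \<sigma> as" by auto
    have "b \<in> closure_by \<theta> M X"
      using sat[of as b] as b bs X by (auto simp: closure_by_def)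
    then show "c \<in> \<sigma> ` closure_by \<theta> M X" using b by simp
  next
    fix c assume "c \<in> \<sigma> ` closure_by \<theta> M X"
    then obtain b as where b: "c = \<sigma> b" "b \<in> universe M" "set as \<subseteq> X"
        "sat_tuple M (\<theta> (length as)) (as @ [b])"
      by (auto simp: closure_by_def)
    then have "set (map \<sigma> as) \<subseteq> \<sigma> ` X" "c \<in> universe N"
        "sat_tuple N (\<theta> (length (map \<sigma> as))) (map \<sigma> as @ [c])"
      using sat[of as b] X uN by auto
    then show "c \<in> closure_by \<theta> N (\<sigma> ` X)" unfolding closure_by_def by blast
  qed
qed

lemma closure_by_sub: "closure_by \<theta> M X \<subseteq> universe M"
  by (auto simp: closure_by_def)

section \<open>Composition of isomorphisms, reducts and restrictions\<close>

lemma iso_refl: "is_struc L M \<Longrightarrow> iso L id M M"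
  by (auto simp: iso_def)

lemma iso_trans:
  assumes "iso L \<sigma> A B" "iso L \<tau> B C"
  shows "iso L (\<tau> \<circ> \<sigma>) A C"
proof -
  have "universe B = \<sigma> ` universe A" using assms by (auto simp: iso_def bij_betw_def)
  then have *: "map \<sigma> as \<in> tuples (universe B) n" if "as \<in> tuples (universe A) n" for as n
    using that by (simp add: map_tuples)
  show ?thesis
    unfolding iso_def
  proof (intro conjI ballI)
    show "bij_betw (\<tau> \<circ> \<sigma>) (universe A) (universe C)"
      using assms by (auto simp: iso_def intro: bij_betw_trans)
    fix f as assume f: "f \<in> funs L" "as \<in> tuples (universe A) (fun_arity L f)"
    then have "\<tau> (\<sigma> (fun_int A f as)) = fun_int C f (map \<tau> (map \<sigma> as))"
      using assms *[OF f(2)] unfolding iso_def by (simp del: map_map)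
    then show "(\<tau> \<circ> \<sigma>) (fun_int A f as) = fun_int C f (map (\<tau> \<circ> \<sigma>) as)" by simp
  next
    fix R as assume R: "R \<in> rels L" "as \<in> tuples (universe A) (rel_arity L R)"
    then have "as \<in> rel_int A R \<longleftrightarrow> map \<tau> (map \<sigma> as) \<in> rel_int C R"
      using assms *[OF R(2)] unfolding iso_def by (simp del: map_map)
    then show "as \<in> rel_int A R \<longleftrightarrow> map (\<tau> \<circ> \<sigma>) as \<in> rel_int C R" by simp
  qed (use assms in \<open>auto simp: iso_def\<close>)
qed

lemma is_struc_reduct: "subvocab L0 L \<Longrightarrow> is_struc L M \<Longrightarrow> is_struc L0 (reduct L0 M)"
  by (auto simp: is_struc_def reduct_def subvocab_def subset_iff)

lemma iso_reduct:
  assumes "subvocab L0 L" "iso L \<sigma> A B"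
  shows "iso L0 \<sigma> (reduct L0 A) (reduct L0 B)"
proof -
  have "is_struc L0 (reduct L0 A)" "is_struc L0 (reduct L0 B)"
    using assms is_struc_reduct by (auto simp: iso_def)
  then show ?thesis using assms by (auto simp: iso_def reduct_def subvocab_def subset_iff)
qed

lemma reduct_restr: "reduct L0 (restr M U) = restr (reduct L0 M) U"
  by (simp add: reduct_def restr_def fun_eq_iff)

lemma restr_restr: "V \<subseteq> U \<Longrightarrow> restr (restr M U) V = restr M V"
  by (auto simp: restr_def fun_eq_iff)

text \<open>An equality of records, because the interpretations in an \<open>L\<close>-structure are
  normalised outside its universe.\<close>

lemma restr_universe: "is_struc L M \<Longrightarrow> restr M (universe M) = M"
proof -
  assume M: "is_struc L M"
  have "fun_int M f as = undefined" if "\<not> set as \<subseteq> universe M" for f as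
    using M that by (auto simp: is_struc_def tuples_def)
  moreover have "set as \<subseteq> universe M" if "as \<in> rel_int M R" for R as
    using M that unfolding is_struc_def tuples_def by blast
  ultimately show ?thesis by (cases M) (force simp: restr_def fun_eq_iff)
qed

lemma is_struc_restr:
  assumes "is_struc L M" "U \<subseteq> universe M"
    and "\<And>f as. f \<in> funs L \<Longrightarrow> as \<in> tuples U (fun_arity L f) \<Longrightarrow> fun_int M f as \<in> U"
  shows "is_struc L (restr M U)"
proof -
  have "as \<in> tuples (universe M) n" if "as \<in> tuples U n" for as n
    using that assms(2) by (auto simp: tuples_def)
  moreover have "as \<in> tuples U n" if "as \<in> tuples (universe M) n" "set as \<subseteq> U" for as n
    using that by (auto simp: tuples_def)
  ultimately show ?thesis
    using assms(1,3) unfolding is_struc_def by (auto simp: restr_def tuples_def subset_iff)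
qed

text \<open>The vocabulary grows by relation symbols only, so the functions and the old relations
  are determined by the reduct, and the tuples of the new relations are all that remains to
  compare.\<close>

lemma struc_eqI:
  assumes "is_struc L M" "is_struc L N" "reduct L0 M = reduct L0 N" "funs L = funs L0"
    and "\<And>R as. R \<in> rels L - rels L0 \<Longrightarrow> length as = rel_arity L R \<Longrightarrow>
      set as \<subseteq> universe M \<Longrightarrow> as \<in> rel_int M R \<longleftrightarrow> as \<in> rel_int N R"
  shows "M = N"
proof -
  have u: "universe M = universe N" using assms(3) by (metis universe_reduct)
  have "fun_int M = fun_int N"
  proof
    fix f
    show "fun_int M f = fun_int N f"
    proof (cases "f \<in> funs L0")
      case True
      then show ?thesis using assms(3) by (auto simp: reduct_def fun_eq_iff split: if_splits)
    next
      case False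
      then show ?thesis using assms(1,2,4) by (auto simp: is_struc_def fun_eq_iff)
    qed
  qed
  moreover have "rel_int M = rel_int N"
  proof
    fix R
    consider "R \<in> rels L0" | "R \<in> rels L - rels L0" | "R \<notin> rels L" "R \<notin> rels L0" by blast
    then show "rel_int M R = rel_int N R"
    proof cases
      case 1
      then show ?thesis using assms(3) by (auto simp: reduct_def fun_eq_iff split: if_splits)
    next
      case 2
      then have "rel_int M R \<subseteq> tuples (universe M) (rel_arity L R)"
          "rel_int N R \<subseteq> tuples (universe M) (rel_arity L R)"
        using assms(1,2) u by (auto simp: is_struc_def)
      then show ?thesis using assms(5)[OF 2] by (auto simp: tuples_def)
    next
      case 3
      then show ?thesis using assms(1,2) by (auto simp: is_struc_def)
    qed
  qed
  ultimately show ?thesis using u by (cases M, cases N) auto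
qed

section \<open>Transport of structure along a bijection\<close>

text \<open>For a bijection \<open>\<tau>\<close> from \<open>U\<close> onto the universe of an
  \<open>L\<close>-structure \<open>B\<close>, this is the unique \<open>L\<close>-structure on
  \<open>U\<close> that makes \<open>\<tau>\<close> an isomorphism onto \<open>B\<close>; see
  \<open>iso_pull\<close> and \<open>pull_eq\<close>.\<close>

definition pull :: "('f, 'r) vocab \<Rightarrow> ('a \<Rightarrow> 'a) \<Rightarrow> 'a set \<Rightarrow> ('a, 'f, 'r) struc \<Rightarrow> ('a, 'f, 'r) struc"
  where "pull L \<tau> U B =
    \<lparr> universe = U,
      fun_int = (\<lambda>f as. if f \<in> funs L \<and> as \<in> tuples U (fun_arity L f)
                         then inv_into U \<tau> (fun_int B f (map \<tau> as)) else undefined),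
      rel_int = (\<lambda>R. if R \<in> rels L
                     then {as \<in> tuples U (rel_arity L R). map \<tau> as \<in> rel_int B R} else {}) \<rparr>"

lemma universe_pull [simp]: "universe (pull L \<tau> U B) = U"
  by (simp add: pull_def)

lemma iso_pull:
  assumes "bij_betw \<tau> U (universe B)" "is_struc L B"
  shows "iso L \<tau> (pull L \<tau> U B) B"
proof -
  have *: "fun_int B f (map \<tau> as) \<in> \<tau> ` U" if "f \<in> funs L" "as \<in> tuples U (fun_arity L f)" for f as
    using assms that map_tuples[OF that(2), of \<tau>] by (auto simp: is_struc_def bij_betw_def)
  then have "is_struc L (pull L \<tau> U B)"
    by (auto simp: is_struc_def pull_def inv_into_into)
  then show ?thesis using assms * by (auto simp: iso_def pull_def f_inv_into_f)
qed

text \<open>Uniqueness of transported structure: the isomorphism conditions fix all interpretations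
  inside the universe, and normalisation fixes them outside.\<close>

lemma pull_eq:
  assumes "iso L \<tau> A B"
  shows "pull L \<tau> (universe A) B = A"
proof -
  have inj: "inj_on \<tau> (universe A)" using assms by (simp add: iso_def bij_betw_def)
  have "fun_int (pull L \<tau> (universe A) B) f as = fun_int A f as" for f as
  proof (cases "f \<in> funs L \<and> as \<in> tuples (universe A) (fun_arity L f)")
    case True
    then have "fun_int A f as \<in> universe A" "\<tau> (fun_int A f as) = fun_int B f (map \<tau> as)"
      using assms by (auto simp: iso_def is_struc_def)
    then show ?thesis using True inv_into_f_f[OF inj, of "fun_int A f as"] by (simp add: pull_def)
  next
    case False
    then show ?thesis using assms by (auto simp: iso_def is_struc_def pull_def)
  qed
  moreover have "rel_int (pull L \<tau> (universe A) B) R = rel_int A R" for R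
  proof (cases "R \<in> rels L")
    case True
    then have "rel_int A R \<subseteq> tuples (universe A) (rel_arity L R)"
        "\<forall>as\<in>tuples (universe A) (rel_arity L R). as \<in> rel_int A R \<longleftrightarrow> map \<tau> as \<in> rel_int B R"
      using assms by (simp_all add: iso_def is_struc_def)
    then show ?thesis using True by (auto simp: pull_def)
  next
    case False
    then show ?thesis using assms by (simp add: iso_def is_struc_def pull_def)
  qed
  ultimately show ?thesis by (cases A) (auto simp: pull_def fun_eq_iff)
qed

lemma reduct_pull:
  assumes "subvocab L0 L"
  shows "reduct L0 (pull L \<tau> U B) = pull L0 \<tau> U (reduct L0 B)"
  using assms by (auto simp: reduct_def pull_def subvocab_def fun_eq_iff)

section \<open>The dimension conditional measure as a process\<close>

text \<open>Indices are removed from \<open>J\<close> one by one. The classes of \<open>q i\<close>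
  partition \<open>F\<close>; each has at most \<open>C\<close> members, one of which satisfies
  \<open>x i\<close>, so the factor with index \<open>i\<close> averages at most
  \<open>1 - c / C\<close> over a class. By \<open>const\<close> the other factors do not vary
  within a class and can be pulled out.\<close>

lemma sum_resampling:
  fixes x :: "'i \<Rightarrow> 'm \<Rightarrow> bool" and q :: "'i \<Rightarrow> 'm \<Rightarrow> 'q"
  assumes "finite F" "finite J" "0 \<le> c" "c \<le> 1" "C > 0"
    and card: "\<And>i M. i \<in> J \<Longrightarrow> M \<in> F \<Longrightarrow> card {M' \<in> F. q i M' = q i M} \<le> C"
    and ex: "\<And>i M. i \<in> J \<Longrightarrow> M \<in> F \<Longrightarrow> \<exists>M'\<in>F. q i M' = q i M \<and> x i M'"
    and const: "\<And>i j M M'. i \<in> J \<Longrightarrow> j \<in> J \<Longrightarrow> i \<noteq> j \<Longrightarrow> M \<in> F \<Longrightarrow> M' \<in> F \<Longrightarrow> q i M = q i M' \<Longrightarrow>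
      x j M \<longleftrightarrow> x j M'"
  shows "(\<Sum>M\<in>F. \<Prod>i\<in>J. 1 - c * of_bool (x i M)) \<le> card F * (1 - c / C) ^ card J"
  using assms(2) card ex const
proof (induction J)
  case empty
  then show ?case by simp
next
  case (insert i J)
  define w where "w M = (\<Prod>j\<in>J. 1 - c * of_bool (x j M))" for M
  let ?cls = "\<lambda>y. {M \<in> F. q i M = y}"
  have w0: "0 \<le> w M" for M
    unfolding w_def using assms(3,4) by (intro prod_nonneg) auto
  have cC: "c / C \<le> 1" using assms(4,5) by (simp add: divide_le_eq)
  have per_class: "(\<Sum>M\<in>?cls y. (1 - c * of_bool (x i M)) * w M) \<le> (\<Sum>M\<in>?cls y. (1 - c / C) * w M)"
    if y: "y \<in> q i ` F" for y
  proof -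
    obtain M0 where M0: "M0 \<in> F" "y = q i M0" using y by blast
    have fin: "finite (?cls y)" using assms(1) by simp
    have w: "w M = w M0" if "M \<in> ?cls y" for M
      unfolding w_def
    proof (intro prod.cong refl)
      fix j assume "j \<in> J"
      then have "x j M \<longleftrightarrow> x j M0"
        using that M0 insert.hyps by (intro insert.prems(3)[of i j]) auto
      then show "1 - c * of_bool (x j M) = 1 - c * of_bool (x j M0)" by simp
    qed
    obtain M1 where M1: "M1 \<in> ?cls y" "x i M1" using insert.prems(2)[of i M0] M0 by auto
    \<comment> \<open>The single member \<open>M1\<close> satisfying \<open>x i\<close> already
      contributes \<open>c\<close>.\<close>
    have "(\<Sum>M\<in>?cls y. c * of_bool (x i M)) \<ge> (\<Sum>M\<in>{M1}. c * of_bool (x i M))"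
      using fin M1 assms(3) by (intro sum_mono2) auto
    then have ge: "(\<Sum>M\<in>?cls y. c * of_bool (x i M)) \<ge> c" using M1 by simp
    \<comment> \<open>The class has at most \<open>C\<close> members, so a total gain of
      \<open>c\<close> amounts to at least \<open>c / C\<close> per member.\<close>
    have "real (card (?cls y)) \<le> real C" using insert.prems(1)[of i M0] M0 by simp
    then have "card (?cls y) * (c / C) \<le> c"
      using assms(3,5) by (simp add: divide_le_eq mult.commute mult_left_mono)
    then have "(\<Sum>M\<in>?cls y. 1 - c * of_bool (x i M)) \<le> card (?cls y) * (1 - c / C)"
      using ge by (simp add: sum_subtractf algebra_simps)
    then have "(\<Sum>M\<in>?cls y. 1 - c * of_bool (x i M)) * w M0 \<le> card (?cls y) * (1 - c / C) * w M0"
      by (rule mult_right_mono) (rule w0)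
    then show ?thesis using w by (simp add: sum_distrib_right)
  qed
  have "(\<Sum>M\<in>F. \<Prod>j\<in>insert i J. 1 - c * of_bool (x j M)) =
      (\<Sum>M\<in>F. (1 - c * of_bool (x i M)) * w M)"
    using insert.hyps by (simp add: w_def)
  also have "\<dots> = (\<Sum>y\<in>q i ` F. \<Sum>M\<in>?cls y. (1 - c * of_bool (x i M)) * w M)"
    using assms(1) by (rule sum.image_gen)
  also have "\<dots> \<le> (\<Sum>y\<in>q i ` F. \<Sum>M\<in>?cls y. (1 - c / C) * w M)"
    using per_class by (rule sum_mono)
  also have "\<dots> = (\<Sum>M\<in>F. (1 - c / C) * w M)"
    using assms(1) by (rule sum.image_gen[symmetric])
  also have "\<dots> = (1 - c / C) * (\<Sum>M\<in>F. w M)" by (simp add: sum_distrib_left)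
  also have "\<dots> \<le> (1 - c / C) * (card F * (1 - c / C) ^ card J)"
    unfolding w_def
  proof (intro mult_left_mono insert.IH)
    show "\<And>k j M M'. k \<in> J \<Longrightarrow> j \<in> J \<Longrightarrow> k \<noteq> j \<Longrightarrow> M \<in> F \<Longrightarrow> M' \<in> F \<Longrightarrow> q k M = q k M' \<Longrightarrow>
        x j M \<longleftrightarrow> x j M'"
      by (rule insert.prems(3)) auto
  qed (use insert.prems(1,2) cC in auto)
  finally show ?case using insert.hyps by (simp add: mult_ac)
qed

section \<open>Truncations and expectations at the stages of the measure\<close>

lemma trunc_sel [simp]:
  "universe (trunc L0 \<theta> d M) = universe M" "fun_int (trunc L0 \<theta> d M) = fun_int M"
  "rel_int (trunc L0 \<theta> d M) R =
    (if R \<in> rels L0 then rel_int M R else {as \<in> rel_int M R. dim_in \<theta> M (set as) \<le> d})"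
  by (simp_all add: trunc_def)

lemma reduct_trunc [simp]: "reduct L0 (trunc L0 \<theta> d M) = reduct L0 M"
  by (auto simp: reduct_def fun_eq_iff)

lemma is_struc_trunc: "is_struc L M \<Longrightarrow> is_struc L (trunc L0 \<theta> d M)"
  by (auto simp: is_struc_def)

definition dc_expect ::
    "('f, 'r) vocab \<Rightarrow> (nat \<Rightarrow> ('f, 'r) fm) \<Rightarrow> ('a, 'f, 'r) struc set \<Rightarrow> nat \<Rightarrow>
     (('a, 'f, 'r) struc \<Rightarrow> real) \<Rightarrow> real" where
  "dc_expect L0 \<theta> Kn r F = (\<Sum>B\<in>trunc L0 \<theta> r ` Kn. dc_mass L0 \<theta> Kn r B * F B)"

text \<open>The possible outcomes of the next stage when stage \<open>r\<close> has produced
  \<open>B\<close>; the conditional distribution on this set is uniform.\<close>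

definition fibre ::
    "('f, 'r) vocab \<Rightarrow> (nat \<Rightarrow> ('f, 'r) fm) \<Rightarrow> ('a, 'f, 'r) struc set \<Rightarrow> nat \<Rightarrow>
     ('a, 'f, 'r) struc \<Rightarrow> ('a, 'f, 'r) struc set" where
  "fibre L0 \<theta> Kn r B = {B' \<in> trunc L0 \<theta> (Suc r) ` Kn. trunc L0 \<theta> r B' = B}"

lemma dc_mass_nonneg: "0 \<le> dc_mass L0 \<theta> Kn r B"
  by (induction r arbitrary: B) auto

context
  fixes L0 :: "('f, 'r) vocab" and \<theta> :: "nat \<Rightarrow> ('f, 'r) fm" and Kn :: "('a, 'f, 'r) struc set"
  assumes fin: "finite Kn" and ne: "Kn \<noteq> {}"
    and trunc_trunc: "\<And>r (M :: ('a, 'f, 'r) struc).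
      trunc L0 \<theta> r (trunc L0 \<theta> (Suc r) M) = trunc L0 \<theta> r M"
begin

lemma finite_fibre: "finite (fibre L0 \<theta> Kn r B)"
  using fin by (simp add: fibre_def)

lemma fibre_nonempty: "B \<in> trunc L0 \<theta> r ` Kn \<Longrightarrow> fibre L0 \<theta> Kn r B \<noteq> {}"
  using trunc_trunc by (auto simp: fibre_def)

text \<open>The tower rule for conditional expectation: the mass of \<open>B'\<close> at stage
  \<open>Suc r\<close> is the mass of its truncation divided by the size of the fibre, so grouping
  the sum by truncations produces fibre averages.\<close>

lemma dc_expect_Suc:
  "dc_expect L0 \<theta> Kn (Suc r) F =
    dc_expect L0 \<theta> Kn r (\<lambda>B. (\<Sum>B'\<in>fibre L0 \<theta> Kn r B. F B') / card (fibre L0 \<theta> Kn r B))"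
proof -
  let ?X = "trunc L0 \<theta> r ` Kn" and ?Y = "trunc L0 \<theta> (Suc r) ` Kn"
  have im: "trunc L0 \<theta> r ` ?Y = ?X" using trunc_trunc by (simp add: image_image)
  have "dc_expect L0 \<theta> Kn (Suc r) F =
      (\<Sum>B\<in>?X. \<Sum>B'\<in>fibre L0 \<theta> Kn r B. dc_mass L0 \<theta> Kn (Suc r) B' * F B')"
    unfolding dc_expect_def fibre_def
    using sum.image_gen[of ?Y _ "trunc L0 \<theta> r"] fin unfolding im by blast
  also have "\<dots> = (\<Sum>B\<in>?X. dc_mass L0 \<theta> Kn r B * ((\<Sum>B'\<in>fibre L0 \<theta> Kn r B. F B') / card (fibre L0 \<theta> Kn r B)))"
  proof (intro sum.cong refl)
    fix B
    have "(\<Sum>B'\<in>fibre L0 \<theta> Kn r B. dc_mass L0 \<theta> Kn (Suc r) B' * F B') =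
        (\<Sum>B'\<in>fibre L0 \<theta> Kn r B. dc_mass L0 \<theta> Kn r B / card (fibre L0 \<theta> Kn r B) * F B')"
      by (intro sum.cong refl) (simp add: fibre_def)
    then show "(\<Sum>B'\<in>fibre L0 \<theta> Kn r B. dc_mass L0 \<theta> Kn (Suc r) B' * F B') =
        dc_mass L0 \<theta> Kn r B * ((\<Sum>B'\<in>fibre L0 \<theta> Kn r B. F B') / card (fibre L0 \<theta> Kn r B))"
      by (simp add: sum_distrib_left sum_divide_distrib)
  qed
  finally show ?thesis by (simp add: dc_expect_def)
qed

lemma dc_expect_mono:
  "(\<And>B. B \<in> trunc L0 \<theta> r ` Kn \<Longrightarrow> F B \<le> F' B) \<Longrightarrow>
    dc_expect L0 \<theta> Kn r F \<le> dc_expect L0 \<theta> Kn r F'"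
  unfolding dc_expect_def by (intro sum_mono mult_left_mono dc_mass_nonneg)

text \<open>Expresses that every stage carries a probability measure. Fibres over attained
  truncations are finite and nonempty, so averaging over them preserves constants.\<close>

lemma dc_expect_const: "dc_expect L0 \<theta> Kn r (\<lambda>_. c) = c"
proof (induction r)
  case 0
  then show ?case using fin ne by (simp add: dc_expect_def)
next
  case (Suc r)
  have "dc_expect L0 \<theta> Kn (Suc r) (\<lambda>_. c) = dc_expect L0 \<theta> Kn r (\<lambda>_. c)"
    unfolding dc_expect_Suc unfolding dc_expect_def
    using fibre_nonempty finite_fibre by (intro sum.cong refl) simp
  then show ?case using Suc by simp
qed

text \<open>The hypothesis is the supermartingale inequality with the division by the fibre size
  cleared. The tower rule then descends one stage at a time.\<close>

lemma dc_expect_supermartingale: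
  fixes F :: "nat \<Rightarrow> ('a, 'f, 'r) struc \<Rightarrow> real"
  assumes "\<And>r B. r < \<rho> \<Longrightarrow> B \<in> trunc L0 \<theta> r ` Kn \<Longrightarrow>
    (\<Sum>B'\<in>fibre L0 \<theta> Kn r B. F (Suc r) B') \<le> card (fibre L0 \<theta> Kn r B) * F r B"
  shows "dc_expect L0 \<theta> Kn \<rho> (F \<rho>) \<le> dc_expect L0 \<theta> Kn 0 (F 0)"
  using assms
proof (induction \<rho>)
  case (Suc \<rho>)
  have "dc_expect L0 \<theta> Kn (Suc \<rho>) (F (Suc \<rho>)) \<le> dc_expect L0 \<theta> Kn \<rho> (F \<rho>)"
    unfolding dc_expect_Suc
  proof (rule dc_expect_mono)
    fix B assume B: "B \<in> trunc L0 \<theta> \<rho> ` Kn"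
    then have "card (fibre L0 \<theta> Kn \<rho> B) > 0" using fibre_nonempty finite_fibre by (simp add: card_gt_0_iff)
    then show "(\<Sum>B'\<in>fibre L0 \<theta> Kn \<rho> B. F (Suc \<rho>) B') / card (fibre L0 \<theta> Kn \<rho> B) \<le> F \<rho> B"
      using Suc.prems[of \<rho> B] B by (simp add: divide_le_eq mult.commute)
  qed
  then show ?case using Suc by force
qed simp

end

text \<open>The finitely many interpretations that may vary are recorded by a subset of a set of
  labelled tuples.\<close>

lemma card_interpretations:
  fixes X :: "('a, 'f, 'r) struc set"
  assumes "finite (rels L - rels L0)" "finite U" "card U \<le> u"
    and arity: "\<And>R. R \<in> rels L - rels L0 \<Longrightarrow> rel_arity L R \<le> \<rho>"
    and struc: "\<And>M. M \<in> X \<Longrightarrow> is_struc L M"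
    and same: "\<And>M N. M \<in> X \<Longrightarrow> N \<in> X \<Longrightarrow> universe M = universe N \<and> fun_int M = fun_int N"
    and diff: "\<And>M N R as. M \<in> X \<Longrightarrow> N \<in> X \<Longrightarrow> \<not> (R \<in> rels L - rels L0 \<and> set as \<subseteq> U) \<Longrightarrow>
      as \<in> rel_int M R \<longleftrightarrow> as \<in> rel_int N R"
  shows "finite X \<and> card X \<le> 2 ^ (card (rels L - rels L0) * (u + 1) ^ \<rho>)"
proof -
  let ?V = "rels L - rels L0"
  let ?D = "SIGMA R:?V. tuples U (rel_arity L R)"
  define f where "f M = {(R, as). R \<in> ?V \<and> as \<in> rel_int M R \<and> set as \<subseteq> U}" for M :: "('a, 'f, 'r) struc"
  have tup: "finite (tuples U n)" "card (tuples U n) = card U ^ n" for n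
    using finite_lists_length_eq[OF assms(2)] card_lists_length_eq[OF assms(2)]
    by (simp_all add: tuples_def)
  have "card ?D = (\<Sum>R\<in>?V. card U ^ rel_arity L R)"
    using assms(1) tup by simp
  also have "\<dots> \<le> (\<Sum>R\<in>?V. (u + 1) ^ \<rho>)"
  proof (intro sum_mono)
    fix R assume R: "R \<in> ?V"
    have "card U ^ rel_arity L R \<le> (u + 1) ^ rel_arity L R" using assms(3) by (intro power_mono) auto
    also have "\<dots> \<le> (u + 1) ^ \<rho>" using arity[OF R] by (intro power_increasing) auto
    finally show "card U ^ rel_arity L R \<le> (u + 1) ^ \<rho>" .
  qed
  finally have D: "card ?D \<le> card ?V * (u + 1) ^ \<rho>" by simp
  have finD: "finite ?D" using assms(1) tup by (intro finite_SigmaI) auto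
  have im: "f ` X \<subseteq> Pow ?D"
  proof
    fix Z assume "Z \<in> f ` X"
    then obtain M where "M \<in> X" "Z = f M" by blast
    moreover have "length as = rel_arity L R" if "as \<in> rel_int M R" "R \<in> ?V" for as R
      using struc[OF \<open>M \<in> X\<close>] that by (auto simp: is_struc_def tuples_def)
    ultimately show "Z \<in> Pow ?D" by (auto simp: f_def tuples_def)
  qed
  have inj: "inj_on f X"
  proof
    fix M N assume MN: "M \<in> X" "N \<in> X" "f M = f N"
    have "as \<in> rel_int M R \<longleftrightarrow> as \<in> rel_int N R" for R as
    proof (cases "R \<in> ?V \<and> set as \<subseteq> U")
      case True
      then have "as \<in> rel_int M R \<longleftrightarrow> (R, as) \<in> f M" "as \<in> rel_int N R \<longleftrightarrow> (R, as) \<in> f N"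
        by (simp_all add: f_def)
      then show ?thesis using MN(3) by simp
    next
      case False
      then show ?thesis using diff[OF MN(1,2)] by blast
    qed
    then have "rel_int M = rel_int N" by (auto simp: fun_eq_iff)
    then show "M = N" using same[OF MN(1,2)] by (cases M, cases N) simp
  qed
  have "finite X" using finite_imageD[OF finite_subset[OF im] inj] finD by simp
  have "card X = card (f ` X)" using inj by (simp add: card_image)
  also have "\<dots> \<le> card (Pow ?D)" using im finD by (intro card_mono) auto
  also have "\<dots> = 2 ^ card ?D" using finD by (rule card_Pow)
  also have "\<dots> \<le> 2 ^ (card ?V * (u + 1) ^ \<rho>)" using D by (intro power_increasing) auto
  finally show ?thesis using \<open>finite X\<close> by simp
qed

section \<open>Substitutions in a class of expansions\<close>

text \<open>The closure is defined by \<open>L0\<close>-formulas and truncation keeps the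
  \<open>L0\<close>-reduct, so dimensions of tuples are the same before and after
  truncating.\<close>

lemma trunc_trunc:
  assumes "\<And>m. fm_in L0 (\<theta> m)"
  shows "trunc L0 \<theta> r (trunc L0 \<theta> (Suc r) M) = trunc L0 \<theta> r M"
proof -
  have "closure_by \<theta> (trunc L0 \<theta> (Suc r) M) = closure_by \<theta> M"
    using closure_by_reduct[of L0 \<theta>, OF assms] by (metis reduct_trunc)
  then have "rel_int (trunc L0 \<theta> r (trunc L0 \<theta> (Suc r) M)) R = rel_int (trunc L0 \<theta> r M) R" for R
    by auto
  then have "rel_int (trunc L0 \<theta> r (trunc L0 \<theta> (Suc r) M)) = rel_int (trunc L0 \<theta> r M)" by blast
  then show ?thesis by (simp add: trunc_def)
qed

text \<open>The hypotheses of the theorem, except the positivity of \<open>k\<close>, are collected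
  here. An accepted substitution yields a structure that is merely represented and has the right
  reduct; \<open>K_iso_closed\<close> places it in \<open>K (G n)\<close>.\<close>

locale expansions =
  fixes L0 L :: "('f, 'r) vocab"
    and G :: "nat \<Rightarrow> ('a, 'f, 'r) struc"
    and clG :: "nat \<Rightarrow> 'a set \<Rightarrow> 'a set"
    and \<theta> :: "nat \<Rightarrow> ('f, 'r) fm"
    and K :: "('a, 'f, 'r) struc \<Rightarrow> ('a, 'f, 'r) struc set"
    and KK :: "('a, 'f, 'r) struc set"
    and k \<rho> :: nat
  assumes vocab: "subvocab L0 L" "funs L = funs L0" "finite (rels L - rels L0)"
    and G_struc: "\<And>n. is_struc L0 (G n)" "\<And>n. finite (universe (G n))"
    and G_pregeometry: "\<And>n. pregeometry (universe (G n)) (clG n)"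
    and G_closed_funs: "\<And>n U f as. U \<subseteq> universe (G n) \<Longrightarrow> clG n U = U \<Longrightarrow> f \<in> funs L0 \<Longrightarrow>
          as \<in> tuples U (fun_arity L0 f) \<Longrightarrow> fun_int (G n) f as \<in> U"
    and \<theta>_formulas: "\<And>m. fm_in L0 (\<theta> m)" "\<And>m. fm_free (\<theta> m) \<subseteq> {..m}"
    and \<theta>_defines: "\<And>n as b. set as \<subseteq> universe (G n) \<Longrightarrow> b \<in> universe (G n) \<Longrightarrow>
          b \<in> clG n (set as) \<longleftrightarrow> sat_tuple (G n) (\<theta> (length as)) (as @ [b])"
    and K_expansions: "\<And>n M. M \<in> K (G n) \<Longrightarrow> is_struc L M \<and> reduct L0 M = G n"
    and K_nonempty: "\<And>n. K (G n) \<noteq> {}"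
    and KK_eq: "KK = (\<Union>n. K (G n))"
    and K_iso_closed: "\<And>n M. represented L KK M \<Longrightarrow> reduct L0 M = G n \<Longrightarrow> M \<in> K (G n)"
    and sub_represented: "\<And>M A. represented L KK M \<Longrightarrow> closed_sub L \<theta> A M \<Longrightarrow> represented L KK A"
    and sub_closure: "\<And>M A X. represented L KK M \<Longrightarrow> closed_sub L \<theta> A M \<Longrightarrow> X \<subseteq> universe A \<Longrightarrow>
          closure_by \<theta> A X = closure_by \<theta> M X"
    and \<rho>_arity: "\<And>R. R \<in> rels L - rels L0 \<Longrightarrow> rel_arity L R \<le> \<rho>"
    and G_bounded: "uniformly_bounded G clG"
    and G_saturated: "poly_saturated_seq L0 \<theta> (range G) k G"
    and K_accepts: "accepts_k_substs L0 L \<theta> KK k"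
begin

section \<open>Closure, dimension and closed substructures in represented structures\<close>

lemma finite_pregeometry_G: "finite_pregeometry (universe (G n)) (clG n)"
  using G_pregeometry G_struc(2) by unfold_locales

sublocale G: finite_pregeometry "universe (G n)" "clG n" for n
  by (rule finite_pregeometry_G)

lemma closure_reduct: "closure_by \<theta> (reduct L0 M) = closure_by \<theta> M"
  using closure_by_reduct \<theta>_formulas(1) by metis

lemma closure_G: "X \<subseteq> universe (G n) \<Longrightarrow> closure_by \<theta> (G n) X = clG n X"
  using G_struc(2) G_pregeometry \<theta>_defines by (intro closure_by_eq) auto

lemma iso_closure:
  "iso L \<sigma> M N \<Longrightarrow> X \<subseteq> universe M \<Longrightarrow> closure_by \<theta> N (\<sigma> ` X) = \<sigma> ` closure_by \<theta> M X"
  using closure_by_iso[OF iso_reduct[OF vocab(1)] \<theta>_formulas] by (simp add: closure_reduct)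

lemma iso_dim:
  assumes "iso L \<sigma> M N" "X \<subseteq> universe M"
  shows "dim_in \<theta> N (\<sigma> ` X) = dim_in \<theta> M X"
  using iso_closure[OF assms(1)] assms
  by (intro pdim_transfer[where S = "universe M"] closure_by_sub) (auto simp only: iso_def bij_betw_def)

lemma represented_struc: "represented L KK M \<Longrightarrow> is_struc L M"
  by (auto simp: represented_def iso_def)

lemma represented_iso: "iso L \<sigma> M N \<Longrightarrow> represented L KK N \<Longrightarrow> represented L KK M"
  unfolding represented_def using iso_trans by blast

lemma K_represented: "M \<in> K (G n) \<Longrightarrow> represented L KK M"
  unfolding represented_def using KK_eq iso_refl K_expansions by blast

lemma K_iff: "M \<in> K (G n) \<longleftrightarrow> represented L KK M \<and> reduct L0 M = G n"
  using K_represented K_iso_closed K_expansions by blast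

lemma K_universe: "M \<in> K (G n) \<Longrightarrow> universe M = universe (G n)"
  using K_expansions universe_reduct by metis

lemma closure_K: "M \<in> K (G n) \<Longrightarrow> X \<subseteq> universe (G n) \<Longrightarrow> closure_by \<theta> M X = clG n X"
  using closure_reduct[of M] closure_G K_expansions by metis

text \<open>An isomorphism onto a member of some \<open>K (G n)\<close> pulls the pregeometry of
  \<open>G n\<close> back to \<open>M\<close>.\<close>

lemma represented_pregeometry:
  assumes "represented L KK M"
  shows "finite_pregeometry (universe M) (closure_by \<theta> M)"
proof
  obtain n N \<phi> where N: "N \<in> K (G n)" "iso L \<phi> M N"
    using assms KK_eq by (auto simp: represented_def)
  have bij: "bij_betw \<phi> (universe M) (universe (G n))"
    using N K_universe by (auto simp: iso_def)
  show "finite (universe M)" using bij_betw_finite[OF bij] G_struc by simp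
  show "pregeometry (universe M) (closure_by \<theta> M)"
  proof (rule pregeometry_transfer[OF G_pregeometry bij])
    fix X assume X: "X \<subseteq> universe M"
    then have "\<phi> ` X \<subseteq> universe (G n)" using bij by (auto simp: bij_betw_def)
    then show "clG n (\<phi> ` X) = \<phi> ` closure_by \<theta> M X"
      using closure_K[OF N(1)] iso_closure[OF N(2) X] by simp
  qed (rule closure_by_sub)
qed

lemma represented_closed_sub:
  assumes M: "represented L KK M" and U: "closed_in \<theta> M U"
  shows "closed_sub L \<theta> (restr M U) M"
proof -
  obtain n N \<phi> where N: "N \<in> K (G n)" "iso L \<phi> M N"
    using M KK_eq by (auto simp: represented_def)
  have UM: "U \<subseteq> universe M" "closure_by \<theta> M U = U" using U by (auto simp: closed_in_def)
  have bij: "bij_betw \<phi> (universe M) (universe (G n))"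
    using N K_universe by (auto simp: iso_def)
  then have im: "\<phi> ` U \<subseteq> universe (G n)" using UM by (auto simp: bij_betw_def)
  have cl: "clG n (\<phi> ` U) = \<phi> ` U"
    using closure_K[OF N(1) im] iso_closure[OF N(2) UM(1)] UM by simp
  have "fun_int M f as \<in> U" if f: "f \<in> funs L" "as \<in> tuples U (fun_arity L f)" for f as
  proof -
    have as: "as \<in> tuples (universe M) (fun_arity L f)" using f(2) UM(1) tuples_mono by blast
    have "\<phi> (fun_int M f as) = fun_int N f (map \<phi> as)" "fun_int M f as \<in> universe M"
      using N(2) f(1) as unfolding iso_def is_struc_def by blast+
    \<comment> \<open>All function symbols belong to \<open>L0\<close>, so \<open>N\<close>
      interprets them as \<open>G n\<close> does, and there closed sets are known to be closed under
      functions.\<close>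
    moreover have "fun_int (reduct L0 N) f = fun_int N f"
      using f(1) vocab(2) by (simp add: reduct_def)
    then have "fun_int N f = fun_int (G n) f" using K_expansions[OF N(1)] by simp
    moreover have "fun_int (G n) f (map \<phi> as) \<in> \<phi> ` U"
      using G_closed_funs[OF im cl] f map_tuples[OF f(2), of \<phi>] vocab(1,2)
      by (auto simp: subvocab_def)
    ultimately show ?thesis
      using bij inj_on_image_mem_iff[OF _ _ UM(1)] by (metis bij_betw_def)
  qed
  then have "is_struc L (restr M U)"
    using represented_struc[OF M] UM(1) by (intro is_struc_restr)
  then show ?thesis
    using U UM represented_struc[OF M] by (simp add: closed_sub_def substruc_def)
qed

section \<open>Structures placed on closed subsets of a base structure\<close>

text \<open>A represented structure on a closed subset of \<open>G n\<close> that expands the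
  \<open>L0\<close>-structure already present there. Such a \<open>T\<close> is a target that a
  member of \<open>K (G n)\<close> may or may not realise on that very set, so no renaming
  intervenes in the probabilistic part.\<close>

definition placed :: "nat \<Rightarrow> ('a, 'f, 'r) struc \<Rightarrow> bool" where
  "placed n T \<longleftrightarrow> represented L KK T \<and> universe T \<subseteq> universe (G n) \<and>
     clG n (universe T) = universe T \<and> reduct L0 T = restr (G n) (universe T)"

lemma placed_K: "M \<in> K (G n) \<Longrightarrow> placed n M"
  using K_represented[of M n] K_universe[of M n] K_expansions[of M n] restr_universe[OF G_struc(1)]
    G.cl_extensive[of "universe (G n)" n] G.cl_sub[of "universe (G n)" n]
  by (auto simp: placed_def)

text \<open>The closure depends on the \<open>L0\<close>-reduct alone. Hence \<open>T\<close> has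
  the closure of the restriction of an arbitrary \<open>M\<close> in \<open>K (G n)\<close> to the
  same universe, and \<open>sub_closure\<close> applies to that restriction.\<close>

lemma placed_closure:
  assumes T: "placed n T" and X: "X \<subseteq> universe T"
  shows "closure_by \<theta> T X = clG n X"
proof -
  obtain M where M: "M \<in> K (G n)" using K_nonempty by blast
  have XG: "X \<subseteq> universe (G n)" "universe T \<subseteq> universe (G n)" using T X by (auto simp: placed_def)
  let ?A = "restr M (universe T)"
  have "closed_in \<theta> M (universe T)"
    using T closure_K[OF M] K_universe[OF M] by (auto simp: placed_def closed_in_def)
  then have A: "closed_sub L \<theta> ?A M" using represented_closed_sub K_represented[OF M] by blast
  have "reduct L0 ?A = reduct L0 T"
    using T K_expansions[OF M] by (simp add: reduct_restr placed_def)
  then have "closure_by \<theta> T X = closure_by \<theta> ?A X" using closure_reduct by metis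
  also have "\<dots> = closure_by \<theta> M X"
    using sub_closure[OF K_represented[OF M] A] X by simp
  finally show ?thesis using closure_K[OF M XG(1)] by simp
qed

lemma placed_dim: "placed n T \<Longrightarrow> X \<subseteq> universe T \<Longrightarrow> dim_in \<theta> T X = pdim (clG n) X"
  using placed_closure by (intro pdim_cong) blast

lemma placed_closed_sub:
  "placed n T \<Longrightarrow> U \<subseteq> universe T \<Longrightarrow> clG n U = U \<Longrightarrow> closed_sub L \<theta> (restr T U) T"
  using placed_closure represented_closed_sub by (auto simp: placed_def closed_in_def)

lemma placed_restr:
  assumes "placed n T" "U \<subseteq> universe T" "clG n U = U"
  shows "placed n (restr T U)"
  using assms sub_represented[OF _ placed_closed_sub[OF assms]]
  by (auto simp: placed_def reduct_restr restr_restr)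

lemma placed_eqI:
  assumes "placed n T" "placed n T'" "universe T = universe T'"
    and "\<And>R as. R \<in> rels L - rels L0 \<Longrightarrow> length as = rel_arity L R \<Longrightarrow> set as \<subseteq> universe T \<Longrightarrow>
      as \<in> rel_int T R \<longleftrightarrow> as \<in> rel_int T' R"
  shows "T = T'"
  using assms represented_struc vocab(2) unfolding placed_def by (intro struc_eqI[of L T T' L0]) auto

text \<open>The event that \<open>M\<close> realises the target \<open>T\<close> on \<open>U\<close>
  correctly up to dimension \<open>r\<close>. Dimensions are taken in \<open>clG n\<close>, so the
  same notion applies to truncations of \<open>M\<close>.\<close>

definition agree :: "nat \<Rightarrow> nat \<Rightarrow> 'a set \<Rightarrow> ('a, 'f, 'r) struc \<Rightarrow> ('a, 'f, 'r) struc \<Rightarrow> bool" where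
  "agree n r U T M \<longleftrightarrow> (\<forall>R\<in>rels L - rels L0. \<forall>as. set as \<subseteq> U \<longrightarrow> length as = rel_arity L R \<longrightarrow>
     pdim (clG n) (set as) \<le> r \<longrightarrow> (as \<in> rel_int M R \<longleftrightarrow> as \<in> rel_int T R))"

lemma agreeD:
  "agree n r U T M \<Longrightarrow> R \<in> rels L \<Longrightarrow> R \<notin> rels L0 \<Longrightarrow> set as \<subseteq> U \<Longrightarrow> length as = rel_arity L R \<Longrightarrow>
    pdim (clG n) (set as) \<le> r \<Longrightarrow> as \<in> rel_int M R \<longleftrightarrow> as \<in> rel_int T R"
  unfolding agree_def by blast

section \<open>Correcting a structure on closed sets of the next dimension\<close>

text \<open>Agreement up to dimension \<open>r\<close> makes the restrictions of \<open>M\<close>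
  and \<open>T\<close> to \<open>U\<close> agree on closed proper substructures, so one may be
  substituted for the other. A tuple of dimension at most \<open>Suc r\<close> whose closure is not
  \<open>U\<close> lies in a closed set that the substitution leaves alone.\<close>

lemma substitute_one:
  assumes T: "placed n T" "pdim (clG n) U \<le> k" and M: "M \<in> K (G n)"
    and U: "U \<subseteq> universe T" "clG n U = U" "pdim (clG n) U = Suc r" and ag: "agree n r U T M"
  obtains N where "N \<in> K (G n)" "agree n (Suc r) U T N"
    "\<And>R as. set as \<subseteq> universe (G n) \<Longrightarrow> pdim (clG n) (set as) \<le> Suc r \<Longrightarrow> clG n (set as) \<noteq> U \<Longrightarrow>
      as \<in> rel_int N R \<longleftrightarrow> as \<in> rel_int M R"
proof -
  let ?A = "restr M U" and ?A' = "restr T U"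
  have UG: "U \<subseteq> universe (G n)" using T U by (auto simp: placed_def)
  have UM: "U \<subseteq> universe M" using UG K_universe[OF M] by simp
  have A: "placed n ?A" and A': "placed n ?A'"
    using placed_restr[OF placed_K[OF M] UM U(2)] placed_restr[OF T(1) U(1,2)] by auto
  have dims: "dim_in \<theta> ?A X = pdim (clG n) X" "dim_in \<theta> ?A' X = pdim (clG n) X" if "X \<subseteq> U" for X
    using placed_dim[OF A] placed_dim[OF A'] that by auto
  have "agree_proper L0 \<theta> ?A ?A'"
    unfolding agree_proper_def
  proof (intro conjI allI impI)
    show "reduct L0 ?A = reduct L0 ?A'" using A A' by (simp add: placed_def)
    fix V assume "closed_in \<theta> ?A V \<and> dim_in \<theta> ?A V < dim_in \<theta> ?A (universe ?A)"
    then have V: "V \<subseteq> U" "closure_by \<theta> ?A V = V" "dim_in \<theta> ?A V < dim_in \<theta> ?A U"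
      by (auto simp: closed_in_def)
    then have V': "clG n V = V" "pdim (clG n) V \<le> r"
      using placed_closure[OF A, of V] dims U(3) by auto
    have VM: "V \<subseteq> universe M" "V \<subseteq> universe T" "V \<subseteq> universe (G n)" using V(1) UM U UG by auto
    \<comment> \<open>Tuples inside a closed set of dimension at most \<open>r\<close> have
      dimension at most \<open>r\<close>, where \<open>M\<close> and \<open>T\<close> already
      agree.\<close>
    have "restr M V = restr T V"
    proof (rule placed_eqI[of n])
      show "placed n (restr M V)" "placed n (restr T V)"
        using placed_restr V' VM placed_K[OF M] T by auto
      fix R as assume R: "R \<in> rels L - rels L0" "length as = rel_arity L R"
          "set as \<subseteq> universe (restr M V)"
      then have "pdim (clG n) (set as) \<le> r"
        using G.pdim_mono[of "set as" n V] V' VM(3) by auto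
      then show "as \<in> rel_int (restr M V) R \<longleftrightarrow> as \<in> rel_int (restr T V) R"
        using agreeD[OF ag, of R as] R V(1) by (auto simp: restr_def)
    qed simp
    then show "restr ?A V = restr ?A' V" using V(1) by (simp add: restr_restr)
  qed
  moreover have "represented L KK ?A" "represented L KK ?A'" using A A' by (auto simp: placed_def)
  ultimately have acc: "accepts_subst L0 L \<theta> KK ?A ?A'"
    using K_accepts dims U(3) T(2) unfolding accepts_k_substs_def by simp
  have "closed_sub L \<theta> ?A M" using placed_closed_sub placed_K[OF M] UM U(2) by blast
  note acc[unfolded accepts_subst_def, THEN spec, THEN mp, OF conjI[OF K_represented[OF M] this]]
  then obtain N where N: "represented L KK N" "reduct L0 N = reduct L0 M" "restr N U = ?A'"
    and eq: "\<And>V. closed_sub L \<theta> V N \<Longrightarrow> dim_in \<theta> N (universe V) \<le> dim_in \<theta> N U \<Longrightarrow> V \<noteq> ?A' \<Longrightarrow>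
        restr N (universe V) = restr M (universe V)"
    unfolding universe_restr by (elim exE conjE) simp
  have NK: "N \<in> K (G n)" using N K_iff K_expansions[OF M] by simp
  show thesis
  proof
    show "N \<in> K (G n)" by (fact NK)
    have "as \<in> rel_int N R \<longleftrightarrow> as \<in> rel_int T R" if "set as \<subseteq> U" for R as
      using arg_cong[OF N(3), of "\<lambda>M. rel_int M R"] that by (auto simp: restr_def)
    then show "agree n (Suc r) U T N" by (simp add: agree_def)
    fix R and as :: "'a list"
    assume as: "set as \<subseteq> universe (G n)" "pdim (clG n) (set as) \<le> Suc r" "clG n (set as) \<noteq> U"
    let ?V = "clG n (set as)"
    have V: "?V \<subseteq> universe N" "clG n ?V = ?V" "set as \<subseteq> ?V"
      using as(1) G.cl_sub G.cl_idem G.cl_extensive K_universe[OF NK] by simp_all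
    have "dim_in \<theta> N ?V = pdim (clG n) (set as)"
      using placed_dim[OF placed_K[OF NK] V(1)] G.pdim_cl[OF as(1)] by simp
    moreover have "dim_in \<theta> N U = Suc r"
      using placed_dim[OF placed_K[OF NK]] UG K_universe[OF NK] U(3) by simp
    moreover have "restr N ?V \<noteq> ?A'" using as(3) universe_restr by metis
    ultimately have "restr N ?V = restr M ?V"
      using eq[OF placed_closed_sub[OF placed_K[OF NK] V(1,2)]] as(2) by simp
    then have "as \<in> rel_int (restr N ?V) R \<longleftrightarrow> as \<in> rel_int (restr M ?V) R" by simp
    then show "as \<in> rel_int N R \<longleftrightarrow> as \<in> rel_int M R" using V(3) by (simp add: restr_def)
  qed
qed

text \<open>The closed sets are treated one after another. They do not disturb each other, because
  among the tuples of dimension at most \<open>Suc r\<close> a substitution at \<open>U\<close>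
  affects only those generating exactly \<open>U\<close>.\<close>

lemma substitute_many:
  assumes T: "placed n T" "pdim (clG n) (universe T) \<le> k" and M: "M \<in> K (G n)"
    and ag: "agree n r (universe T) T M" and "finite \<U>"
    and \<U>: "\<And>U. U \<in> \<U> \<Longrightarrow> U \<subseteq> universe T \<and> clG n U = U \<and> pdim (clG n) U = Suc r"
  shows "\<exists>N\<in>K (G n). (\<forall>U\<in>\<U>. agree n (Suc r) U T N) \<and>
    (\<forall>R as. set as \<subseteq> universe (G n) \<and> pdim (clG n) (set as) \<le> Suc r \<and> clG n (set as) \<notin> \<U> \<longrightarrow>
      (as \<in> rel_int N R \<longleftrightarrow> as \<in> rel_int M R))"
  using assms(5) \<U>
proof (induction \<U>)
  case empty
  then show ?case using M by auto
next
  case (insert U \<U>)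
  then obtain N where N: "N \<in> K (G n)" "\<forall>U\<in>\<U>. agree n (Suc r) U T N"
      "\<And>R as. set as \<subseteq> universe (G n) \<Longrightarrow> pdim (clG n) (set as) \<le> Suc r \<Longrightarrow> clG n (set as) \<notin> \<U> \<Longrightarrow>
        as \<in> rel_int N R \<longleftrightarrow> as \<in> rel_int M R"
    by auto
  have TG: "universe T \<subseteq> universe (G n)" using T by (simp add: placed_def)
  have U: "U \<subseteq> universe T" "clG n U = U" "pdim (clG n) U = Suc r" using insert.prems by auto
  have dim: "pdim (clG n) (clG n (set as)) = pdim (clG n) (set as)" if "set as \<subseteq> universe (G n)" for as
    using G.pdim_cl that by blast
  have agU: "agree n r U T N"
    unfolding agree_def
  proof (intro ballI allI impI)
    fix R as assume R: "R \<in> rels L - rels L0" "set as \<subseteq> U" "length as = rel_arity L R"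
        "pdim (clG n) (set as) \<le> r"
    have asG: "set as \<subseteq> universe (G n)" using R(2) U(1) TG by blast
    \<comment> \<open>The closure of \<open>as\<close> has dimension at most \<open>r\<close>, while
      all members of the family have dimension \<open>Suc r\<close>. So the earlier substitutions
      preserved the agreement required at \<open>U\<close>.\<close>
    then have "clG n (set as) \<notin> \<U>" using dim insert.prems R(4) by fastforce
    then have "as \<in> rel_int N R \<longleftrightarrow> as \<in> rel_int M R" using N(3) asG R(4) by simp
    then show "as \<in> rel_int N R \<longleftrightarrow> as \<in> rel_int T R" using agreeD[OF ag] R U(1) by auto
  qed
  have "pdim (clG n) U \<le> k"
    using G.pdim_mono[of U n "universe T"] U(1) T TG by (auto simp: placed_def)
  then obtain N' where N': "N' \<in> K (G n)" "agree n (Suc r) U T N'"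
    "\<And>R as. set as \<subseteq> universe (G n) \<Longrightarrow> pdim (clG n) (set as) \<le> Suc r \<Longrightarrow> clG n (set as) \<noteq> U \<Longrightarrow>
      as \<in> rel_int N' R \<longleftrightarrow> as \<in> rel_int N R"
    using substitute_one[OF T(1) _ N(1) U agU] by metis
  have "agree n (Suc r) V T N'" if V: "V \<in> \<U>" for V
    unfolding agree_def
  proof (intro ballI allI impI)
    fix R as assume R: "R \<in> rels L - rels L0" "set as \<subseteq> V" "length as = rel_arity L R"
        "pdim (clG n) (set as) \<le> Suc r"
    have V': "V \<subseteq> universe T" using insert.prems V by auto
    show "as \<in> rel_int N' R \<longleftrightarrow> as \<in> rel_int T R"
    \<comment> \<open>A tuple of \<open>V\<close> that generates \<open>U\<close> also lies in
      \<open>U\<close>, where \<open>N'\<close> has just been made to agree with \<open>T\<close>;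
      the other tuples keep their status from \<open>N\<close>.\<close>
    proof (cases "clG n (set as) = U")
      case True
      then have "set as \<subseteq> U" using G.cl_extensive[of "set as" n] R(2) V' TG by blast
      then show ?thesis using agreeD[OF N'(2)] R by auto
    next
      case False
      then show ?thesis using N'(3)[of as R] agreeD[of n "Suc r" V T N] N(2) V R V' TG by auto
    qed
  qed
  then show ?case using N' N(3) by (intro bexI[of _ N']) auto
qed


subsection \<open>The probability that all copies fail\<close>

lemma K_fun: "M \<in> K (G n) \<Longrightarrow> N \<in> K (G n) \<Longrightarrow> fun_int M = fun_int N"
proof
  fix f assume MN: "M \<in> K (G n)" "N \<in> K (G n)"
  show "fun_int M f = fun_int N f"
  proof (cases "f \<in> funs L")
    case True
    then have "fun_int (reduct L0 M) f = fun_int M f" "fun_int (reduct L0 N) f = fun_int N f"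
      using vocab(2) by (simp_all add: reduct_def)
    then show ?thesis using MN K_expansions by metis
  next
    case False
    then show ?thesis using K_expansions[OF MN(1)] K_expansions[OF MN(2)]
      by (auto simp: is_struc_def fun_eq_iff)
  qed
qed

lemma K_rel0: "M \<in> K (G n) \<Longrightarrow> R \<in> rels L0 \<Longrightarrow> rel_int M R = rel_int (G n) R"
proof -
  assume "M \<in> K (G n)" "R \<in> rels L0"
  moreover from this have "rel_int (reduct L0 M) R = rel_int M R" by (simp add: reduct_def)
  ultimately show ?thesis using K_expansions by metis
qed

lemma K_rel:
  assumes "M \<in> K (G n)" "as \<in> rel_int M R"
  shows "R \<in> rels L" "set as \<subseteq> universe (G n)" "length as = rel_arity L R"
proof -
  have M: "is_struc L M" using assms K_expansions by blast
  show R: "R \<in> rels L" using M assms(2) unfolding is_struc_def by blast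
  then have "as \<in> tuples (universe M) (rel_arity L R)"
    using M assms(2) unfolding is_struc_def by blast
  then show "set as \<subseteq> universe (G n)" "length as = rel_arity L R"
    using K_universe[OF assms(1)] by (auto simp: tuples_def)
qed

lemma K_dim: "M \<in> K (G n) \<Longrightarrow> X \<subseteq> universe (G n) \<Longrightarrow> dim_in \<theta> M X = pdim (clG n) X"
  using placed_dim[OF placed_K] K_universe by metis

lemma in_trunc:
  assumes "M \<in> K (G n)" "R \<notin> rels L0"
  shows "as \<in> rel_int (trunc L0 \<theta> r M) R \<longleftrightarrow> as \<in> rel_int M R \<and> pdim (clG n) (set as) \<le> r"
  using assms K_rel(2)[OF assms(1)] K_dim[OF assms(1)] by auto

lemma trunc_eqI:
  assumes "M \<in> K (G n)" "N \<in> K (G n)"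
    and "\<And>R as. R \<notin> rels L0 \<Longrightarrow> set as \<subseteq> universe (G n) \<Longrightarrow> pdim (clG n) (set as) \<le> r \<Longrightarrow>
      as \<in> rel_int M R \<longleftrightarrow> as \<in> rel_int N R"
  shows "trunc L0 \<theta> r M = trunc L0 \<theta> r N"
proof -
  have "as \<in> rel_int (trunc L0 \<theta> r M) R \<longleftrightarrow> as \<in> rel_int (trunc L0 \<theta> r N) R" for R as
  proof (cases "R \<in> rels L0")
    case True
    then show ?thesis using K_rel0[OF assms(1)] K_rel0[OF assms(2)] by simp
  next
    case False
    then show ?thesis
      using in_trunc[OF assms(1) False, of as r] in_trunc[OF assms(2) False, of as r]
        K_rel(2)[OF assms(1), of as R] K_rel(2)[OF assms(2), of as R] assms(3)[OF False, of as] by argo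
  qed
  then have "rel_int (trunc L0 \<theta> r M) = rel_int (trunc L0 \<theta> r N)" by (intro ext set_eqI)
  moreover have "universe M = universe N" "fun_int M = fun_int N"
    using K_universe[OF assms(1)] K_universe[OF assms(2)] K_fun[OF assms(1,2)] by simp_all
  ultimately show ?thesis by (simp add: trunc_def)
qed

text \<open>The dimension of a tuple is at most its length, and \<open>\<rho>\<close> bounds the
  arities of the new relations, so the truncation at \<open>\<rho>\<close> removes nothing.\<close>

lemma trunc_self: "M \<in> K (G n) \<Longrightarrow> trunc L0 \<theta> \<rho> M = M"
proof -
  assume M: "M \<in> K (G n)"
  have "as \<in> rel_int (trunc L0 \<theta> \<rho> M) R \<longleftrightarrow> as \<in> rel_int M R" for R as
  proof (cases "R \<in> rels L0")
    case False
    have "pdim (clG n) (set as) \<le> \<rho>" if "as \<in> rel_int M R"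
    proof -
      have "pdim (clG n) (set as) \<le> card (set as)" using G.pdim_le_card K_rel(2)[OF M that] by blast
      also have "\<dots> \<le> length as" by (rule card_length)
      also have "\<dots> \<le> \<rho>" using \<rho>_arity K_rel(1,3)[OF M that] False by simp
      finally show ?thesis .
    qed
    then show ?thesis using in_trunc[OF M False] by blast
  qed simp
  then have "rel_int (trunc L0 \<theta> \<rho> M) = rel_int M" by (intro ext set_eqI)
  then show ?thesis by (cases M) (simp add: trunc_def)
qed

lemma agree_trunc:
  assumes "M \<in> K (G n)" "r \<le> r'"
  shows "agree n r U T (trunc L0 \<theta> r' M) \<longleftrightarrow> agree n r U T M"
proof -
  have "as \<in> rel_int (trunc L0 \<theta> r' M) R \<longleftrightarrow> as \<in> rel_int M R"
    if "R \<notin> rels L0" "pdim (clG n) (set as) \<le> r" for R as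
    using in_trunc[OF assms(1) that(1)] that(2) assms(2) by auto
  then show ?thesis unfolding agree_def by (metis DiffD2)
qed

lemma agree_mono: "agree n r U T M \<Longrightarrow> r' \<le> r \<Longrightarrow> U' \<subseteq> U \<Longrightarrow> agree n r' U' T M"
  unfolding agree_def by (meson le_trans subset_trans)

text \<open>The constant \<open>C\<close> of the resampling argument: a bound for the number of ways
  to interpret the new relations on a set of at most \<open>u\<close> elements, counting subsets of
  the set of labelled tuples.\<close>

definition expansion_bound :: "nat \<Rightarrow> nat" where
  "expansion_bound u = 2 ^ (card (rels L - rels L0) * (u + 1) ^ \<rho>)"

lemma expansion_bound_ge_1: "1 \<le> expansion_bound u"
  by (simp add: expansion_bound_def)

lemma card_agreeing:
  assumes "X \<subseteq> trunc L0 \<theta> r ` K (G n)" "finite U" "card U \<le> u"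
    and "\<And>M N R as. M \<in> X \<Longrightarrow> N \<in> X \<Longrightarrow> \<not> (R \<in> rels L - rels L0 \<and> set as \<subseteq> U) \<Longrightarrow>
      as \<in> rel_int M R \<longleftrightarrow> as \<in> rel_int N R"
  shows "finite X" "card X \<le> expansion_bound u"
proof -
  have "finite X \<and> card X \<le> 2 ^ (card (rels L - rels L0) * (u + 1) ^ \<rho>)"
  proof (rule card_interpretations[OF vocab(3) assms(2,3) \<rho>_arity])
    show "is_struc L M" if "M \<in> X" for M
      using that assms(1) is_struc_trunc K_expansions by blast
    show "universe M = universe N \<and> fun_int M = fun_int N" if MN: "M \<in> X" "N \<in> X" for M N
    proof -
      obtain M' N' where "M' \<in> K (G n)" "N' \<in> K (G n)" "M = trunc L0 \<theta> r M'" "N = trunc L0 \<theta> r N'"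
        using MN assms(1) by blast
      then show ?thesis using K_universe[of M' n] K_universe[of N' n] K_fun[of M' n N'] by simp
    qed
  qed (use assms(4) in blast)+
  then show "finite X" "card X \<le> expansion_bound u" by (simp_all add: expansion_bound_def)
qed

text \<open>\<open>card_agreeing\<close> is applied with the whole universe as the region of freedom
  and at the last stage, where truncation is the identity; the relations of \<open>L0\<close> are
  fixed by \<open>G n\<close>.\<close>

lemma finite_K: "finite (K (G n))"
proof -
  have "trunc L0 \<theta> \<rho> ` K (G n) = K (G n)" using trunc_self by auto
  moreover have "finite (trunc L0 \<theta> \<rho> ` K (G n))"
  proof (rule card_agreeing[where U = "universe (G n)", OF order_refl G_struc(2) order_refl])
    fix M N R and as :: "'a list"
    assume M: "M \<in> trunc L0 \<theta> \<rho> ` K (G n)" and N: "N \<in> trunc L0 \<theta> \<rho> ` K (G n)"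
      and R: "\<not> (R \<in> rels L - rels L0 \<and> set as \<subseteq> universe (G n))"
    have M': "M \<in> K (G n)" "N \<in> K (G n)" using M N trunc_self by auto
    show "as \<in> rel_int M R \<longleftrightarrow> as \<in> rel_int N R"
    proof (cases "R \<in> rels L0")
      case True
      then show ?thesis using K_rel0[OF M'(1)] K_rel0[OF M'(2)] by simp
    next
      case False
      then show ?thesis using R K_rel(1,2)[OF M'(1)] K_rel(1,2)[OF M'(2)] by blast
    qed
  qed
  ultimately show ?thesis by simp
qed

lemma trunc_trunc': "trunc L0 \<theta> r (trunc L0 \<theta> (Suc r) M) = trunc L0 \<theta> r M"
  using trunc_trunc \<theta>_formulas(1) by metis

abbreviation "fib n \<equiv> fibre L0 \<theta> (K (G n))"

text \<open>The supermartingale inequality for one stage, an instance of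
  \<open>sum_resampling\<close>. Among the members of the fibre that are right on \<open>A\<close>,
  the class belonging to copy \<open>i\<close> lets the new relations vary on tuples inside that
  copy but not inside \<open>A\<close>. Class sizes are bounded by \<open>card_agreeing\<close>, and
  \<open>substitute_many\<close> finds a member with copy \<open>i\<close> correct up to
  \<open>Suc r\<close>. The price is that the weight \<open>c\<close> drops to
  \<open>c / expansion_bound u\<close>.\<close>

lemma stage:
  fixes T :: "('a, 'f, 'r) struc" and Tf :: "'i \<Rightarrow> ('a, 'f, 'r) struc"
  assumes A: "A \<subseteq> universe (G n)" "clG n A = A" and "finite I"
    and Tf: "\<And>i. i \<in> I \<Longrightarrow> placed n (Tf i) \<and> pdim (clG n) (universe (Tf i)) \<le> k \<and>
      A \<subseteq> universe (Tf i) \<and> card (universe (Tf i)) \<le> u"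
    and disj: "\<And>i j. i \<in> I \<Longrightarrow> j \<in> I \<Longrightarrow> i \<noteq> j \<Longrightarrow> universe (Tf i) \<inter> universe (Tf j) = A"
    and TA: "\<And>i R as. i \<in> I \<Longrightarrow> R \<in> rels L - rels L0 \<Longrightarrow> set as \<subseteq> A \<Longrightarrow>
      as \<in> rel_int (Tf i) R \<longleftrightarrow> as \<in> rel_int T R"
    and B: "B \<in> trunc L0 \<theta> r ` K (G n)" and c: "0 \<le> c" "c \<le> 1"
  shows "(\<Sum>M\<in>fib n r B. of_bool (agree n (Suc r) A T M) *
        (\<Prod>i\<in>I. 1 - c * of_bool (agree n (Suc r) (universe (Tf i)) (Tf i) M)))
    \<le> card (fib n r B) * (of_bool (agree n r A T B) *
        (\<Prod>i\<in>I. 1 - c / expansion_bound u * of_bool (agree n r (universe (Tf i)) (Tf i) B)))"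
proof -
  let ?C = "expansion_bound u" and ?Fib = "fib n r B" and ?U = "\<lambda>i. universe (Tf i)"
  define F where "F = {M \<in> ?Fib. agree n (Suc r) A T M}"
  define J where "J = {i \<in> I. agree n r (?U i) (Tf i) B}"
  define x where "x i M \<longleftrightarrow> agree n (Suc r) (?U i) (Tf i) M" for i M
  \<comment> \<open>The part of \<open>M\<close> that is frozen while copy \<open>i\<close> is
    resampled: tuples of new relations inside the copy and not inside \<open>A\<close> are
    erased.\<close>
  define q where "q i M = (\<lambda>R. {as \<in> rel_int M R.
      \<not> (R \<in> rels L - rels L0 \<and> set as \<subseteq> ?U i \<and> \<not> set as \<subseteq> A)})" for i and M :: "('a, 'f, 'r) struc"
  have C1: "real ?C \<ge> 1" using expansion_bound_ge_1[of u] by simp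
  have cC: "0 \<le> c / ?C" "c / ?C \<le> 1"
    using c C1 by (auto simp: divide_le_eq)
  have fib: "finite ?Fib"
    using finite_K[of n] by (simp add: fibre_def)
  have mem: "M \<in> ?Fib \<longleftrightarrow> (\<exists>N\<in>K (G n). M = trunc L0 \<theta> (Suc r) N \<and> trunc L0 \<theta> r N = B)" for M
    by (auto simp: fibre_def trunc_trunc')
  have agB: "agree n r V T' M \<longleftrightarrow> agree n r V T' B" if M: "M \<in> ?Fib" for M V T'
  proof -
    obtain N where N: "N \<in> K (G n)" "M = trunc L0 \<theta> (Suc r) N" "B = trunc L0 \<theta> r N"
      using M mem by blast
    show ?thesis using agree_trunc[OF N(1), of r "Suc r"] agree_trunc[OF N(1), of r r] N(2,3) by simp
  qed
  \<comment> \<open>A copy that is wrong at stage \<open>r\<close> stays wrong, so its factor equals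
    1 and only the indices in \<open>J\<close> count.\<close>
  have xJ: "\<not> x i M" if "M \<in> ?Fib" "i \<in> I" "i \<notin> J" for i M
    using agree_mono[of n "Suc r" "?U i" "Tf i" M r "?U i"] agB[OF that(1)] that
    by (auto simp: x_def J_def)
  have qD: "as \<in> rel_int M R \<longleftrightarrow> as \<in> rel_int M' R"
    if "q i M = q i M'" "\<not> (R \<in> rels L - rels L0 \<and> set as \<subseteq> ?U i \<and> \<not> set as \<subseteq> A)" for i M M' R as
    using fun_cong[OF that(1), of R] that(2) by (auto simp: q_def)
  have "(\<Sum>M\<in>F. \<Prod>i\<in>J. 1 - c * of_bool (x i M)) \<le> card F * (1 - c / ?C) ^ card J"
  proof (rule sum_resampling[OF _ _ c])
    show "finite F" "finite J" using fib assms(3) by (auto simp: F_def J_def)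
    show "?C > 0" using expansion_bound_ge_1[of u] by simp
  next
    fix i M assume iM: "i \<in> J" "M \<in> F"
    then have i: "i \<in> I" by (simp add: J_def)
    have "finite (?U i)" using Tf[OF i] G_struc(2) by (meson finite_subset placed_def)
    moreover have "card (?U i) \<le> u" using Tf[OF i] by blast
    ultimately show "card {M' \<in> F. q i M' = q i M} \<le> ?C"
    proof (rule card_agreeing(2)[rotated 1])
      show "{M' \<in> F. q i M' = q i M} \<subseteq> trunc L0 \<theta> (Suc r) ` K (G n)"
        using mem by (auto simp: F_def)
      fix N N' R and as :: "'a list"
      assume "N \<in> {M' \<in> F. q i M' = q i M}" "N' \<in> {M' \<in> F. q i M' = q i M}"
        "\<not> (R \<in> rels L - rels L0 \<and> set as \<subseteq> ?U i)"
      then show "as \<in> rel_int N R \<longleftrightarrow> as \<in> rel_int N' R" using qD[of i N N'] by auto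
    qed
    obtain N where N: "N \<in> K (G n)" "M = trunc L0 \<theta> (Suc r) N" "trunc L0 \<theta> r N = B"
      using iM mem by (auto simp: F_def)
    \<comment> \<open>Closed sets inside \<open>A\<close> are excluded: the structure on
      \<open>A\<close> is shared by all copies and has to stay as it is.\<close>
    let ?\<U> = "{V. V \<subseteq> ?U i \<and> clG n V = V \<and> pdim (clG n) V = Suc r \<and> \<not> V \<subseteq> A}"
    have "agree n r (?U i) (Tf i) N"
      using iM(1) agree_trunc[OF N(1), of r r] N(3) by (auto simp: J_def)
    moreover have "finite ?\<U>" using \<open>finite (?U i)\<close> by simp
    ultimately have "\<exists>N'\<in>K (G n). (\<forall>V\<in>?\<U>. agree n (Suc r) V (Tf i) N') \<and>
        (\<forall>R as. set as \<subseteq> universe (G n) \<and> pdim (clG n) (set as) \<le> Suc r \<and> clG n (set as) \<notin> ?\<U> \<longrightarrow>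
          (as \<in> rel_int N' R \<longleftrightarrow> as \<in> rel_int N R))"
      using Tf[OF i] N(1) by (intro substitute_many) auto
    then obtain N' where NK: "N' \<in> K (G n)"
      and NU: "\<forall>V\<in>?\<U>. agree n (Suc r) V (Tf i) N'"
      and NO: "\<forall>R as. set as \<subseteq> universe (G n) \<and> pdim (clG n) (set as) \<le> Suc r \<and>
        clG n (set as) \<notin> ?\<U> \<longrightarrow> (as \<in> rel_int N' R \<longleftrightarrow> as \<in> rel_int N R)"
      by (elim bexE conjE)
    note N' = NK NU[THEN bspec] NO[THEN spec, THEN spec, THEN mp, OF conjI, OF _ conjI]
    let ?M' = "trunc L0 \<theta> (Suc r) N'"
    have UG: "?U i \<subseteq> universe (G n)" "clG n (?U i) = ?U i" using Tf[OF i] by (auto simp: placed_def)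
    have clA: "clG n (set as) \<subseteq> A" if "set as \<subseteq> A" for as
      using G.cl_mono[OF that A(1)] A(2) by simp
    \<comment> \<open>Only tuples of dimension \<open>Suc r\<close> may have changed among those up
      to that dimension, so the corrected structure remains in the same fibre.\<close>
    have "trunc L0 \<theta> r N' = trunc L0 \<theta> r N"
    proof (rule trunc_eqI[OF N'(1) N(1)])
      fix R and as :: "'a list"
      assume as: "set as \<subseteq> universe (G n)" "pdim (clG n) (set as) \<le> r"
      then have "clG n (set as) \<notin> ?\<U>" using G.pdim_cl[OF as(1)] by auto
      then show "as \<in> rel_int N' R \<longleftrightarrow> as \<in> rel_int N R" using N'(3) as by simp
    qed
    then have fibM': "?M' \<in> ?Fib" using mem N'(1) N(3) by auto
    have agA: "agree n (Suc r) A T ?M'"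
    proof -
      have agM: "agree n (Suc r) A T N"
        using iM(2) agree_trunc[OF N(1), of "Suc r" "Suc r"] N(2) by (simp add: F_def)
      have "agree n (Suc r) A T N'"
        unfolding agree_def
      proof (intro ballI allI impI)
        fix R as assume R: "R \<in> rels L - rels L0" "set as \<subseteq> A" "length as = rel_arity L R"
            "pdim (clG n) (set as) \<le> Suc r"
        then show "as \<in> rel_int N' R \<longleftrightarrow> as \<in> rel_int T R"
          using N'(3)[of as R] clA[OF R(2)] agreeD[OF agM, of R as] A(1) by auto
      qed
      then show ?thesis using agree_trunc[OF N'(1), of "Suc r" "Suc r"] by simp
    qed
    have "q i ?M' = q i M"
    proof
      fix R
      have "as \<in> rel_int ?M' R \<longleftrightarrow> as \<in> rel_int M R"
        if as: "\<not> (R \<in> rels L - rels L0 \<and> set as \<subseteq> ?U i \<and> \<not> set as \<subseteq> A)" for as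
      proof (cases "R \<in> rels L0")
        case True
        then show ?thesis using K_rel0[OF N(1)] K_rel0[OF N'(1)] N(2) by simp
      next
        case False
        have "as \<in> rel_int N' R \<longleftrightarrow> as \<in> rel_int N R" if "pdim (clG n) (set as) \<le> Suc r"
        proof (cases "R \<in> rels L \<and> set as \<subseteq> universe (G n)")
          case True
          then have "\<not> set as \<subseteq> ?U i \<or> set as \<subseteq> A" using as False by blast
          then have "clG n (set as) \<notin> ?\<U>" using clA G.cl_extensive[of "set as" n] True by blast
          then show ?thesis using N'(3) True that by blast
        next
          case False
          then show ?thesis using K_rel(1,2)[OF N(1)] K_rel(1,2)[OF N'(1)] by blast
        qed
        then show ?thesis using in_trunc[OF N(1) False] in_trunc[OF N'(1) False] N(2) by blast
      qed
      then show "q i ?M' R = q i M R" unfolding q_def by blast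
    qed
    moreover have "x i ?M'"
    proof -
      have "agree n (Suc r) (?U i) (Tf i) N'"
        unfolding agree_def
      proof (intro ballI allI impI)
        fix R as assume R: "R \<in> rels L - rels L0" "set as \<subseteq> ?U i" "length as = rel_arity L R"
            "pdim (clG n) (set as) \<le> Suc r"
        let ?V = "clG n (set as)"
        have asG: "set as \<subseteq> universe (G n)" using R(2) UG(1) by blast
        have V: "?V \<subseteq> ?U i" "clG n ?V = ?V" "pdim (clG n) ?V = pdim (clG n) (set as)" "set as \<subseteq> ?V"
          using G.cl_mono[OF R(2) UG(1)] UG(2) G.cl_idem[OF asG] G.pdim_cl[OF asG]
            G.cl_extensive[OF asG] by simp_all
        \<comment> \<open>Either the tuple generates a corrected closed set, or it has dimension at
          most \<open>r\<close> and was already right, or it lies in \<open>A\<close>, where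
          \<open>Tf i\<close> and \<open>T\<close> coincide and agreement holds within
          \<open>F\<close>.\<close>
        consider "?V \<in> ?\<U>" | "?V \<notin> ?\<U>" "pdim (clG n) (set as) \<le> r" | "?V \<notin> ?\<U>" "?V \<subseteq> A"
          using V R(4) by (auto simp: le_Suc_eq)
        then show "as \<in> rel_int N' R \<longleftrightarrow> as \<in> rel_int (Tf i) R"
        proof cases
          case 1
          then show ?thesis using agreeD[OF N'(2)[OF 1], of R as] R V(4) by auto
        next
          case 2
          then show ?thesis
            using N'(3)[OF asG R(4) 2(1)] agreeD[OF \<open>agree n r (?U i) (Tf i) N\<close>, of R as] R by auto
        next
          case 3
          then have "as \<in> rel_int (Tf i) R \<longleftrightarrow> as \<in> rel_int T R" using TA[OF i R(1)] V(4) by blast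
          moreover have "as \<in> rel_int ?M' R \<longleftrightarrow> as \<in> rel_int T R"
            using agreeD[OF agA, of R as] R V(4) 3(2) by auto
          moreover have "as \<in> rel_int ?M' R \<longleftrightarrow> as \<in> rel_int N' R"
            using in_trunc[OF N'(1), of R as "Suc r"] R by auto
          ultimately show ?thesis by blast
        qed
      qed
      then show ?thesis unfolding x_def using agree_trunc[OF N'(1), of "Suc r" "Suc r"] by simp
    qed
    ultimately show "\<exists>M'\<in>F. q i M' = q i M \<and> x i M'" using fibM' agA by (auto simp: F_def)
  next
    fix i j M M' assume ij: "i \<in> J" "j \<in> J" "i \<noteq> j" "M \<in> F" "M' \<in> F" "q i M = q i M'"
    \<comment> \<open>A tuple lying in both copies lies in \<open>A\<close> and is therefore frozen
      by \<open>q i\<close>; resampling copy \<open>i\<close> cannot affect copy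
      \<open>j\<close>.\<close>
    then have "?U i \<inter> ?U j = A" using disj by (auto simp: J_def)
    then have "as \<in> rel_int M R \<longleftrightarrow> as \<in> rel_int M' R" if "set as \<subseteq> ?U j" for R as
      using qD[OF ij(6), of R as] that by blast
    then show "x j M \<longleftrightarrow> x j M'" by (simp add: x_def agree_def)
  qed
  moreover have "(\<Sum>M\<in>?Fib. of_bool (agree n (Suc r) A T M) * (\<Prod>i\<in>I. 1 - c * of_bool (x i M))) =
      (\<Sum>M\<in>F. \<Prod>i\<in>J. 1 - c * of_bool (x i M))"
  proof -
    have "(\<Sum>M\<in>?Fib. of_bool (agree n (Suc r) A T M) * (\<Prod>i\<in>I. 1 - c * of_bool (x i M))) =
        (\<Sum>M\<in>F. \<Prod>i\<in>I. 1 - c * of_bool (x i M))"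
      unfolding F_def using fib by (intro sum.mono_neutral_cong_right) auto
    also have "\<dots> = (\<Sum>M\<in>F. \<Prod>i\<in>J. 1 - c * of_bool (x i M))"
      using assms(3) xJ by (intro sum.cong refl prod.mono_neutral_right) (auto simp: F_def J_def)
    finally show ?thesis .
  qed
  moreover have "card F * (1 - c / ?C) ^ card J \<le> card ?Fib * (of_bool (agree n r A T B) *
      (\<Prod>i\<in>I. 1 - c / ?C * of_bool (agree n r (?U i) (Tf i) B)))"
  \<comment> \<open>If \<open>B\<close> is right on \<open>A\<close>, then \<open>F\<close> is at
    most the whole fibre and the indices outside \<open>J\<close> give factors 1. If
    \<open>B\<close> is wrong on \<open>A\<close>, no member of the fibre can repair this and
    \<open>F\<close> is empty.\<close>
  proof (cases "agree n r A T B")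
    case True
    have "(\<Prod>i\<in>I. 1 - c / ?C * of_bool (agree n r (?U i) (Tf i) B)) = (\<Prod>i\<in>J. 1 - c / ?C)"
      unfolding J_def using assms(3) by (intro prod.mono_neutral_cong_right) auto
    moreover have "card F \<le> card ?Fib" using fib by (intro card_mono) (auto simp: F_def)
    ultimately show ?thesis using True cC by (simp add: mult_right_mono)
  next
    case False
    then have "F = {}" using agB agree_mono[of n "Suc r" A T _ r A] by (auto simp: F_def)
    then show ?thesis using False by simp
  qed
  ultimately show ?thesis unfolding x_def by linarith
qed

text \<open>The product of the indicator of agreement on \<open>A\<close> with the weighted failure
  factors is a supermartingale by \<open>stage\<close>. Its final value is the indicator of the
  event in question, and its initial value is bounded by the right-hand side.\<close>

lemma all_fail_bound:
  fixes T :: "('a, 'f, 'r) struc" and Tf :: "'i \<Rightarrow> ('a, 'f, 'r) struc"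
  assumes A: "A \<subseteq> universe (G n)" "clG n A = A" and "finite I"
    and Tf: "\<And>i. i \<in> I \<Longrightarrow> placed n (Tf i) \<and> pdim (clG n) (universe (Tf i)) \<le> k \<and>
      A \<subseteq> universe (Tf i) \<and> card (universe (Tf i)) \<le> u"
    and disj: "\<And>i j. i \<in> I \<Longrightarrow> j \<in> I \<Longrightarrow> i \<noteq> j \<Longrightarrow> universe (Tf i) \<inter> universe (Tf j) = A"
    and TA: "\<And>i R as. i \<in> I \<Longrightarrow> R \<in> rels L - rels L0 \<Longrightarrow> set as \<subseteq> A \<Longrightarrow>
      as \<in> rel_int (Tf i) R \<longleftrightarrow> as \<in> rel_int T R"
  shows "dc_prob L0 \<theta> (K (G n)) \<rho>
      (\<lambda>M. agree n \<rho> A T M \<and> (\<forall>i\<in>I. \<not> agree n \<rho> (universe (Tf i)) (Tf i) M))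
    \<le> (1 - 1 / real (expansion_bound u) ^ \<rho>) ^ card I"
proof -
  let ?C = "real (expansion_bound u)"
  \<comment> \<open>The weights lose a factor \<open>?C\<close> with every stage that is still to
    come and end with \<open>c \<rho> = 1\<close>, where a single correct copy makes the product
    vanish.\<close>
  define c where "c r = 1 / ?C ^ (\<rho> - r)" for r
  define F where "F r M = of_bool (agree n r A T M) *
    (\<Prod>i\<in>I. 1 - c r * of_bool (agree n r (universe (Tf i)) (Tf i) M))" for r M
  have C1: "?C \<ge> 1" using expansion_bound_ge_1[of u] by simp
  have c: "0 \<le> c r" "c r \<le> 1" for r using C1 by (auto simp: c_def)
  have cSuc: "c (Suc r) / ?C = c r" if "r < \<rho>" for r
    using that by (simp add: c_def Suc_diff_Suc flip: power_Suc2)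
  note dc = finite_K K_nonempty trunc_trunc'
  have "dc_prob L0 \<theta> (K (G n)) \<rho>
      (\<lambda>M. agree n \<rho> A T M \<and> (\<forall>i\<in>I. \<not> agree n \<rho> (universe (Tf i)) (Tf i) M)) =
      dc_expect L0 \<theta> (K (G n)) \<rho> (F \<rho>)"
  proof -
    have F: "F \<rho> M = of_bool (agree n \<rho> A T M \<and> (\<forall>i\<in>I. \<not> agree n \<rho> (universe (Tf i)) (Tf i) M))" for M
    proof (cases "\<exists>i\<in>I. agree n \<rho> (universe (Tf i)) (Tf i) M")
      case True
      then have "(\<Prod>i\<in>I. 1 - c \<rho> * of_bool (agree n \<rho> (universe (Tf i)) (Tf i) M)) = 0"
        using assms(3) by (auto simp: prod_zero_iff c_def)
      then show ?thesis using True by (auto simp: F_def)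
    next
      case False
      then show ?thesis by (auto simp: F_def)
    qed
    have im: "trunc L0 \<theta> \<rho> ` K (G n) = K (G n)" using trunc_self by auto
    show ?thesis
      unfolding dc_prob_def dc_expect_def im F
      using finite_K[of n] by (intro sum.mono_neutral_cong_left) auto
  qed
  also have "\<dots> \<le> dc_expect L0 \<theta> (K (G n)) 0 (F 0)"
  proof (rule dc_expect_supermartingale[OF dc])
    fix r B assume r: "r < \<rho>" and B: "B \<in> trunc L0 \<theta> r ` K (G n)"
    show "sum (F (Suc r)) (fib n r B) \<le> card (fib n r B) * F r B"
      using stage[where T = T, OF A assms(3) Tf disj TA B c[of "Suc r"]] unfolding F_def cSuc[OF r] .
  qed
  also have "\<dots> \<le> dc_expect L0 \<theta> (K (G n)) 0 (\<lambda>_. (1 - c 0) ^ card I)"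
  proof (rule dc_expect_mono[OF dc])
    fix B
    \<comment> \<open>Tuples of dimension 0 lie in the closure of the empty set, hence in
      \<open>A\<close>. So at stage 0 all copies are right as soon as \<open>A\<close> is, and every
      factor equals \<open>1 - c 0\<close>.\<close>
    have "agree n 0 (universe (Tf i)) (Tf i) B" if "agree n 0 A T B" and i: "i \<in> I" for i
      unfolding agree_def
    proof (intro ballI allI impI)
      fix R as assume R: "R \<in> rels L - rels L0" "set as \<subseteq> universe (Tf i)" "length as = rel_arity L R"
          "pdim (clG n) (set as) \<le> 0"
      have "set as \<subseteq> universe (G n)" using R(2) Tf[OF i] by (auto simp: placed_def)
      then have "set as \<subseteq> A" using G.pdim_0[of n "set as"] R(4) G.cl_mono[of "{}" A n] A by auto
      then show "as \<in> rel_int B R \<longleftrightarrow> as \<in> rel_int (Tf i) R"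
        using agreeD[OF that(1), of R as] TA[OF i R(1)] R by auto
    qed
    then have "F 0 B \<le> (\<Prod>i\<in>I. 1 - c 0)" if "agree n 0 A T B"
      using that by (simp add: F_def)
    then show "F 0 B \<le> (1 - c 0) ^ card I"
      using c[of 0] by (cases "agree n 0 A T B") (auto simp: F_def)
  qed
  also have "\<dots> = (1 - c 0) ^ card I" by (rule dc_expect_const[OF dc])
  finally show ?thesis by (simp add: c_def)
qed


subsection \<open>The union bound\<close>

lemma dc_prob_eq: "dc_prob L0 \<theta> (K (G n)) \<rho> \<phi> =
    (\<Sum>M\<in>K (G n). dc_mass L0 \<theta> (K (G n)) \<rho> M * of_bool (\<phi> M))"
  unfolding dc_prob_def using finite_K[of n] by (intro sum.mono_neutral_cong_left) auto

lemma dc_prob_True: "dc_prob L0 \<theta> (K (G n)) \<rho> (\<lambda>_. True) = 1"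
proof -
  have "trunc L0 \<theta> \<rho> ` K (G n) = K (G n)" using trunc_self by auto
  then show ?thesis
    using dc_expect_const[OF finite_K K_nonempty trunc_trunc', of n \<rho> 1]
    by (simp add: dc_prob_eq dc_expect_def)
qed

lemma dc_prob_mono:
  "(\<And>M. M \<in> K (G n) \<Longrightarrow> \<phi> M \<Longrightarrow> \<psi> M) \<Longrightarrow>
    dc_prob L0 \<theta> (K (G n)) \<rho> \<phi> \<le> dc_prob L0 \<theta> (K (G n)) \<rho> \<psi>"
  unfolding dc_prob_eq by (intro sum_mono mult_left_mono dc_mass_nonneg) auto

lemma dc_prob_not: "dc_prob L0 \<theta> (K (G n)) \<rho> \<phi> = 1 - dc_prob L0 \<theta> (K (G n)) \<rho> (\<lambda>M. \<not> \<phi> M)"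
proof -
  have "dc_prob L0 \<theta> (K (G n)) \<rho> \<phi> + dc_prob L0 \<theta> (K (G n)) \<rho> (\<lambda>M. \<not> \<phi> M) = 1"
    unfolding dc_prob_eq dc_prob_True[of n, symmetric] sum.distrib[symmetric]
    by (intro sum.cong refl) auto
  then show ?thesis by simp
qed

lemma dc_prob_le_1: "dc_prob L0 \<theta> (K (G n)) \<rho> \<phi> \<le> 1"
  using dc_prob_mono[of n \<phi> "\<lambda>_. True"] dc_prob_True by simp

lemma dc_prob_union_bound:
  fixes p :: real
  assumes "finite X" "\<And>M. M \<in> K (G n) \<Longrightarrow> \<phi> M \<Longrightarrow> \<exists>e\<in>X. E e M"
    and "\<And>e. e \<in> X \<Longrightarrow> dc_prob L0 \<theta> (K (G n)) \<rho> (E e) \<le> p"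
  shows "dc_prob L0 \<theta> (K (G n)) \<rho> \<phi> \<le> card X * p"
proof -
  have "dc_prob L0 \<theta> (K (G n)) \<rho> \<phi> \<le>
      (\<Sum>M\<in>K (G n). \<Sum>e\<in>X. dc_mass L0 \<theta> (K (G n)) \<rho> M * of_bool (E e M))"
    unfolding dc_prob_eq
  proof (rule sum_mono)
    fix M assume M: "M \<in> K (G n)"
    have "of_bool (\<phi> M) \<le> (\<Sum>e\<in>X. of_bool (E e M) :: real)"
    proof (cases "\<phi> M")
      case True
      then obtain e where "e \<in> X" "E e M" using assms(2)[OF M] by blast
      then have "of_bool (E e M) \<le> (\<Sum>e\<in>X. of_bool (E e M) :: real)"
        using assms(1) by (intro member_le_sum) auto
      then show ?thesis using \<open>E e M\<close> by simp
    qed (simp add: sum_nonneg)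
    then show "dc_mass L0 \<theta> (K (G n)) \<rho> M * of_bool (\<phi> M) \<le>
        (\<Sum>e\<in>X. dc_mass L0 \<theta> (K (G n)) \<rho> M * of_bool (E e M))"
      unfolding sum_distrib_left[symmetric] by (intro mult_left_mono dc_mass_nonneg)
  qed
  also have "\<dots> = (\<Sum>e\<in>X. dc_prob L0 \<theta> (K (G n)) \<rho> (E e))"
    unfolding dc_prob_eq by (rule sum.swap)
  also have "\<dots> \<le> (\<Sum>e\<in>X. p)" using assms(3) by (rule sum_mono)
  finally show ?thesis by simp
qed

text \<open>The one-step extension problems realised inside \<open>G n\<close>; the structure over
  which \<open>T\<close> extends is the restriction of \<open>T\<close> to \<open>A\<close>. Since
  everything lives on subsets of \<open>G n\<close>, there are finitely many problems, and
  \<open>one_step_multiplicity\<close> reduces arbitrary ones to these.\<close>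

definition extension_data :: "nat \<Rightarrow> ('a set \<times> ('a, 'f, 'r) struc) set" where
  "extension_data n = {(A, T). placed n T \<and> A \<subseteq> universe T \<and> clG n A = A \<and>
     pdim (clG n) A + 1 = pdim (clG n) (universe T) \<and> pdim (clG n) (universe T) \<le> k}"

text \<open>The multiplicity clause of \<open>poly_saturated_seq\<close> for the base class, at the
  single index \<open>n\<close>.\<close>

definition G_multiplicity :: "nat \<Rightarrow> nat \<Rightarrow> bool" where
  "G_multiplicity n l \<longleftrightarrow> (\<forall>N A B. represented L0 (range G) N \<and>
     closed_sub L0 \<theta> A N \<and> closed_sub L0 \<theta> B N \<and> universe A \<subset> universe B \<and>
     dim_in \<theta> N (universe A) + 1 = dim_in \<theta> N (universe B) \<and> dim_in \<theta> N (universe B) \<le> k \<longrightarrow>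
     mult_at_least L0 \<theta> A B (G n) l)"

text \<open>The isomorphism condition is left out because it is added in two forms: over
  \<open>L0\<close> for copies in \<open>G n\<close>, and over \<open>L\<close> for copies in a
  member of \<open>K (G n)\<close>.\<close>

definition copies_over ::
    "nat \<Rightarrow> nat \<Rightarrow> 'a set \<Rightarrow> (nat \<Rightarrow> 'a set) \<Rightarrow> (nat \<Rightarrow> 'a \<Rightarrow> 'a) \<Rightarrow> bool" where
  "copies_over n m A U \<tau> \<longleftrightarrow>
     (\<forall>i\<in>{1..m}. U i \<subseteq> universe (G n) \<and> clG n (U i) = U i \<and> A \<subseteq> U i \<and> (\<forall>x\<in>A. \<tau> i x = x)) \<and>
     (\<forall>i\<in>{1..m}. \<forall>j\<in>{1..m}. i \<noteq> j \<longrightarrow> U i \<inter> U j = A)"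

definition many_copies :: "nat \<Rightarrow> nat \<Rightarrow> ('a, 'f, 'r) struc \<Rightarrow> bool" where
  "many_copies n m M \<longleftrightarrow> (\<forall>(A, T)\<in>extension_data n. agree n \<rho> A T M \<longrightarrow>
     (\<exists>U \<tau>. copies_over n m A U \<tau> \<and> (\<forall>i\<in>{1..m}. iso L (\<tau> i) (restr M (U i)) T)))"

lemma reduct_K: "M \<in> K (G n) \<Longrightarrow> reduct L0 M = G n"
  using K_expansions by blast

lemma closed_sub_reduct:
  assumes "closed_sub L \<theta> A M"
  shows "closed_sub L0 \<theta> (reduct L0 A) (reduct L0 M)"
proof -
  have A: "is_struc L A" "is_struc L M" "universe A \<subseteq> universe M" "A = restr M (universe A)"
      "closed_in \<theta> M (universe A)"
    using assms by (auto simp: closed_sub_def substruc_def)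
  have "reduct L0 A = restr (reduct L0 M) (universe A)"
    using arg_cong[OF A(4), of "reduct L0"] by (simp add: reduct_restr)
  moreover have "is_struc L0 (reduct L0 A)" "is_struc L0 (reduct L0 M)"
    using A is_struc_reduct[OF vocab(1)] by blast+
  ultimately show ?thesis
    using A(3,5) unfolding closed_sub_def substruc_def closed_in_def closure_reduct universe_reduct
    by blast
qed

text \<open>The reduct of \<open>T\<close> is itself a closed substructure of \<open>G n\<close>, so
  the multiplicity of \<open>G n\<close> applies with the identity on \<open>A\<close> as the given
  isomorphism.\<close>

lemma G_copies:
  assumes "G_multiplicity n l" and AT: "(A, T) \<in> extension_data n"
  shows "\<exists>U \<tau>. copies_over n l A U \<tau> \<and>
    (\<forall>i\<in>{1..l}. iso L0 (\<tau> i) (restr (G n) (U i)) (reduct L0 T))"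
proof -
  have T: "placed n T" and A: "A \<subseteq> universe T" "clG n A = A"
    and dim: "pdim (clG n) A + 1 = pdim (clG n) (universe T)" "pdim (clG n) (universe T) \<le> k"
    using AT by (auto simp: extension_data_def)
  have TG: "universe T \<subseteq> universe (G n)" "clG n (universe T) = universe T"
      "reduct L0 T = restr (G n) (universe T)"
    using T by (auto simp: placed_def)
  obtain M where M: "M \<in> K (G n)" using K_nonempty by blast
  have sub: "closed_sub L0 \<theta> (restr (G n) V) (G n)" if "V \<subseteq> universe (G n)" "clG n V = V" for V
    using closed_sub_reduct[OF placed_closed_sub[OF placed_K[OF M], of V]] that
    by (simp add: K_universe[OF M] reduct_restr reduct_K[OF M])
  have AG: "A \<subseteq> universe (G n)" using A TG by blast
  have "represented L0 (range G) (G n)"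
    unfolding represented_def using iso_refl[OF G_struc(1)] by blast
  moreover have "dim_in \<theta> (G n) V = pdim (clG n) V" if "V \<subseteq> universe (G n)" for V
    using that closure_G by (intro pdim_cong) auto
  moreover have "A \<noteq> universe T" using dim by auto
  ultimately have mult: "mult_at_least L0 \<theta> (restr (G n) A) (reduct L0 T) (G n) l"
    using assms(1)[unfolded G_multiplicity_def, rule_format, of "G n" "restr (G n) A" "reduct L0 T"]
      sub[OF AG A(2)] sub[OF TG(1,2)] A dim AG TG by auto
  have isoA: "iso L0 id (restr (G n) A) (restr (G n) A)"
    using sub[OF AG A(2)] by (intro iso_refl) (simp add: closed_sub_def substruc_def)
  have "\<exists>B' \<tau>. (\<forall>i\<in>{1..l}. closed_sub L0 \<theta> (B' i) (G n) \<and> iso L0 (\<tau> i) (B' i) (reduct L0 T) \<and>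
        substruc L0 (restr (G n) A) (B' i) \<and> (\<forall>x\<in>A. \<tau> i x = id x)) \<and>
      (\<forall>i\<in>{1..l}. \<forall>j\<in>{1..l}. i \<noteq> j \<longrightarrow> universe (B' i) \<inter> universe (B' j) = A)"
    using mult[unfolded mult_at_least_def, THEN spec, THEN spec, THEN mp,
      OF conjI[OF sub[OF AG A(2)] isoA]] by (simp only: universe_restr)
  then obtain B' \<tau> where B': "\<And>i. i \<in> {1..l} \<Longrightarrow> closed_sub L0 \<theta> (B' i) (G n) \<and>
        iso L0 (\<tau> i) (B' i) (reduct L0 T) \<and> substruc L0 (restr (G n) A) (B' i) \<and> (\<forall>x\<in>A. \<tau> i x = id x)"
      "\<forall>i\<in>{1..l}. \<forall>j\<in>{1..l}. i \<noteq> j \<longrightarrow> universe (B' i) \<inter> universe (B' j) = A"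
    by blast
  have "universe (B' i) \<subseteq> universe (G n) \<and> clG n (universe (B' i)) = universe (B' i) \<and>
      A \<subseteq> universe (B' i) \<and> (\<forall>x\<in>A. \<tau> i x = x) \<and>
      iso L0 (\<tau> i) (restr (G n) (universe (B' i))) (reduct L0 T)" if "i \<in> {1..l}" for i
  proof -
    have *: "universe (B' i) \<subseteq> universe (G n)" "B' i = restr (G n) (universe (B' i))"
        "closure_by \<theta> (G n) (universe (B' i)) = universe (B' i)" "A \<subseteq> universe (B' i)"
        "iso L0 (\<tau> i) (B' i) (reduct L0 T)" "\<forall>x\<in>A. \<tau> i x = x"
      using B'(1)[OF that] by (auto simp: closed_sub_def substruc_def closed_in_def)
    then show ?thesis using closure_G[OF *(1)] by metis
  qed
  then show ?thesis
    unfolding copies_over_def using B'(2)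
    by (intro exI[of _ "\<lambda>i. universe (B' i)"] exI[of _ \<tau>]) blast
qed

text \<open>An \<open>L0\<close>-copy of the reduct of \<open>B\<close> is turned into an
  \<open>L\<close>-target on the same set by transporting the \<open>L\<close>-structure of
  \<open>B\<close>. By uniqueness of transport its reduct is the \<open>L0\<close>-structure already
  present on \<open>U\<close>.\<close>

lemma placed_pull:
  assumes "represented L KK B" "iso L0 \<tau> (restr (G n) U) (reduct L0 B)"
    and "U \<subseteq> universe (G n)" "clG n U = U"
  shows "placed n (pull L \<tau> U B)" "iso L \<tau> (pull L \<tau> U B) B"
proof -
  have "bij_betw \<tau> U (universe B)" using assms(2) by (simp add: iso_def)
  then show iso: "iso L \<tau> (pull L \<tau> U B) B" using represented_struc[OF assms(1)] by (rule iso_pull)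
  have "reduct L0 (pull L \<tau> U B) = restr (G n) U"
    using pull_eq[OF assms(2)] by (simp add: reduct_pull[OF vocab(1)])
  then show "placed n (pull L \<tau> U B)"
    using represented_iso[OF iso assms(1)] assms by (simp add: placed_def)
qed

lemma agree_restr_eq:
  assumes M: "M \<in> K (G n)" and T: "placed n T" and ag: "agree n \<rho> (universe T) T M"
  shows "restr M (universe T) = T"
proof (rule placed_eqI[OF _ T])
  have TG: "universe T \<subseteq> universe (G n)" "clG n (universe T) = universe T"
    using T by (auto simp: placed_def)
  then show "placed n (restr M (universe T))"
    using placed_restr[OF placed_K[OF M]] K_universe[OF M] by simp
  fix R as assume R: "R \<in> rels L - rels L0" "length as = rel_arity L R"
    "set as \<subseteq> universe (restr M (universe T))"
  then have "pdim (clG n) (set as) \<le> card (set as)"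
    using TG by (intro G.pdim_le_card) auto
  also have "\<dots> \<le> \<rho>" using card_length[of as] R(2) \<rho>_arity[OF R(1)] by simp
  finally show "as \<in> rel_int (restr M (universe T)) R \<longleftrightarrow> as \<in> rel_int T R"
    using agreeD[OF ag, of R as] R by (auto simp: restr_def)
qed simp

text \<open>A problem is given by the closed set \<open>A\<close>, the universe of \<open>T\<close>,
  and an expansion of the \<open>L0\<close>-structure on that universe. The first two are counted by
  \<open>card_closed_sets\<close> and the third by \<open>expansion_bound u\<close>.\<close>

lemma finite_extension_data:
  assumes u: "\<And>U. U \<subseteq> universe (G n) \<Longrightarrow> clG n U = U \<Longrightarrow> pdim (clG n) U \<le> k \<Longrightarrow> card U \<le> u"
  shows "finite (extension_data n)"
    "card (extension_data n) \<le> ((k + 1) * (card (universe (G n)) + 1) ^ k)\<^sup>2 * expansion_bound u"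
proof -
  let ?Cl = "{U. U \<subseteq> universe (G n) \<and> clG n U = U \<and> pdim (clG n) U \<le> k}"
  let ?X = "\<lambda>U. {T. placed n T \<and> universe T = U}"
  let ?S = "SIGMA p:?Cl \<times> ?Cl. ?X (snd p)"
  have finCl: "finite ?Cl" using G_struc(2)[of n] by simp
  have X: "finite (?X U) \<and> card (?X U) \<le> expansion_bound u" if U: "U \<in> ?Cl" for U
    unfolding expansion_bound_def
  proof (rule card_interpretations[OF vocab(3) _ _ \<rho>_arity])
    show "finite U" "card U \<le> u" using U u finite_subset[OF _ G_struc(2)] by auto
    show "is_struc L T" if "T \<in> ?X U" for T
      using that represented_struc by (auto simp: placed_def)
    fix T T' assume T: "T \<in> ?X U" "T' \<in> ?X U"
    then have struc: "is_struc L T" "is_struc L T'" and red: "reduct L0 T = reduct L0 T'"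
      using represented_struc by (auto simp: placed_def)
    have "fun_int T f = fun_int T' f" for f
    proof (cases "f \<in> funs L")
      case True
      then have "fun_int (reduct L0 T) f = fun_int T f" "fun_int (reduct L0 T') f = fun_int T' f"
        using vocab(2) by (simp_all add: reduct_def)
      then show ?thesis using red by simp
    next
      case False
      then show ?thesis using struc by (auto simp: is_struc_def fun_eq_iff)
    qed
    then show "universe T = universe T' \<and> fun_int T = fun_int T'" using T by auto
    fix R and as :: "'a list" assume R: "\<not> (R \<in> rels L - rels L0 \<and> set as \<subseteq> U)"
    show "as \<in> rel_int T R \<longleftrightarrow> as \<in> rel_int T' R"
    proof (cases "R \<in> rels L0")
      case True
      then have "rel_int (reduct L0 T) R = rel_int T R" "rel_int (reduct L0 T') R = rel_int T' R"
        by (simp_all add: reduct_def)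
      then show ?thesis using red by simp
    next
      case False
      have "as \<notin> rel_int T R" if T: "T \<in> ?X U" for T
      proof
        assume as: "as \<in> rel_int T R"
        have T': "is_struc L T" "universe T = U" using T represented_struc by (auto simp: placed_def)
        then have "R \<in> rels L" using as unfolding is_struc_def by blast
        moreover from this have "set as \<subseteq> U" using as T' unfolding is_struc_def tuples_def by blast
        ultimately show False using R False by blast
      qed
      then show ?thesis using T by blast
    qed
  qed
  have sub: "extension_data n \<subseteq> (\<lambda>((A, U), T). (A, T)) ` ?S"
  proof
    fix e assume "e \<in> extension_data n"
    then obtain A T where e: "e = (A, T)" and T: "placed n T" "A \<subseteq> universe T" "clG n A = A"
        "pdim (clG n) A \<le> k" "pdim (clG n) (universe T) \<le> k"
      by (force simp: extension_data_def)
    then have "A \<in> ?Cl" "universe T \<in> ?Cl" by (auto simp: placed_def)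
    then have "((A, universe T), T) \<in> ?S" using T by simp
    then show "e \<in> (\<lambda>((A, U), T). (A, T)) ` ?S" by (rule rev_image_eqI) (simp add: e)
  qed
  have finS: "finite ?S" using finCl X by (intro finite_SigmaI) auto
  show fin: "finite (extension_data n)" using finite_subset[OF sub] finS by simp
  have "card (extension_data n) \<le> card ?S"
    by (rule surj_card_le[OF finS sub])
  also have "\<dots> = (\<Sum>p\<in>?Cl \<times> ?Cl. card (?X (snd p)))"
    using finCl X by (intro card_SigmaI) auto
  also have "\<dots> \<le> (\<Sum>p\<in>?Cl \<times> ?Cl. expansion_bound u)" using X by (intro sum_mono) auto
  also have "\<dots> = (card ?Cl)\<^sup>2 * expansion_bound u"
    by (simp add: card_cartesian_product power2_eq_square)
  also have "\<dots> \<le> ((k + 1) * (card (universe (G n)) + 1) ^ k)\<^sup>2 * expansion_bound u"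
    using G.card_closed_sets[of n k] by (intro mult_right_mono power_mono) auto
  finally show "card (extension_data n) \<le>
      ((k + 1) * (card (universe (G n)) + 1) ^ k)\<^sup>2 * expansion_bound u" .
qed

text \<open>For each problem, \<open>m * s\<close> of the available copies are split into
  \<open>m\<close> blocks of \<open>s\<close>. If no block fails entirely, every block contributes
  one correct copy. The union bound runs over all pairs of a problem and a block.\<close>

lemma many_copies_prob:
  assumes u: "\<And>U. U \<subseteq> universe (G n) \<Longrightarrow> clG n U = U \<Longrightarrow> pdim (clG n) U \<le> k \<Longrightarrow> card U \<le> u"
    and mult: "G_multiplicity n l" and ms: "m * s \<le> l"
  shows "dc_prob L0 \<theta> (K (G n)) \<rho> (\<lambda>M. \<not> many_copies n m M) \<le>
    card (extension_data n) * m * (1 - 1 / real (expansion_bound u) ^ \<rho>) ^ s"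
proof -
  obtain U \<tau> where U\<tau>: "\<And>A T. (A, T) \<in> extension_data n \<Longrightarrow> copies_over n l A (U A T) (\<tau> A T) \<and>
      (\<forall>i\<in>{1..l}. iso L0 (\<tau> A T i) (restr (G n) (U A T i)) (reduct L0 T))"
    using G_copies[OF mult] by metis
  define Tf where "Tf A T i = pull L (\<tau> A T i) (U A T i) T" for A T i
  \<comment> \<open>Blocks are numbered from 0 and copies from 1; for \<open>g < m\<close> the block
    ends at \<open>(g + 1) * s\<close>, which is at most \<open>m * s\<close> and so at most
    \<open>l\<close>.\<close>
  define I where "I g = {g * s + 1..g * s + s}" for g
  define E where "E = (\<lambda>((A, T), g) M. agree n \<rho> A T M \<and>
    (\<forall>i\<in>I g. \<not> agree n \<rho> (universe (Tf A T i)) (Tf A T i) M))"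
  have Il: "I g \<subseteq> {1..l}" if "g < m" for g
  proof -
    have "(g + 1) * s \<le> m * s" using that by (intro mult_right_mono) auto
    then show ?thesis using ms by (auto simp: I_def)
  qed
  have Idisj: "g = g'" if "i \<in> I g" "i \<in> I g'" for i g g'
  proof (rule ccontr)
    assume "g \<noteq> g'"
    then consider "g + 1 \<le> g'" | "g' + 1 \<le> g" by linarith
    then show False
    proof cases
      case 1
      then have "(g + 1) * s \<le> g' * s" by (intro mult_right_mono) auto
      then show False using that by (auto simp: I_def)
    next
      case 2
      then have "(g' + 1) * s \<le> g * s" by (intro mult_right_mono) auto
      then show False using that by (auto simp: I_def)
    qed
  qed
  have copy: "U A T i \<subseteq> universe (G n)" "clG n (U A T i) = U A T i" "A \<subseteq> U A T i"
      "\<And>x. x \<in> A \<Longrightarrow> \<tau> A T i x = x" "placed n (Tf A T i)" "iso L (\<tau> A T i) (Tf A T i) T"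
      "universe (Tf A T i) = U A T i"
    if AT: "(A, T) \<in> extension_data n" and i: "i \<in> {1..l}" for A T i
  proof -
    show *: "U A T i \<subseteq> universe (G n)" "clG n (U A T i) = U A T i" "A \<subseteq> U A T i"
        "\<And>x. x \<in> A \<Longrightarrow> \<tau> A T i x = x"
      using U\<tau>[OF AT] i by (auto simp: copies_over_def)
    have "represented L KK T" using AT by (auto simp: extension_data_def placed_def)
    then show "placed n (Tf A T i)" "iso L (\<tau> A T i) (Tf A T i) T"
      unfolding Tf_def using placed_pull * U\<tau>[OF AT] i by blast+
    show "universe (Tf A T i) = U A T i" by (simp add: Tf_def)
  qed
  have disj: "U A T i \<inter> U A T j = A"
    if "(A, T) \<in> extension_data n" "i \<in> {1..l}" "j \<in> {1..l}" "i \<noteq> j" for A T i j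
    using U\<tau>[OF that(1)] that(2-4) by (simp add: copies_over_def)
  have E_bound: "dc_prob L0 \<theta> (K (G n)) \<rho> (E e) \<le> (1 - 1 / real (expansion_bound u) ^ \<rho>) ^ s"
    if e: "e \<in> extension_data n \<times> {..<m}" for e
  proof -
    obtain A T g where e': "e = ((A, T), g)" and AT: "(A, T) \<in> extension_data n" and g: "g < m"
      using e by (cases e) auto
    have A: "A \<subseteq> universe (G n)" "clG n A = A" and dimT: "pdim (clG n) (universe T) \<le> k"
      using AT by (auto simp: extension_data_def placed_def)
    have "dc_prob L0 \<theta> (K (G n)) \<rho> (\<lambda>M. agree n \<rho> A T M \<and>
        (\<forall>i\<in>I g. \<not> agree n \<rho> (universe (Tf A T i)) (Tf A T i) M))
      \<le> (1 - 1 / real (expansion_bound u) ^ \<rho>) ^ card (I g)"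
    proof (rule all_fail_bound[OF A])
      show "finite (I g)" by (simp add: I_def)
    next
      fix i assume "i \<in> I g"
      then have i: "i \<in> {1..l}" using Il[OF g] by blast
      have "pdim (clG n) (U A T i) = dim_in \<theta> (Tf A T i) (U A T i)"
        using placed_dim copy[OF AT i] by simp
      also have "\<dots> = dim_in \<theta> T (\<tau> A T i ` U A T i)"
        using iso_dim[OF copy(6)[OF AT i]] copy(7)[OF AT i] by simp
      also have "\<tau> A T i ` U A T i = universe T"
        using copy(6,7)[OF AT i] by (auto simp: iso_def bij_betw_def)
      also have "dim_in \<theta> T (universe T) = pdim (clG n) (universe T)"
        using AT placed_dim by (auto simp: extension_data_def)
      finally have "pdim (clG n) (U A T i) \<le> k" using dimT by simp
      then show "placed n (Tf A T i) \<and> pdim (clG n) (universe (Tf A T i)) \<le> k \<and>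
          A \<subseteq> universe (Tf A T i) \<and> card (universe (Tf A T i)) \<le> u"
        using copy[OF AT i] u by simp
      fix R and as :: "'a list" assume R: "R \<in> rels L - rels L0" "set as \<subseteq> A"
      have "is_struc L T" using copy(6)[OF AT i] by (simp add: iso_def)
      then have len: "length as = rel_arity L R" if "as \<in> rel_int T R"
        using that R unfolding is_struc_def tuples_def by blast
      \<comment> \<open>The isomorphism fixes \<open>A\<close> pointwise, so the transported
        structure has on \<open>A\<close> exactly the relations of \<open>T\<close>.\<close>
      have "map (\<tau> A T i) as = as" using R(2) copy(4)[OF AT i] by (intro map_idI) auto
      then show "as \<in> rel_int (Tf A T i) R \<longleftrightarrow> as \<in> rel_int T R"
        using R copy(3)[OF AT i] len by (auto simp: Tf_def pull_def tuples_def)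
    next
      fix i j assume "i \<in> I g" "j \<in> I g" "i \<noteq> j"
      then have "U A T i \<inter> U A T j = A" using disj[OF AT, of i j] Il[OF g] by blast
      then show "universe (Tf A T i) \<inter> universe (Tf A T j) = A" by (simp add: Tf_def)
    qed
    then show ?thesis by (simp add: e' E_def I_def)
  qed
  have "dc_prob L0 \<theta> (K (G n)) \<rho> (\<lambda>M. \<not> many_copies n m M) \<le>
    card (extension_data n \<times> {..<m}) * (1 - 1 / real (expansion_bound u) ^ \<rho>) ^ s"
  proof (rule dc_prob_union_bound[OF _ _ E_bound])
    show "finite (extension_data n \<times> {..<m})" using finite_extension_data(1)[OF u] by simp
    fix M assume M: "M \<in> K (G n)" and not: "\<not> many_copies n m M"
    show "\<exists>e\<in>extension_data n \<times> {..<m}. E e M"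
    proof (rule ccontr)
      assume none: "\<not> ?thesis"
      have "\<exists>U' \<tau>'. copies_over n m A U' \<tau>' \<and> (\<forall>i\<in>{1..m}. iso L (\<tau>' i) (restr M (U' i)) T)"
        if AT: "(A, T) \<in> extension_data n" and ag: "agree n \<rho> A T M" for A T
      proof -
        have "\<exists>i\<in>I g. agree n \<rho> (universe (Tf A T i)) (Tf A T i) M" if g: "g < m" for g
        proof (rule ccontr)
          assume "\<not> ?thesis"
          then have "E ((A, T), g) M" using ag by (simp add: E_def)
          then show False using none AT g by blast
        qed
        then obtain h where h: "\<And>g. g < m \<Longrightarrow> h g \<in> I g"
            "\<And>g. g < m \<Longrightarrow> agree n \<rho> (universe (Tf A T (h g))) (Tf A T (h g)) M"
          by metis
        have h1: "h (j - 1) \<in> {1..l}" if "j \<in> {1..m}" for j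
        proof -
          have "j - 1 < m" using that by auto
          then show ?thesis using h(1) Il by blast
        qed
        \<comment> \<open>\<open>h\<close> picks a correct copy from each block. The shift by 1
          converts copy numbers, which start at 1, into block numbers, and disjointness of the
          blocks makes the chosen copies distinct.\<close>
        have hne: "h (i - 1) \<noteq> h (j - 1)" if "i \<in> {1..m}" "j \<in> {1..m}" "i \<noteq> j" for i j
        proof
          assume eq: "h (i - 1) = h (j - 1)"
          have "i - 1 < m" "j - 1 < m" using that by auto
          then have "i - 1 = j - 1" using h(1)[of "i - 1"] h(1)[of "j - 1"] Idisj unfolding eq by blast
          then show False using that by auto
        qed
        have "iso L (\<tau> A T (h (j - 1))) (restr M (U A T (h (j - 1)))) T" if j: "j \<in> {1..m}" for j
        proof -
          note c = copy[OF AT h1[OF j]]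
          have "j - 1 < m" using j by auto
          then have "restr M (U A T (h (j - 1))) = Tf A T (h (j - 1))"
            using agree_restr_eq[OF M c(5) h(2)] c(7) by simp
          then show ?thesis using c(6) by simp
        qed
        moreover have "copies_over n m A (\<lambda>j. U A T (h (j - 1))) (\<lambda>j. \<tau> A T (h (j - 1)))"
          unfolding copies_over_def using copy(1-4)[OF AT h1] disj[OF AT h1 h1 hne] by simp
        ultimately show ?thesis by blast
      qed
      then show False using not by (auto simp: many_copies_def)
    qed
  qed
  then show ?thesis by (simp add: card_cartesian_product)
qed


subsection \<open>Multiplicities and extension axioms\<close>

text \<open>An abstract problem over a closed \<open>A'\<close> in \<open>M\<close> is moved into
  \<open>G n\<close>: the base structure contains a copy of the reduct of \<open>B\<close> over
  \<open>A'\<close>, and transporting \<open>B\<close> to that copy gives a target \<open>T\<close>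
  in \<open>extension_data n\<close>. The copies of \<open>T\<close> supplied by
  \<open>many_copies\<close>, composed with the isomorphism from \<open>T\<close> to
  \<open>B\<close>, are the required ones.\<close>

lemma one_step_multiplicity:
  assumes M: "M \<in> K (G n)" and many: "many_copies n m M" and mult: "G_multiplicity n l" "1 \<le> l"
    and N: "represented L KK N" and A: "closed_sub L \<theta> A N" and B: "closed_sub L \<theta> B N"
    and AB: "universe A \<subset> universe B"
    and dim: "dim_in \<theta> N (universe A) + 1 = dim_in \<theta> N (universe B)"
      "dim_in \<theta> N (universe B) \<le> k"
  shows "mult_at_least L \<theta> A B M m"
  unfolding mult_at_least_def
proof (intro allI impI)
  fix A' \<sigma> assume "closed_sub L \<theta> A' M \<and> iso L \<sigma> A' A"
  then have A': "closed_sub L \<theta> A' M" and \<sigma>: "iso L \<sigma> A' A" by auto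
  have B_rep: "represented L KK B" using sub_represented[OF N B] .
  have red: "closed_sub L0 \<theta> (reduct L0 A) (reduct L0 N)" "closed_sub L0 \<theta> (reduct L0 B) (reduct L0 N)"
      "closed_sub L0 \<theta> (reduct L0 A') (G n)" "iso L0 \<sigma> (reduct L0 A') (reduct L0 A)"
    using closed_sub_reduct[OF A] closed_sub_reduct[OF B] closed_sub_reduct[OF A'] reduct_K[OF M]
      iso_reduct[OF vocab(1) \<sigma>] by auto
  have "represented L0 (range G) (reduct L0 N)"
  proof -
    obtain n' N' \<phi> where "N' \<in> K (G n')" "iso L \<phi> N N'"
      using N KK_eq by (auto simp: represented_def)
    then show ?thesis
      unfolding represented_def using iso_reduct[OF vocab(1)] reduct_K by (metis rangeI)
  qed
  then have "mult_at_least L0 \<theta> (reduct L0 A) (reduct L0 B) (G n) l"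
    using mult(1)[unfolded G_multiplicity_def, rule_format, of "reduct L0 N" "reduct L0 A" "reduct L0 B"]
      red AB dim by (simp add: closure_reduct)
  from this[unfolded mult_at_least_def, THEN spec, THEN spec, THEN mp, OF conjI[OF red(3,4)]]
  obtain B1 \<tau>1 where "\<forall>i\<in>{1..l}. closed_sub L0 \<theta> (B1 i) (G n) \<and> iso L0 (\<tau>1 i) (B1 i) (reduct L0 B) \<and>
      substruc L0 (reduct L0 A') (B1 i) \<and> (\<forall>x\<in>universe (reduct L0 A'). \<tau>1 i x = \<sigma> x)"
    by (elim exE conjE)
  \<comment> \<open>A single copy suffices to place the problem in \<open>G n\<close>; the
    assumption \<open>1 \<le> l\<close> makes index 1 available.\<close>
  then have "closed_sub L0 \<theta> (B1 1) (G n) \<and> iso L0 (\<tau>1 1) (B1 1) (reduct L0 B) \<and>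
      substruc L0 (reduct L0 A') (B1 1) \<and> (\<forall>x\<in>universe (reduct L0 A'). \<tau>1 1 x = \<sigma> x)"
    using mult(2) by simp
  then obtain B0 \<tau> where B0: "closed_sub L0 \<theta> B0 (G n)" "iso L0 \<tau> B0 (reduct L0 B)"
      "substruc L0 (reduct L0 A') B0" and \<tau>: "\<And>x. x \<in> universe A' \<Longrightarrow> \<tau> x = \<sigma> x"
    unfolding universe_reduct by blast
  let ?V = "universe B0" and ?A = "universe A'"
  have V: "?V \<subseteq> universe (G n)" "clG n ?V = ?V" "B0 = restr (G n) ?V" "?A \<subseteq> ?V"
    using B0 closure_G[of ?V n] by (auto simp: closed_sub_def substruc_def closed_in_def)
  define T where "T = pull L \<tau> ?V B"
  have T: "placed n T" "iso L \<tau> T B" "universe T = ?V"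
    using placed_pull[OF B_rep _ V(1,2), of \<tau>] B0(2) V(3) by (auto simp: T_def)
  have A'M: "?A \<subseteq> universe (G n)" "clG n ?A = ?A" "A' = restr M ?A" "is_struc L A'"
  proof -
    have *: "?A \<subseteq> universe (G n)" using V by blast
    then show "?A \<subseteq> universe (G n)" "clG n ?A = ?A" "A' = restr M ?A" "is_struc L A'"
      using A' closure_K[OF M *] by (auto simp: closed_sub_def substruc_def closed_in_def)
  qed
  \<comment> \<open>Isomorphisms compare dimensions inside the substructures, while the hypotheses
    measure them in the ambient structures; \<open>sub_closure\<close> mediates.\<close>
  have sub_dim: "dim_in \<theta> C (universe C) = dim_in \<theta> N' (universe C)"
    if "represented L KK N'" "closed_sub L \<theta> C N'" for C N'
    using sub_closure[OF that] by (intro pdim_cong) blast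
  have dimA: "pdim (clG n) ?A = dim_in \<theta> N (universe A)"
  proof -
    have "pdim (clG n) ?A = dim_in \<theta> A' ?A"
      using sub_dim[OF K_represented[OF M] A'] K_dim[OF M A'M(1)] by simp
    also have "\<dots> = dim_in \<theta> A (\<sigma> ` ?A)" using iso_dim[OF \<sigma>] by simp
    also have "\<sigma> ` ?A = universe A" using \<sigma> by (simp add: iso_def bij_betw_def)
    finally show ?thesis using sub_dim[OF N A] by simp
  qed
  have dimB: "pdim (clG n) ?V = dim_in \<theta> N (universe B)"
  proof -
    have "pdim (clG n) ?V = dim_in \<theta> T ?V" using placed_dim[OF T(1)] T(3) by simp
    also have "\<dots> = dim_in \<theta> B (\<tau> ` ?V)" using iso_dim[OF T(2)] T(3) by simp
    also have "\<tau> ` ?V = universe B" using T(2,3) by (simp add: iso_def bij_betw_def)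
    finally show ?thesis using sub_dim[OF N B] by simp
  qed
  have "(?A, T) \<in> extension_data n"
    using T V(4) A'M(2) dimA dimB dim by (simp add: extension_data_def)
  \<comment> \<open>The map \<open>\<tau>\<close> extends \<open>\<sigma>\<close>, which is an
    isomorphism over the full vocabulary \<open>L\<close>, so \<open>T\<close> and \<open>M\<close>
    induce the same relations on \<open>A'\<close>.\<close>
  moreover have "agree n \<rho> ?A T M"
    unfolding agree_def
  proof (intro ballI allI impI)
    fix R as assume R: "R \<in> rels L - rels L0" "set as \<subseteq> ?A" "length as = rel_arity L R"
    have eq: "map \<tau> as = map \<sigma> as" using \<tau> R(2) by auto
    have "\<sigma> ` ?A = universe A" using \<sigma> by (simp add: iso_def bij_betw_def)
    then have im: "set (map \<sigma> as) \<subseteq> universe A" using R(2) by auto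
    have "A = restr N (universe A)" "B = restr N (universe B)"
      using A B by (auto simp: closed_sub_def substruc_def)
    then have "rel_int A R = rel_int (restr N (universe A)) R"
        "rel_int B R = rel_int (restr N (universe B)) R"
      by simp_all
    then have "map \<sigma> as \<in> rel_int B R \<longleftrightarrow> map \<sigma> as \<in> rel_int A R"
      using im AB by (auto simp: restr_def)
    moreover have "as \<in> rel_int T R \<longleftrightarrow> map \<sigma> as \<in> rel_int B R"
      unfolding T_def eq[symmetric] using R V(4) by (auto simp: pull_def tuples_def)
    moreover have "as \<in> rel_int A' R \<longleftrightarrow> map \<sigma> as \<in> rel_int A R"
      using \<sigma> R by (auto simp: iso_def tuples_def)
    moreover have "as \<in> rel_int A' R \<longleftrightarrow> as \<in> rel_int M R"
      using arg_cong[OF A'M(3), of "\<lambda>M. rel_int M R"] R(2) by (auto simp: restr_def)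
    ultimately show "as \<in> rel_int M R \<longleftrightarrow> as \<in> rel_int T R" by blast
  qed
  ultimately obtain U \<upsilon> where U: "copies_over n m ?A U \<upsilon>"
      "\<forall>i\<in>{1..m}. iso L (\<upsilon> i) (restr M (U i)) T"
    using many unfolding many_copies_def by blast
  let ?B' = "\<lambda>i. restr M (U i)" and ?\<tau>' = "\<lambda>i. \<tau> \<circ> \<upsilon> i"
  have "closed_sub L \<theta> (?B' i) M \<and> iso L (?\<tau>' i) (?B' i) B \<and> substruc L A' (?B' i) \<and>
      (\<forall>x\<in>?A. ?\<tau>' i x = \<sigma> x)" if i: "i \<in> {1..m}" for i
  proof -
    have Ui: "U i \<subseteq> universe M" "clG n (U i) = U i" "?A \<subseteq> U i" "\<forall>x\<in>?A. \<upsilon> i x = x"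
      using U(1) i K_universe[OF M] by (auto simp: copies_over_def)
    have sub: "closed_sub L \<theta> (?B' i) M" using placed_closed_sub[OF placed_K[OF M] Ui(1,2)] .
    moreover have "iso L (?\<tau>' i) (?B' i) B" using iso_trans[OF _ T(2)] U(2) i by blast
    moreover have "substruc L A' (?B' i)"
      using sub A'M(3,4) Ui(3) by (simp add: closed_sub_def substruc_def restr_restr)
    ultimately show ?thesis using Ui(4) \<tau> by simp
  qed
  moreover have "\<forall>i\<in>{1..m}. \<forall>j\<in>{1..m}. i \<noteq> j \<longrightarrow> universe (?B' i) \<inter> universe (?B' j) = ?A"
    using U(1) by (simp add: copies_over_def)
  ultimately show "\<exists>B' \<tau>. (\<forall>i\<in>{1..m}. closed_sub L \<theta> (B' i) M \<and> iso L (\<tau> i) (B' i) B \<and>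
        substruc L A' (B' i) \<and> (\<forall>x\<in>?A. \<tau> i x = \<sigma> x)) \<and>
      (\<forall>i\<in>{1..m}. \<forall>j\<in>{1..m}. i \<noteq> j \<longrightarrow> universe (B' i) \<inter> universe (B' j) = ?A)"
    by (intro exI[of _ ?B'] exI[of _ ?\<tau>']) blast
qed

lemma mult_1_iff: "mult_at_least L \<theta> A B M 1 \<longleftrightarrow>
    (\<forall>A' \<sigma>. closed_sub L \<theta> A' M \<longrightarrow> iso L \<sigma> A' A \<longrightarrow>
      (\<exists>B' \<tau>. closed_sub L \<theta> B' M \<and> iso L \<tau> B' B \<and> substruc L A' B' \<and> (\<forall>x\<in>universe A'. \<tau> x = \<sigma> x)))"
  (is "?lhs \<longleftrightarrow> ?rhs")
proof
  assume l: ?lhs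
  show ?rhs
  proof (intro allI impI)
    fix A' \<sigma> assume "closed_sub L \<theta> A' M" "iso L \<sigma> A' A"
    from l[unfolded mult_at_least_def, THEN spec, THEN spec, THEN mp, OF conjI[OF this]]
    show "\<exists>B' \<tau>. closed_sub L \<theta> B' M \<and> iso L \<tau> B' B \<and> substruc L A' B' \<and> (\<forall>x\<in>universe A'. \<tau> x = \<sigma> x)"
      by auto
  qed
next
  assume r: ?rhs
  show ?lhs
    unfolding mult_at_least_def
  proof (intro allI impI)
    fix A' \<sigma> assume "closed_sub L \<theta> A' M \<and> iso L \<sigma> A' A"
    then obtain B' \<tau> where "closed_sub L \<theta> B' M \<and> iso L \<tau> B' B \<and> substruc L A' B' \<and>
        (\<forall>x\<in>universe A'. \<tau> x = \<sigma> x)"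
      using r by blast
    then show "\<exists>B' \<tau>. (\<forall>i\<in>{1..1}. closed_sub L \<theta> (B' i) M \<and> iso L (\<tau> i) (B' i) B \<and>
          substruc L A' (B' i) \<and> (\<forall>x\<in>universe A'. \<tau> i x = \<sigma> x)) \<and>
        (\<forall>i\<in>{1..1::nat}. \<forall>j\<in>{1..1::nat}. i \<noteq> j \<longrightarrow> universe (B' i) \<inter> universe (B' j) = universe A')"
      by (intro exI[of _ "\<lambda>_. B'"] exI[of _ "\<lambda>_. \<tau>"]) auto
  qed
qed

text \<open>Adjoining one element of \<open>B\<close> to \<open>A\<close> and closing gives a
  one-dimensional step to some \<open>A1\<close> inside \<open>B\<close>. An extension along this
  step is continued by the induction hypothesis for \<open>B\<close> over \<open>A1\<close>.\<close>

lemma extension_axiom: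
  assumes one: "\<And>A B. closed_sub L \<theta> A N \<Longrightarrow> closed_sub L \<theta> B N \<Longrightarrow> universe A \<subset> universe B \<Longrightarrow>
      dim_in \<theta> N (universe A) + 1 = dim_in \<theta> N (universe B) \<Longrightarrow> dim_in \<theta> N (universe B) \<le> k \<Longrightarrow>
      mult_at_least L \<theta> A B M 1"
    and N: "represented L KK N" and B: "closed_sub L \<theta> B N" "dim_in \<theta> N (universe B) \<le> k"
    and A: "closed_sub L \<theta> A N" "universe A \<subseteq> universe B"
  shows "mult_at_least L \<theta> A B M 1"
  using A
proof (induction "card (universe B - universe A)" arbitrary: A rule: less_induct)
  case less
  interpret N: finite_pregeometry "universe N" "closure_by \<theta> N"
    by (rule represented_pregeometry[OF N])
  have sub: "universe A \<subseteq> universe N" "closure_by \<theta> N (universe A) = universe A"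
      "A = restr N (universe A)" "is_struc L A"
      "universe B \<subseteq> universe N" "closure_by \<theta> N (universe B) = universe B"
      "B = restr N (universe B)"
    using less.prems B by (auto simp: closed_sub_def substruc_def closed_in_def)
  show ?case
  proof (cases "universe A = universe B")
    case True
    then have "A = B" using sub by metis
    show ?thesis
      unfolding mult_1_iff
    proof (intro allI impI)
      fix A' \<sigma> assume *: "closed_sub L \<theta> A' M" "iso L \<sigma> A' A"
      then have "is_struc L A'" by (simp add: iso_def)
      then have "substruc L A' A'" using restr_universe[of L A'] by (simp add: substruc_def)
      then show "\<exists>B' \<tau>. closed_sub L \<theta> B' M \<and> iso L \<tau> B' B \<and> substruc L A' B' \<and>
          (\<forall>x\<in>universe A'. \<tau> x = \<sigma> x)"
        using * \<open>A = B\<close> by blast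
    qed
  next
    case False
    then obtain b where b: "b \<in> universe B" "b \<notin> universe A" using less.prems by blast
    let ?X = "insert b (universe A)"
    let ?U = "closure_by \<theta> N ?X"
    let ?A1 = "restr N ?U"
    have X: "?X \<subseteq> universe N" "?X \<subseteq> universe B" using b sub less.prems(2) by auto
    have U: "?U \<subseteq> universe N" "closure_by \<theta> N ?U = ?U" "?X \<subseteq> ?U"
      using N.cl_sub[OF X(1)] N.cl_idem[OF X(1)] N.cl_extensive[OF X(1)] by auto
    have UB: "?U \<subseteq> universe B" using N.cl_mono[OF X(2) sub(5)] sub(6) by simp
    have A1: "closed_sub L \<theta> ?A1 N"
      using represented_closed_sub[OF N] U by (simp add: closed_in_def)
    have dim: "dim_in \<theta> N ?U = dim_in \<theta> N (universe A) + 1"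
      using N.pdim_insert[OF sub(1,2) _ b(2)] X(1) by simp
    have "dim_in \<theta> N ?U \<le> k"
      using N.pdim_mono[of ?U "universe B"] UB sub(5,6) B(2) by simp
    then have step: "mult_at_least L \<theta> A ?A1 M 1"
      using one[OF less.prems(1) A1] U(3) b dim by auto
    have "universe B - universe ?A1 \<subset> universe B - universe A" using U(3) b by auto
    then have "card (universe B - universe ?A1) < card (universe B - universe A)"
      using finite_subset[OF sub(5) N.finite_carrier] by (intro psubset_card_mono) auto
    then have rest: "mult_at_least L \<theta> ?A1 B M 1" using less.hyps A1 UB by simp
    show ?thesis
      unfolding mult_1_iff
    proof (intro allI impI)
      fix A' \<sigma> assume "closed_sub L \<theta> A' M" "iso L \<sigma> A' A"
      then obtain A1' \<sigma>1 where 1: "closed_sub L \<theta> A1' M" "iso L \<sigma>1 A1' ?A1" "substruc L A' A1'"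
          "\<forall>x\<in>universe A'. \<sigma>1 x = \<sigma> x"
        using step unfolding mult_1_iff by blast
      then obtain B' \<tau> where 2: "closed_sub L \<theta> B' M" "iso L \<tau> B' B" "substruc L A1' B'"
          "\<forall>x\<in>universe A1'. \<tau> x = \<sigma>1 x"
        using rest unfolding mult_1_iff by blast
      have "substruc L A' B'"
      proof -
        have s: "universe A' \<subseteq> universe A1'" "universe A1' \<subseteq> universe B'"
            "A' = restr A1' (universe A')" "A1' = restr B' (universe A1')" "is_struc L A'" "is_struc L B'"
          using 1(3) 2(3) by (auto simp: substruc_def)
        have "A' = restr (restr B' (universe A1')) (universe A')" using s(3,4) by simp
        then show ?thesis using s restr_restr[OF s(1), of B'] by (simp add: substruc_def)
      qed
      moreover have "\<forall>x\<in>universe A'. \<tau> x = \<sigma> x" using 1(3,4) 2(4) by (auto simp: substruc_def)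
      ultimately show "\<exists>B' \<tau>. closed_sub L \<theta> B' M \<and> iso L \<tau> B' B \<and> substruc L A' B' \<and>
          (\<forall>x\<in>universe A'. \<tau> x = \<sigma> x)"
        using 2(1,2) by blast
    qed
  qed
qed

lemma mult_at_least_mono:
  assumes "mult_at_least L \<theta> A B M m" "m' \<le> m"
  shows "mult_at_least L \<theta> A B M m'"
proof -
  have sub: "{1..m'} \<subseteq> {1..m}" using assms(2) by auto
  show ?thesis
    unfolding mult_at_least_def
  proof (intro allI impI, goal_cases)
    case (1 A' \<sigma>)
    from assms(1)[unfolded mult_at_least_def, THEN spec, THEN spec, THEN mp, OF 1]
    obtain B' \<tau> where *: "\<forall>i\<in>{1..m}. closed_sub L \<theta> (B' i) M \<and> iso L (\<tau> i) (B' i) B \<and>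
          substruc L A' (B' i) \<and> (\<forall>x\<in>universe A'. \<tau> i x = \<sigma> x)"
        "\<forall>i\<in>{1..m}. \<forall>j\<in>{1..m}. i \<noteq> j \<longrightarrow> universe (B' i) \<inter> universe (B' j) = universe A'"
      by (elim exE conjE)
    show ?case
      by (intro exI[of _ B'] exI[of _ \<tau>] conjI ballI impI)
        (use * sub in \<open>simp_all add: subset_iff\<close>)
  qed
qed

end

section \<open>Polynomial against geometric growth\<close>

text \<open>\<open>Q\<close> arises from \<open>P\<close> by taking absolute values of the
  coefficients. It is used because the saturation bound \<open>P\<close> need not be monotone, while
  its argument is later only bounded from above.\<close>

lemma poly_monotone_majorant:
  fixes P :: "real poly"
  shows "\<exists>Q. \<forall>x y. 0 \<le> x \<longrightarrow> x \<le> y \<longrightarrow> \<bar>poly P x\<bar> \<le> poly Q y"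
proof (induction P)
  case 0
  then show ?case by (intro exI[of _ 0]) simp
next
  case (pCons a P)
  then obtain Q where Q: "\<And>x y. 0 \<le> x \<Longrightarrow> x \<le> y \<Longrightarrow> \<bar>poly P x\<bar> \<le> poly Q y" by blast
  have "\<bar>poly (pCons a P) x\<bar> \<le> poly (pCons \<bar>a\<bar> Q) y" if "0 \<le> x" "x \<le> y" for x y
  proof -
    have "\<bar>x * poly P x\<bar> \<le> y * poly Q y"
      unfolding abs_mult using that Q[OF that] by (intro mult_mono) auto
    then show ?thesis by simp
  qed
  then show ?case by blast
qed

text \<open>Write \<open>q ^ s\<close> as \<open>sqrt q ^ s * sqrt q ^ s\<close>: one factor absorbs
  a single power of \<open>s\<close>, the other the remaining \<open>j\<close> by induction, which
  is therefore stated for arbitrary \<open>q\<close>.\<close>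

lemma power_times_geometric_tendsto_0:
  fixes q :: real
  assumes "0 \<le> q" "q < 1"
  shows "(\<lambda>s. real s ^ j * q ^ s) \<longlonglongrightarrow> 0"
  using assms
proof (induction j arbitrary: q)
  case 0
  then show ?case by (simp add: LIMSEQ_power_zero)
next
  case (Suc j)
  have sq: "0 \<le> sqrt q" "sqrt q < 1" "sqrt q * sqrt q = q" using Suc.prems by auto
  have "(\<lambda>s. (real s * sqrt q ^ s) * (real s ^ j * sqrt q ^ s)) \<longlonglongrightarrow> 0 * 0"
    using powser_times_n_limit_0[of "sqrt q"] Suc.IH[OF sq(1,2)] sq by (intro tendsto_mult) auto
  moreover have eq: "real s ^ Suc j * q ^ s = (real s * sqrt q ^ s) * (real s ^ j * sqrt q ^ s)" for s
  proof -
    have "q ^ s = sqrt q ^ s * sqrt q ^ s" using sq(3) by (metis power_mult_distrib)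
    then show ?thesis by (simp add: mult_ac)
  qed
  ultimately show ?case unfolding eq by simp
qed

lemma poly_times_geometric_tendsto_0:
  fixes q :: real
  assumes "0 \<le> q" "q < 1"
  shows "(\<lambda>s. poly R (real s) * q ^ s) \<longlonglongrightarrow> 0"
proof -
  have "(\<lambda>s. \<Sum>i\<le>degree R. coeff R i * (real s ^ i * q ^ s)) \<longlonglongrightarrow> (\<Sum>i\<le>degree R. coeff R i * 0)"
    by (intro tendsto_sum tendsto_mult_left power_times_geometric_tendsto_0 assms)
  then show ?thesis by (simp add: poly_altdef sum_distrib_right mult.assoc)
qed

context expansions
begin

text \<open>Both conclusions come from one event: with probability tending to 1, every one-step
  problem in the random structure has about the square root of \<open>l n\<close> copies. Extension
  axioms follow by composing steps, saturation by choosing one structure in the event for each large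
  \<open>n\<close>.\<close>

lemma extension_axioms_and_saturation:
  assumes k_pos: "k > 0"
  shows "(\<forall>A B. ext_axiom_pair L \<theta> KK (k - 1) A B \<longrightarrow>
            (\<lambda>n. dc_prob L0 \<theta> (K (G n)) \<rho> (sat_ext_axiom L \<theta> A B)) \<longlonglongrightarrow> 1) \<and>
         poly_saturated L \<theta> KK k"
proof -
  obtain l :: "nat \<Rightarrow> nat" and P :: "real poly" where l_lim: "filterlim l at_top sequentially"
    and l: "\<And>n. l n \<le> card (universe (G n))" "\<And>n. real (card (universe (G n))) \<le> poly P (real (l n))"
      "\<And>n. G_multiplicity n (l n)"
    using G_saturated unfolding poly_saturated_seq_def G_multiplicity_def by blast
  obtain u0 where u0: "\<And>n X. X \<subseteq> universe (G n) \<Longrightarrow> card (clG n X) \<le> u0 (pdim (clG n) X)"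
    using G_bounded unfolding uniformly_bounded_def by blast
  \<comment> \<open>The sum bounds \<open>u0 j\<close> for all dimensions up to \<open>k\<close> at
    once, also when \<open>u0\<close> is not monotone.\<close>
  define u where "u = (\<Sum>j\<le>k. u0 j)"
  have u: "card U \<le> u" if "U \<subseteq> universe (G n)" "clG n U = U" "pdim (clG n) U \<le> k" for n U
  proof -
    have "card U \<le> u0 (pdim (clG n) U)" using u0[OF that(1)] that(2) by simp
    also have "\<dots> \<le> u" unfolding u_def using that(3) by (intro member_le_sum) auto
    finally show ?thesis .
  qed
  \<comment> \<open>Serves both as the number of blocks and as the block size, and later as the
    multiplicity of the new sequence: \<open>s n * s n\<close> is at most \<open>l n\<close>, which
    is at most the square of \<open>1 + s n\<close>.\<close>
  define s where "s n = nat \<lfloor>sqrt (real (l n))\<rfloor>" for n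
  have s_le: "s n * s n \<le> l n" for n
  proof -
    have "real (s n) \<le> sqrt (real (l n))" by (simp add: s_def)
    then have "real (s n) * real (s n) \<le> sqrt (real (l n)) * sqrt (real (l n))"
      by (intro mult_mono) auto
    then have "real (s n * s n) \<le> real (l n)" by simp
    then show ?thesis by (simp only: of_nat_le_iff)
  qed
  have s_ge: "real (l n) \<le> (1 + real (s n))\<^sup>2" for n
  proof -
    have "sqrt (real (l n)) \<le> 1 + real (s n)" unfolding s_def by linarith
    then show ?thesis using real_sqrt_le_iff[of "real (l n)" "(1 + real (s n))\<^sup>2"] by simp
  qed
  have s_lim: "filterlim s at_top sequentially"
    unfolding filterlim_at_top
  proof
    fix Z :: nat
    have "eventually (\<lambda>n. Z * Z \<le> l n) sequentially"
      using l_lim unfolding filterlim_at_top by blast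
    then show "eventually (\<lambda>n. Z \<le> s n) sequentially"
    proof (rule eventually_mono)
      fix n assume "Z * Z \<le> l n"
      then have "real Z * real Z \<le> real (l n)" by (metis of_nat_le_iff of_nat_mult)
      then have "real Z \<le> sqrt (real (l n))" by (simp add: real_le_rsqrt power2_eq_square)
      then show "Z \<le> s n" unfolding s_def by (rule le_nat_floor)
    qed
  qed
  obtain P' where P': "\<And>x y. 0 \<le> x \<Longrightarrow> x \<le> y \<Longrightarrow> \<bar>poly P x\<bar> \<le> poly P' y"
    using poly_monotone_majorant[of P] by blast
  \<comment> \<open>Evaluated at \<open>s n\<close>, this is the majorant of \<open>P\<close> at the
    square of \<open>1 + s n\<close>, hence a bound for the size of \<open>G n\<close>.\<close>
  define Q where "Q = pcompose P' ([:1, 1:] ^ 2)"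
  have card_Q: "real (card (universe (G n))) \<le> poly Q (real (s n))" for n
  proof -
    have "real (card (universe (G n))) \<le> \<bar>poly P (real (l n))\<bar>" using l(2)[of n] by linarith
    also have "\<dots> \<le> poly P' ((1 + real (s n))\<^sup>2)" using s_ge by (intro P') auto
    finally show ?thesis by (simp add: Q_def poly_pcompose)
  qed
  let ?C = "expansion_bound u"
  define q where "q = 1 - 1 / real ?C ^ \<rho>"
  have q: "0 \<le> q" "q < 1" using expansion_bound_ge_1[of u] by (auto simp: q_def)
  \<comment> \<open>The bound of \<open>finite_extension_data\<close> with \<open>Q\<close> in place
    of the size of \<open>G n\<close>, times the number \<open>s n\<close> of blocks.\<close>
  define R where "R = (smult (real (k + 1)) ((Q + 1) ^ k)) ^ 2 * [:real ?C:] * [:0, 1:]"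
  define \<epsilon> where "\<epsilon> n = poly R (real (s n)) * q ^ s n" for n
  have \<epsilon>_lim: "\<epsilon> \<longlonglongrightarrow> 0"
    unfolding \<epsilon>_def using filterlim_compose[OF poly_times_geometric_tendsto_0[OF q] s_lim] .
  have bad: "dc_prob L0 \<theta> (K (G n)) \<rho> (\<lambda>M. \<not> many_copies n (s n) M) \<le> \<epsilon> n" for n
  proof -
    have "real (card (extension_data n)) \<le>
        real (((k + 1) * (card (universe (G n)) + 1) ^ k)\<^sup>2 * ?C)"
      using finite_extension_data(2)[OF u] by (simp only: of_nat_le_iff)
    also have "\<dots> = (real (k + 1) * (real (card (universe (G n))) + 1) ^ k)\<^sup>2 * real ?C"
      by (simp only: of_nat_mult of_nat_power of_nat_add of_nat_1)
    also have "\<dots> \<le> (real (k + 1) * (poly Q (real (s n)) + 1) ^ k)\<^sup>2 * real ?C"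
      using card_Q[of n] by (intro mult_right_mono power_mono mult_left_mono) auto
    finally have "real (card (extension_data n)) * real (s n) \<le>
        (real (k + 1) * (poly Q (real (s n)) + 1) ^ k)\<^sup>2 * real ?C * real (s n)"
      by (rule mult_right_mono) simp
    also have "\<dots> = poly R (real (s n))" by (simp add: R_def)
    finally have "real (card (extension_data n)) * real (s n) \<le> poly R (real (s n))" .
    then have "real (card (extension_data n)) * real (s n) * q ^ s n \<le> \<epsilon> n"
      unfolding \<epsilon>_def using q by (intro mult_right_mono) auto
    moreover have "dc_prob L0 \<theta> (K (G n)) \<rho> (\<lambda>M. \<not> many_copies n (s n) M) \<le>
        real (card (extension_data n) * s n) * q ^ s n"
      unfolding q_def by (rule many_copies_prob[OF _ l(3) s_le]) (rule u)
    ultimately show ?thesis by simp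
  qed
  have one_step: "mult_at_least L \<theta> A B M (s n)"
    if "M \<in> K (G n)" "many_copies n (s n) M" "1 \<le> s n" "represented L KK N"
      "closed_sub L \<theta> A N" "closed_sub L \<theta> B N" "universe A \<subset> universe B"
      "dim_in \<theta> N (universe A) + 1 = dim_in \<theta> N (universe B)" "dim_in \<theta> N (universe B) \<le> k"
    for M n N A B
  proof -
    have "1 \<le> s n * s n" using that(3) by simp
    then have "1 \<le> l n" using s_le[of n] by linarith
    then show ?thesis using one_step_multiplicity l(3) that by blast
  qed
  have s_ev: "eventually (\<lambda>n. 1 \<le> s n) sequentially"
    using s_lim unfolding filterlim_at_top by blast
  show ?thesis
  proof (intro conjI allI impI)
    \<comment> \<open>Since \<open>k > 0\<close>, the subtraction is exact and the dimension bound
      on \<open>B\<close> is \<open>k\<close>.\<close>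
    fix A B assume "ext_axiom_pair L \<theta> KK (k - 1) A B"
    then obtain N where N: "represented L KK N" "closed_sub L \<theta> A N" "closed_sub L \<theta> B N"
        "universe A \<subseteq> universe B" and dimB: "dim_in \<theta> B (universe B) \<le> k"
      using k_pos by (auto simp: ext_axiom_pair_def)
    have "dim_in \<theta> B (universe B) = dim_in \<theta> N (universe B)"
      using sub_closure[OF N(1,3)] by (intro pdim_cong) blast
    then have dim: "dim_in \<theta> N (universe B) \<le> k" using dimB by simp
    show "(\<lambda>n. dc_prob L0 \<theta> (K (G n)) \<rho> (sat_ext_axiom L \<theta> A B)) \<longlonglongrightarrow> 1"
    proof (rule tendsto_sandwich)
      show "eventually (\<lambda>n. dc_prob L0 \<theta> (K (G n)) \<rho> (sat_ext_axiom L \<theta> A B) \<le> 1) sequentially"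
        by (simp add: dc_prob_le_1)
      show "(\<lambda>n. 1 - \<epsilon> n) \<longlonglongrightarrow> 1" using tendsto_diff[OF tendsto_const[of 1] \<epsilon>_lim] by simp
      show "eventually (\<lambda>n. 1 - \<epsilon> n \<le> dc_prob L0 \<theta> (K (G n)) \<rho> (sat_ext_axiom L \<theta> A B)) sequentially"
        using s_ev
      proof (rule eventually_mono)
        fix n assume s1: "1 \<le> s n"
        \<comment> \<open>The event handles all one-step problems simultaneously, so extensions by
          several dimensions follow deterministically on it.\<close>
        have "sat_ext_axiom L \<theta> A B M" if M: "M \<in> K (G n)" "many_copies n (s n) M" for M
          unfolding sat_ext_axiom_def
        proof (rule extension_axiom[OF _ N(1,3) dim N(2,4)])
          fix A B assume "closed_sub L \<theta> A N" "closed_sub L \<theta> B N" "universe A \<subset> universe B"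
            "dim_in \<theta> N (universe A) + 1 = dim_in \<theta> N (universe B)" "dim_in \<theta> N (universe B) \<le> k"
          then show "mult_at_least L \<theta> A B M 1"
            using mult_at_least_mono[OF one_step[OF M s1 N(1)] s1] by blast
        qed
        then have "dc_prob L0 \<theta> (K (G n)) \<rho> (many_copies n (s n)) \<le>
            dc_prob L0 \<theta> (K (G n)) \<rho> (sat_ext_axiom L \<theta> A B)"
          by (rule dc_prob_mono)
        then show "1 - \<epsilon> n \<le> dc_prob L0 \<theta> (K (G n)) \<rho> (sat_ext_axiom L \<theta> A B)"
          using bad[of n] dc_prob_not[of n "many_copies n (s n)"] by linarith
      qed
    qed (rule tendsto_const)
  next
    have "eventually (\<lambda>n. \<epsilon> n < 1 \<and> 1 \<le> s n) sequentially"
      using order_tendstoD(2)[OF \<epsilon>_lim, of 1] s_ev by (intro eventually_conj) auto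
    then obtain n0 where n0: "\<And>n. n \<ge> n0 \<Longrightarrow> \<epsilon> n < 1 \<and> 1 \<le> s n"
      unfolding eventually_sequentially by blast
    \<comment> \<open>If no structure were good, the bad event would have probability 1,
      contradicting the bound \<open>\<epsilon> n < 1\<close>.\<close>
    have ex: "\<exists>M\<in>K (G n). many_copies n (s n) M" if "n \<ge> n0" for n
    proof (rule ccontr)
      assume "\<not> ?thesis"
      then have "dc_prob L0 \<theta> (K (G n)) \<rho> (\<lambda>_. True) \<le>
          dc_prob L0 \<theta> (K (G n)) \<rho> (\<lambda>M. \<not> many_copies n (s n) M)"
        by (intro dc_prob_mono) blast
      then show False using bad[of n] n0[OF that] dc_prob_True[of n] by linarith
    qed
    \<comment> \<open>Good structures are guaranteed only from \<open>n0\<close> on, whereas a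
      saturated sequence must satisfy its conditions at every index; hence the shift.\<close>
    have "\<forall>n. \<exists>M. M \<in> K (G (n + n0)) \<and> many_copies (n + n0) (s (n + n0)) M"
      using ex[OF le_add2] by blast
    then obtain M where M: "\<And>n. M n \<in> K (G (n + n0))" "\<And>n. many_copies (n + n0) (s (n + n0)) (M n)"
      by metis
    have univ: "universe (M n) = universe (G (n + n0))" for n using K_universe[OF M(1)] .
    have "poly_saturated_seq L \<theta> KK k M"
      unfolding poly_saturated_seq_def
    proof (intro conjI allI exI[of _ "\<lambda>n. s (n + n0)"] exI[of _ Q] impI)
      fix n
      show "M n \<in> KK" using M(1) KK_eq by blast
      show "real (card (universe (M n))) \<le> poly Q (real (s (n + n0)))" unfolding univ by (rule card_Q)
      have "s (n + n0) \<le> s (n + n0) * s (n + n0)" by simp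
      then show "s (n + n0) \<le> card (universe (M n))"
        unfolding univ using s_le[of "n + n0"] l(1)[of "n + n0"] by linarith
      fix N A B
      assume *: "represented L KK N \<and> closed_sub L \<theta> A N \<and> closed_sub L \<theta> B N \<and>
        universe A \<subset> universe B \<and> dim_in \<theta> N (universe A) + 1 = dim_in \<theta> N (universe B) \<and>
        dim_in \<theta> N (universe B) \<le> k"
      have "1 \<le> s (n + n0)" using n0[of "n + n0"] by simp
      then show "mult_at_least L \<theta> A B (M n) (s (n + n0))" using one_step[OF M] * by blast
    next
      show "filterlim (\<lambda>n. s (n + n0)) at_top sequentially"
        using filterlim_compose[OF s_lim filterlim_add_const_nat_at_top] .
    qed
    then show "poly_saturated L \<theta> KK k" unfolding poly_saturated_def by blast
  qed
qed

end

theorem theorem7p31: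
  fixes L0 L :: "('f, 'r) vocab"
    and G :: "nat \<Rightarrow> ('a, 'f, 'r) struc"
    and clG :: "nat \<Rightarrow> 'a set \<Rightarrow> 'a set"
    and \<theta> :: "nat \<Rightarrow> ('f, 'r) fm"
    and K :: "('a, 'f, 'r) struc \<Rightarrow> ('a, 'f, 'r) struc set"
    and KK :: "('a, 'f, 'r) struc set"
    and k \<rho> :: nat
  assumes vocab: "subvocab L0 L" "funs L = funs L0" "finite (rels L - rels L0)"
    and G_struc: "\<And>n. is_struc L0 (G n)" "\<And>n. finite (universe (G n))"
    and G_pregeometry: "\<And>n. pregeometry (universe (G n)) (clG n)"
    and G_closed_funs: "\<And>n U f as. U \<subseteq> universe (G n) \<Longrightarrow> clG n U = U \<Longrightarrow> f \<in> funs L0 \<Longrightarrow>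
          as \<in> tuples U (fun_arity L0 f) \<Longrightarrow> fun_int (G n) f as \<in> U"
    and \<theta>_formulas: "\<And>m. fm_in L0 (\<theta> m)" "\<And>m. fm_free (\<theta> m) \<subseteq> {..m}"
    and \<theta>_defines: "\<And>n as b. set as \<subseteq> universe (G n) \<Longrightarrow> b \<in> universe (G n) \<Longrightarrow>
          b \<in> clG n (set as) \<longleftrightarrow> sat_tuple (G n) (\<theta> (length as)) (as @ [b])"
    and K_expansions: "\<And>n M. M \<in> K (G n) \<Longrightarrow> is_struc L M \<and> reduct L0 M = G n"
    and K_nonempty: "\<And>n. K (G n) \<noteq> {}"
    and KK_eq: "KK = (\<Union>n. K (G n))"
    and K_iso_closed: "\<And>n M. represented L KK M \<Longrightarrow> reduct L0 M = G n \<Longrightarrow> M \<in> K (G n)"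
    and sub_represented: "\<And>M A. represented L KK M \<Longrightarrow> closed_sub L \<theta> A M \<Longrightarrow> represented L KK A"
    and sub_closure: "\<And>M A X. represented L KK M \<Longrightarrow> closed_sub L \<theta> A M \<Longrightarrow> X \<subseteq> universe A \<Longrightarrow>
          closure_by \<theta> A X = closure_by \<theta> M X"
    and \<rho>_arity: "\<And>R. R \<in> rels L - rels L0 \<Longrightarrow> rel_arity L R \<le> \<rho>"
    and k_pos: "k > 0"
    and G_bounded: "uniformly_bounded G clG"
    and G_saturated: "poly_saturated_seq L0 \<theta> (range G) k G"
    and K_accepts: "accepts_k_substs L0 L \<theta> KK k"
  shows "(\<forall>A B. ext_axiom_pair L \<theta> KK (k - 1) A B \<longrightarrow>
            (\<lambda>n. dc_prob L0 \<theta> (K (G n)) \<rho> (sat_ext_axiom L \<theta> A B)) \<longlonglongrightarrow> 1) \<and>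
         poly_saturated L \<theta> KK k"
proof -
  interpret expansions L0 L G clG \<theta> K KK k \<rho>
    using assms by unfold_locales
  show ?thesis by (rule extension_axioms_and_saturation[OF k_pos])
qed

end
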